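(* Let $d\ge1$, $\alpha>0$, and let $\{z(x)\}_{x\in\mathbb{Z}^d}$ be non-negative i.i.d. random variables under $\mathbb{P}$ (expectation $\mathbb{E}$) with $\mathbb{P}(z(x)>r)=r^{-\alpha+o(1)}$ as $r\to\infty$. Let $(S_t)_{t\ge 0}$ be the continuous time simple random walk on $\mathbb{Z}^d$ started at $0$ under $P_0$, and let $A_t=\int_0^t z(S_u)\,du$. Suppose that $d=1$ and $\alpha>1$, or $d\ge 2$ and $\alpha>\frac d2$. Then for any $c>\mathbb{E}[z(0)]$, $\mathbb{P}$-almost surely, $$P_0\left(A_t\ge ct\right)=\begin{cases}\exp\left\{-t^{\frac{\alpha-1}{\alpha+1}+o(1)}\right\}, & d=1,\\[5pt] \exp\left\{-t^{\frac{2\alpha-d}{2\alpha+d}+o(1)}\right\}, & d\ge 2,\end{cases}$$ as $t\to\infty$.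
   Context: The scenery $z$ (law $\mathbb{P}$) and the walk (law $P_0$) are independent; $P_0$-probabilities are computed for a fixed (quenched) realization of $z$. The continuous time simple random walk on $\mathbb{Z}^d$ is the nearest neighbor walk with generator $(2d)^{-1}\Delta$, $\Delta$ being the discrete Laplacian (jump rate 1). An equality $F(t)=\exp\{-t^{p+o(1)}\}$ as $t\to\infty$ means $\log(-\log F(t))/\log t\to p$; likewise $\mathbb{P}(z(x)>r)=r^{-\alpha+o(1)}$ means $\log\mathbb{P}(z(x)>r)/\log r\to-\alpha$. *)

theory Defs
  imports "HOL-Probability.Probability"
begin

text \<open>
  The lattice of dimension \<open>d\<close> is \<open>int ^ 'd\<close> with \<open>d = CARD('d)\<close>. It carries no
  further structure here than addition; all topology on it is discrete.
\<close>

definition iid_family :: "'a measure \<Rightarrow> ('i \<Rightarrow> 'a \<Rightarrow> real) \<Rightarrow> bool" where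
  "iid_family M z \<longleftrightarrow>
     prob_space.indep_vars M (\<lambda>_. borel) z UNIV \<and>
     (\<forall>x y. distr M borel (z x) = distr M borel (z y))"

text \<open>
  \<open>G r = r powr (- \<alpha> + o(1))\<close> as \<open>r\<close> tends to infinity. For \<open>\<alpha> > 0\<close> the
  convention \<open>ln 0 = 0\<close> is harmless: the limit forces \<open>G r \<noteq> 0\<close> for large \<open>r\<close>.
\<close>

definition polynomial_decay :: "(real \<Rightarrow> real) \<Rightarrow> real \<Rightarrow> bool" where
  "polynomial_decay G \<alpha> \<longleftrightarrow> ((\<lambda>r. ln (G r) / ln r) \<longlongrightarrow> - \<alpha>) at_top"

text \<open>
  \<open>F t = exp (- (t powr (p + o(1))))\<close> as \<open>t\<close> tends to infinity. For \<open>p > 0\<close> and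
  \<open>F\<close> with values in \<open>[0, 1]\<close> the limit forces \<open>0 < F t < 1\<close> for large \<open>t\<close>, since
  \<open>ln 0 = ln 1 = 0\<close>.
\<close>

definition stretched_exp_decay :: "(real \<Rightarrow> real) \<Rightarrow> real \<Rightarrow> bool" where
  "stretched_exp_decay F p \<longleftrightarrow> ((\<lambda>t. ln (- ln (F t)) / ln t) \<longlongrightarrow> p) at_top"

definition discrete_laplacian :: "(int ^ 'd \<Rightarrow> real) \<Rightarrow> int ^ 'd \<Rightarrow> real" where
  "discrete_laplacian f x =
     (\<Sum>i\<in>UNIV. (f (x + axis i 1) - f x) + (f (x - axis i 1) - f x))"

text \<open>Transition semigroups are indexed by \<open>real\<close>; only times \<open>t \<ge> 0\<close> matter.\<close>

definition markov_semigroup :: "(real \<Rightarrow> 's \<Rightarrow> 's pmf) \<Rightarrow> bool" where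
  "markov_semigroup K \<longleftrightarrow>
     (\<forall>x. K 0 x = return_pmf x) \<and>
     (\<forall>s\<ge>0. \<forall>t\<ge>0. \<forall>x. K (s + t) x = bind_pmf (K s x) (K t))"

text \<open>
  \<open>L\<close> is the generator, everywhere defined on the bounded functions with the
  supremum norm. This is the right notion when the jump rates are bounded.
\<close>

definition has_generator ::
  "(real \<Rightarrow> 's \<Rightarrow> 's pmf) \<Rightarrow> (('s \<Rightarrow> real) \<Rightarrow> 's \<Rightarrow> real) \<Rightarrow> bool" where
  "has_generator K L \<longleftrightarrow>
     (\<forall>f. bounded (range f) \<longrightarrow>
        uniform_limit UNIV
          (\<lambda>t x. (measure_pmf.expectation (K t x) f - f x) / t) (L f) (at_right 0))"

text \<open>
  A Markov process on a countable state space with transition semigroup \<open>K\<close>,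
  started at \<open>x\<^sub>0\<close>. The fourth conjunct is the Markov property with respect to the
  natural filtration, written without conditioning. The last two say that every
  path is right-continuous with left limits in the discrete topology, hence a
  step function with finitely many jumps in every bounded time interval.
\<close>

definition markov_jump_process ::
  "'b measure \<Rightarrow> (real \<Rightarrow> 'b \<Rightarrow> 's::countable) \<Rightarrow> (real \<Rightarrow> 's \<Rightarrow> 's pmf) \<Rightarrow> 's \<Rightarrow> bool" where
  "markov_jump_process N S K x\<^sub>0 \<longleftrightarrow>
     prob_space N \<and>
     (\<forall>t\<ge>0. S t \<in> measurable N (count_space UNIV)) \<and>
     (AE \<omega> in N. S 0 \<omega> = x\<^sub>0) \<and>
     (\<forall>n. \<forall>t :: nat \<Rightarrow> real. \<forall>y :: nat \<Rightarrow> 's.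
        0 \<le> t 0 \<longrightarrow> (\<forall>i\<le>n. t i \<le> t (Suc i)) \<longrightarrow>
        measure N {\<omega> \<in> space N. \<forall>i\<le>Suc n. S (t i) \<omega> = y i} =
        measure N {\<omega> \<in> space N. \<forall>i\<le>n. S (t i) \<omega> = y i} *
        pmf (K (t (Suc n) - t n) (y n)) (y (Suc n))) \<and>
     (\<forall>\<omega>\<in>space N. \<forall>t\<ge>0. eventually (\<lambda>u. S u \<omega> = S t \<omega>) (at_right t)) \<and>
     (\<forall>\<omega>\<in>space N. \<forall>t>0. \<exists>y. eventually (\<lambda>u. S u \<omega> = y) (at_left t))"

definition ct_simple_random_walk ::
  "'b measure \<Rightarrow> (real \<Rightarrow> 'b \<Rightarrow> int ^ 'd) \<Rightarrow> bool" where
  "ct_simple_random_walk N S \<longleftrightarrow>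
     (\<exists>K. markov_semigroup K \<and>
          has_generator K (\<lambda>f x. discrete_laplacian f x / (2 * real CARD('d))) \<and>
          markov_jump_process N S K 0)"

definition scenery_integral ::
  "('s \<Rightarrow> real) \<Rightarrow> (real \<Rightarrow> 's) \<Rightarrow> real \<Rightarrow> real" where
  "scenery_integral \<zeta> s t = (LINT u:{0..t}|lborel. \<zeta> (s u))"

end

theory Submission
  imports Defs "HOL-Real_Asymp.Real_Asymp"
begin

text \<open>
  Write \<open>p\<close> for the exponent, \<open>R = t powr ((1 + p) / 2)\<close>, and let \<open>L\<close> be the generator. Leaving the
  cube of radius \<open>R\<close> costs \<open>exp (- t powr p)\<close>.

  Upper bound. A bounded \<open>\<phi> \<ge> 1\<close> with \<open>L \<phi> + V \<phi> \<le> \<mu> \<phi>\<close> gives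
  \<open>E (exp (\<integral> V)) \<le> sup \<phi> * exp (\<mu> t)\<close>. Take \<open>V = \<theta> z\<close> inside the cube with \<open>\<theta>\<close> slightly below
  \<open>t powr (p - 1)\<close>, and \<open>\<phi> = 1 + (1 + a) \<theta> (g * z)\<close>, where \<open>g\<close> is the Green function of the discrete-time
  walk up to a time \<open>T\<close> with \<open>\<theta> T \<rightarrow> 0\<close>, so that \<open>L g\<close> is the heat kernel at time \<open>T\<close> minus the
  point mass at \<open>0\<close>. Both weighted averages of \<open>z\<close> that occur are at most \<open>E z + o(1)\<close>, uniformly in
  the starting point, by a Chernoff bound: each weight times the largest \<open>z\<close> in the cube is still
  a negative power of \<open>t\<close>. The condition \<open>c > E z\<close> then makes exponential Chebyshev work.

  Lower bound. The walk moves to the largest \<open>z\<close> in the cube and spends enough time there. The local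
  time \<open>l\<close> at that site is bounded below by the Paley--Zygmund inequality for \<open>exp (\<theta> l)\<close>, with a
  subsolution for \<open>\<theta>\<close> and a supersolution for \<open>2 \<theta>\<close>; in dimension one these functions have width of
  order \<open>1 / \<theta>\<close>, in higher dimensions they can be a point mass and a constant.
\<close>

section \<open>Sampled paths\<close>

text \<open>The exponents come from one balance. The maximum of \<open>z\<close> over the cube is
  about \<open>R powr (d / \<alpha>)\<close>. To collect \<open>c * t\<close> from that site alone
  the walk needs local time \<open>l = c * t / max z\<close> there, which up to constants costs
  \<open>exp (- l)\<close> for d \<ge> 2 and \<open>exp (- l^2 / t)\<close> for d = 1. Equating this
  with the cost \<open>exp (- R^2 / t)\<close> of reaching the site fixes \<open>p\<close>. The same
  scales are critical in the upper bound: at \<open>T = t powr (1 - p)\<close> the bound on the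
  weights is the reciprocal of the maximum of \<open>z\<close>, so averaging up to that time only
  just dissolves the highest peak. Hence the small margins \<open>\<delta>\<close> in all exponents.
  For d \<ge> 2 the Green function divided by \<open>T\<close> is at least \<open>1 / T\<close> at
  the origin, so a faster decay of the heat kernel would gain nothing and all these dimensions share
  one exponent. Since \<alpha> may be below 2, variances may be infinite; the Chernoff bound
  therefore uses the mean alone. The corrector is built from the discrete-time walk because its
  kernels have finite range: uniformity over all starting points then reduces to finitely many of
  them.\<close>

lemma finite_range_path:
  fixes s :: "real \<Rightarrow> 's"
  assumes rc: "\<And>t. t \<ge> 0 \<Longrightarrow> eventually (\<lambda>u. s u = s t) (at_right t)"
    and ll: "\<And>t. t > 0 \<Longrightarrow> \<exists>y. eventually (\<lambda>u. s u = y) (at_left t)"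
  shows "finite (s ` {0..T})"
proof -
  \<comment> \<open>Near any time the path takes at most two values, its left limit and its present
    value; compactness of \<open>{0..T}\<close> leaves finitely many. This is what bounds an
    unbounded scenery along a path.\<close>
  have "\<exists>U. open U \<and> u \<in> U \<and> finite (s ` (U \<inter> {0..T}))" if u: "u \<in> {0..T}" for u
  proof -
    from rc[of u] u obtain b where b: "b > u" "\<And>v. u < v \<Longrightarrow> v < b \<Longrightarrow> s v = s u"
      unfolding eventually_at_right_field by auto
    obtain a y where a: "a < u" "\<And>v. a < v \<Longrightarrow> v < u \<Longrightarrow> v \<ge> 0 \<Longrightarrow> s v = y"
    proof (cases "u > 0")
      case True
      then obtain y where "eventually (\<lambda>v. s v = y) (at_left u)" using ll by blast
      then show thesis using that unfolding eventually_at_left_field by auto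
    next
      case False
      \<comment> \<open>At time 0 no admissible time lies to the left, so the left value is
        arbitrary.\<close>
      then show thesis using that[of "u - 1" undefined] u by auto
    qed
    have "s ` ({a<..<b} \<inter> {0..T}) \<subseteq> {y, s u}"
      using a b u by (auto) (metis linorder_neqE_linordered_idom)
    then have "finite (s ` ({a<..<b} \<inter> {0..T}))"
      using finite_subset by blast
    then show ?thesis using a b by (intro exI[of _ "{a<..<b}"]) auto
  qed
  then obtain U where U: "\<And>u. u \<in> {0..T} \<Longrightarrow> open (U u) \<and> u \<in> U u \<and> finite (s ` (U u \<inter> {0..T}))"
    by metis
  have "compact {0..T}" by simp
  then obtain F where F: "F \<subseteq> {0..T}" "finite F" "{0..T} \<subseteq> (\<Union>u\<in>F. U u)"
    using U by (elim compactE_image[where C="{0..T}" and f=U]) auto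
  have "s ` {0..T} \<subseteq> (\<Union>u\<in>F. s ` (U u \<inter> {0..T}))" using F by blast
  moreover have "finite (\<Union>u\<in>F. s ` (U u \<inter> {0..T}))" using F U by auto
  ultimately show ?thesis by (rule finite_subset)
qed

text \<open>Sampling at the right end point of each cell makes the step functions
  converge at every time, since the path is right-continuous.\<close>

lemma riemann_sum_path:
  fixes s :: "real \<Rightarrow> 's" and \<zeta> :: "'s \<Rightarrow> real"
  assumes rc: "\<And>t. t \<ge> 0 \<Longrightarrow> eventually (\<lambda>u. s u = s t) (at_right t)"
    and ll: "\<And>t. t > 0 \<Longrightarrow> \<exists>y. eventually (\<lambda>u. s u = y) (at_left t)"
    and a: "0 \<le> a" and T: "0 < T"
  shows "set_integrable lborel {a..a+T} (\<lambda>u. \<zeta> (s u))"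
    and "(\<lambda>n. T / real (Suc n) * (\<Sum>j<Suc n. \<zeta> (s (a + real j * (T / real (Suc n))))))
          \<longlonglongrightarrow> (LINT u:{a..a+T}|lborel. \<zeta> (s u))"
proof -
  define h where "h n = T / real (Suc n)" for n
  have h0: "h n > 0" for n using T by (simp add: h_def)
  have hS: "h n * real (Suc n) = T" for n by (simp add: h_def)
  have fin: "finite (s ` {0..a+T})" by (rule finite_range_path[OF rc ll])
  define C where "C = Max (insert 0 ((\<lambda>y. \<bar>\<zeta> y\<bar>) ` s ` {0..a+T}))"
  have C: "\<bar>\<zeta> (s u)\<bar> \<le> C" if "0 \<le> u" "u \<le> a + T" for u
    unfolding C_def using fin that by (intro Max_ge) auto
  have C0: "0 \<le> C" unfolding C_def using fin by (intro Max_ge) auto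
  define I where "I n j = {a + real j * h n <.. a + real (Suc j) * h n}" for n j
  define g where "g n u = (\<Sum>j<Suc n. \<zeta> (s (a + real (Suc j) * h n)) * indicator (I n j) u)" for n u
  define f where "f u = indicator {a<..a+T} u * \<zeta> (s u)" for u
  have g_eq: "\<exists>v\<in>{u..<u + h n}. v \<le> a + T \<and> g n u = \<zeta> (s v)" if u: "u \<in> {a<..a+T}" for n u
  proof -
    \<comment> \<open>Cells are open on the left and closed on the right, so the ceiling picks the
      cell that contains \<open>u\<close>, and its right end point is less than one mesh width
      later.\<close>
    define c where "c = \<lceil>(u - a) / h n\<rceil>"
    have c: "of_int c - 1 < (u - a) / h n" "(u - a) / h n \<le> of_int c"
      unfolding c_def by linarith+
    have "0 < (u - a) / h n" using u h0[of n] by simp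
    with c have c1: "c \<ge> 1" by linarith
    have "(u - a) / h n \<le> real (Suc n)" using u h0[of n] hS[of n]
      by (simp add: divide_le_eq mult.commute)
    with c have "real_of_int c < real (Suc n) + 1" by linarith
    then have cn: "c \<le> int (Suc n)" by linarith
    define j where "j = nat (c - 1)"
    have j: "real (Suc j) = of_int c" "j < Suc n" using c1 cn by (auto simp: j_def)
    have uI: "u \<in> I n i \<longleftrightarrow> i = j" for i
    proof -
      have "u \<in> I n i \<longleftrightarrow> real i < (u - a) / h n \<and> (u - a) / h n \<le> real (Suc i)"
        unfolding I_def using h0[of n] by (auto simp: field_simps)
      also have "\<dots> \<longleftrightarrow> i = j" using c j by (auto; linarith)
      finally show ?thesis .
    qed
    have "g n u = \<zeta> (s (a + real (Suc j) * h n))"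
      unfolding g_def using j(2) by (subst sum.remove[of _ j]) (auto simp: uI indicator_def intro!: sum.neutral)
    moreover have "a + real (Suc j) * h n \<in> {u..<u + h n}"
      using c h0[of n] unfolding j(1) by (auto simp: field_simps)
    moreover have "real (Suc j) * h n \<le> real (Suc n) * h n"
      using j(2) h0[of n] by (intro mult_right_mono) auto
    then have "a + real (Suc j) * h n \<le> a + T" using hS[of n] by (simp add: mult.commute)
    ultimately show ?thesis by blast
  qed
  have g_out: "g n u = 0" if "u \<notin> {a<..a+T}" for n u
  proof -
    have "u \<notin> I n j" if "j < Suc n" for j
    proof -
      have "real (Suc j) * h n \<le> real (Suc n) * h n"
        using that h0[of n] by (intro mult_right_mono) auto
      then have "real (Suc j) * h n \<le> T" using hS[of n] by (simp add: mult.commute)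
      moreover have "0 \<le> real j * h n" using h0[of n] by simp
      ultimately show ?thesis using \<open>u \<notin> {a<..a+T}\<close> unfolding I_def
        by (simp) linarith
    qed
    then show ?thesis unfolding g_def by (intro sum.neutral) (auto simp: indicator_def)
  qed
  have gm: "g n \<in> borel_measurable lborel" for n
    unfolding g_def I_def by measurable
  have hlim: "h \<longlonglongrightarrow> 0" unfolding h_def by real_asymp
  have lim: "(\<lambda>n. g n u) \<longlonglongrightarrow> f u" for u
  proof (cases "u \<in> {a<..a+T}")
    case False then show ?thesis using g_out by (simp add: f_def)
  next
    case True
    from rc[of u] True a obtain b where b: "b > u" "\<And>v. u < v \<Longrightarrow> v < b \<Longrightarrow> s v = s u"
      unfolding eventually_at_right_field by auto
    have "eventually (\<lambda>n. h n < b - u) sequentially"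
      using order_tendstoD(2)[OF hlim, of "b - u"] b by simp
    then have "eventually (\<lambda>n. g n u = f u) sequentially"
    proof eventually_elim
      case (elim n)
      obtain v where v: "v \<in> {u..<u + h n}" "g n u = \<zeta> (s v)" using g_eq[OF True] by blast
      have "s v = s u" using v b elim by (cases "v = u") auto
      then show ?case using v True by (simp add: f_def)
    qed
    then show ?thesis by (rule tendsto_eventually)
  qed
  have fm: "f \<in> borel_measurable lborel"
    using lim gm by (intro borel_measurable_LIMSEQ_real[of lborel g f]) auto
  have bnd: "\<bar>g n u\<bar> \<le> C * indicator {a<..a+T} u" for n u
  proof (cases "u \<in> {a<..a+T}")
    case True
    obtain v where v: "v \<in> {u..<u + h n}" "v \<le> a + T" "g n u = \<zeta> (s v)" using g_eq[OF True] by blast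
    then show ?thesis using C[of v] a True by auto
  qed (simp add: g_out)
  have wi: "integrable lborel (\<lambda>u. C * indicator {a<..a+T} u :: real)"
    by (intro integrable_mult_right integrable_real_indicator) (auto simp: emeasure_lborel_Ioc T less_imp_le)
  have fi: "integrable lborel f"
    by (rule integrable_dominated_convergence[where w="\<lambda>u. C * indicator {a<..a+T} u" and s=g])
      (use lim fm gm wi bnd in auto)
  have conv: "(\<lambda>n. integral\<^sup>L lborel (g n)) \<longlonglongrightarrow> integral\<^sup>L lborel f"
    by (rule integral_dominated_convergence[where w="\<lambda>u. C * indicator {a<..a+T} u"])
      (use lim fm gm wi bnd in auto)
  have intg: "integral\<^sup>L lborel (g n) = h n * (\<Sum>j<Suc n. \<zeta> (s (a + real (Suc j) * h n)))" for n
  proof -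
    have m: "measure lborel (I n j) = h n" "emeasure lborel (I n j) < \<infinity>" for j
      using h0[of n] by (auto simp: I_def algebra_simps emeasure_lborel_Ioc)
    have "integral\<^sup>L lborel (g n) = (\<Sum>j<Suc n. \<zeta> (s (a + real (Suc j) * h n)) * h n)"
      unfolding g_def using m
      by (subst Bochner_Integration.integral_sum) (auto intro!: integrable_mult_right integrable_real_indicator simp: I_def)
    then show ?thesis by (simp only: sum_distrib_left mult.commute)
  qed
  have ae: "AE u in lborel. f u = indicator {a..a+T} u *\<^sub>R \<zeta> (s u)"
    using AE_lborel_singleton[of a] by eventually_elim (auto simp: f_def indicator_def)
  let ?F = "\<lambda>u. indicator {a..a+T} u *\<^sub>R \<zeta> (s u)"
  \<comment> \<open>Equality off the null set \<open>{a}\<close> does not give measurability of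
    \<open>?F\<close>, hence the explicit form: \<open>f\<close> changed at one point.\<close>
  have Feq: "?F = (\<lambda>u. if u = a then \<zeta> (s a) else f u)"
    using T by (auto simp: fun_eq_iff f_def indicator_def)
  have Fm: "?F \<in> borel_measurable lborel" unfolding Feq using fm by measurable
  show "set_integrable lborel {a..a+T} (\<lambda>u. \<zeta> (s u))"
    unfolding set_integrable_def using integrable_cong_AE[OF fm Fm ae] fi by simp
  have intf: "(LINT u:{a..a+T}|lborel. \<zeta> (s u)) = integral\<^sup>L lborel f"
    unfolding set_lebesgue_integral_def using integral_cong_AE[OF fm Fm ae] by simp
  \<comment> \<open>The step functions sample at right end points, the claim at left end points. The
    difference telescopes to two boundary values times \<open>h n\<close>.\<close>
  have "(\<lambda>n. integral\<^sup>L lborel (g n) + h n * (\<zeta> (s a) - \<zeta> (s (a + T)))) \<longlonglongrightarrow>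
      integral\<^sup>L lborel f + 0 * (\<zeta> (s a) - \<zeta> (s (a + T)))"
    by (intro tendsto_intros conv hlim)
  moreover have "integral\<^sup>L lborel (g n) + h n * (\<zeta> (s a) - \<zeta> (s (a + T))) =
     h n * (\<Sum>j<Suc n. \<zeta> (s (a + real j * h n)))" for n
  proof -
    have "(\<Sum>j<Suc n. \<zeta> (s (a + real (Suc j) * h n)) - \<zeta> (s (a + real j * h n)))
       = \<zeta> (s (a + real (Suc n) * h n)) - \<zeta> (s (a + real 0 * h n))"
      by (rule sum_lessThan_telescope)
    then have "(\<Sum>j<Suc n. \<zeta> (s (a + real (Suc j) * h n))) =
       (\<Sum>j<Suc n. \<zeta> (s (a + real j * h n))) + \<zeta> (s (a + T)) - \<zeta> (s a)"
      using hS[of n] unfolding sum_subtractf by (simp add: mult.commute del: sum.lessThan_Suc)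
    then show ?thesis unfolding intg by (simp only:) (simp add: algebra_simps)
  qed
  ultimately show "(\<lambda>n. T / real (Suc n) * (\<Sum>j<Suc n. \<zeta> (s (a + real j * (T / real (Suc n))))))
          \<longlonglongrightarrow> (LINT u:{a..a+T}|lborel. \<zeta> (s u))"
    unfolding intf by (simp add: h_def[symmetric] del: sum.lessThan_Suc of_nat_Suc)
qed

section \<open>Feynman--Kac bounds for jump processes\<close>

text \<open>Newest state first, so that the Markov property peels off the head of the list.\<close>

primrec path_pmf :: "'s pmf \<Rightarrow> ('s \<Rightarrow> 's pmf) \<Rightarrow> nat \<Rightarrow> 's list pmf" where
  "path_pmf p Q 0 = map_pmf (\<lambda>x. [x]) p"
| "path_pmf p Q (Suc n) = bind_pmf (path_pmf p Q n) (\<lambda>ys. map_pmf (\<lambda>y. y # ys) (Q (hd ys)))"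

lemma length_path_pmf: "ys \<in> set_pmf (path_pmf p Q n) \<Longrightarrow> length ys = Suc n"
  by (induction n arbitrary: ys) auto

lemma pmf_path_Suc:
  "pmf (path_pmf p Q (Suc n)) (y # ys) = pmf (path_pmf p Q n) ys * pmf (Q (hd ys)) y"
proof -
  have "pmf (map_pmf (\<lambda>y. y # zs) (Q (hd zs))) (y # ys) =
      indicator {ys} zs * pmf (Q (hd ys)) y" for zs
  proof (cases "zs = ys")
    case True
    have "inj (\<lambda>y. y # ys)" by (auto simp: inj_def)
    then show ?thesis using pmf_map_inj'[of "\<lambda>y. y # ys" "Q (hd ys)" y] True by simp
  next
    case False
    then have "y # ys \<notin> set_pmf (map_pmf (\<lambda>y. y # zs) (Q (hd zs)))" by auto
    then have "pmf (map_pmf (\<lambda>y. y # zs) (Q (hd zs))) (y # ys) = 0"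
      by (rule pmf_eq_0_set_pmf[THEN iffD2])
    then show ?thesis using False by simp
  qed
  then show ?thesis by (simp add: pmf_bind measure_pmf_single)
qed

text \<open>One step of a discrete Feynman-Kac semigroup. The weight is collected before the jump,
  so \<open>n\<close> iterations carry the weights of the times 0 to n - 1, and the final state
  enters through \<open>u\<close> only.\<close>

definition fk :: "('s \<Rightarrow> real) \<Rightarrow> ('s \<Rightarrow> 's pmf) \<Rightarrow> ('s \<Rightarrow> real) \<Rightarrow> 's \<Rightarrow> real" where
  "fk e Q u x = e x * measure_pmf.expectation (Q x) u"

lemma integrable_pmf_bounded:
  fixes u :: "'s \<Rightarrow> real"
  assumes "\<And>x. 0 \<le> u x" "\<And>x. u x \<le> U"
  shows "integrable (measure_pmf p) u"
  using assms by (intro measure_pmf.integrable_const_bound[where B=U]) auto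

lemma expectation_pmf_mono:
  fixes u v :: "'s \<Rightarrow> real"
  assumes "\<And>x. 0 \<le> u x" "\<And>x. u x \<le> v x" "\<And>x. v x \<le> B"
  shows "measure_pmf.expectation p u \<le> measure_pmf.expectation p v"
  using assms by (intro integral_mono integrable_pmf_bounded[where U=B]) (meson order_trans)+

lemma fk_bounds:
  assumes "\<And>x. 0 \<le> e x" "\<And>x. e x \<le> E" "\<And>x. 0 \<le> u x" "\<And>x. u x \<le> U"
  shows "0 \<le> fk e Q u x" "fk e Q u x \<le> E * U"
proof -
  have "measure_pmf.expectation (Q x) u \<le> measure_pmf.expectation (Q x) (\<lambda>_. U)"
    using assms by (intro expectation_pmf_mono[where B=U]) auto
  moreover have "0 \<le> measure_pmf.expectation (Q x) u" using assms by simp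
  moreover have "0 \<le> E" using assms(1,2) order_trans by blast
  ultimately show "0 \<le> fk e Q u x" "fk e Q u x \<le> E * U"
    unfolding fk_def using assms by (auto intro!: mult_nonneg_nonneg mult_mono)
qed

lemma fk_iter_bounds:
  assumes "\<And>x. 0 \<le> e x" "\<And>x. e x \<le> E" "\<And>x. 0 \<le> u x" "\<And>x. u x \<le> U"
  shows "0 \<le> (fk e Q ^^ n) u x \<and> (fk e Q ^^ n) u x \<le> E ^ n * U"
proof (induction n arbitrary: x)
  case (Suc n)
  show ?case using fk_bounds[of e E "(fk e Q ^^ n) u" "E ^ n * U" Q x] Suc assms(1,2)
    by (simp add: mult.assoc)
qed (use assms in auto)

lemma fk_iter_swap: "(fk e Q ^^ n) (fk e Q u) = (fk e Q ^^ Suc n) u"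
  by (metis comp_apply funpow_Suc_right)

text \<open>Integrating out the newest state turns the terminal function \<open>u\<close> into
  \<open>fk e Q u\<close>; hence the induction with \<open>u\<close> and its bound arbitrary. The
  oldest state is the last entry of the list and is pinned to \<open>x\<close>, which makes the
  initial law factor out.\<close>

lemma nn_integral_path_pmf:
  assumes e: "\<And>x. 0 \<le> e x" "\<And>x. e x \<le> E" and u: "\<And>x. 0 \<le> u x" "\<And>x. u x \<le> U"
  shows "(\<integral>\<^sup>+ ys. ennreal (of_bool (last ys = x) * prod_list (map e (tl ys)) * u (hd ys)) \<partial>path_pmf p Q n)
     = ennreal (pmf p x * (fk e Q ^^ n) u x)"
  using u
proof (induction n arbitrary: u U)
  case 0
  have "(\<integral>\<^sup>+ y. ennreal (of_bool (y = x) * u y) \<partial>measure_pmf p)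
      = (\<integral>\<^sup>+ y. ennreal (u x) * indicator {x} y \<partial>measure_pmf p)"
    by (intro nn_integral_cong) (auto simp: indicator_def)
  also have "\<dots> = ennreal (u x) * ennreal (pmf p x)"
    by (subst nn_integral_cmult_indicator) (auto simp: emeasure_pmf_single)
  finally show ?case using 0 by (simp add: ennreal_mult'' mult.commute)
next
  case (Suc n)
  have p0: "0 \<le> prod_list (map e ys)" for ys using e by (induction ys) auto
  have "(\<integral>\<^sup>+ ys. ennreal (of_bool (last ys = x) * prod_list (map e (tl ys)) * u (hd ys)) \<partial>path_pmf p Q (Suc n))
    = (\<integral>\<^sup>+ ys. (\<integral>\<^sup>+ y. ennreal (of_bool (last (y # ys) = x) * prod_list (map e ys) * u y) \<partial>Q (hd ys)) \<partial>path_pmf p Q n)"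
    by simp
  also have "\<dots> = (\<integral>\<^sup>+ ys. ennreal (of_bool (last ys = x) * prod_list (map e (tl ys)) * fk e Q u (hd ys)) \<partial>path_pmf p Q n)"
  proof (intro nn_integral_cong_AE AE_pmfI)
    fix ys assume "ys \<in> set_pmf (path_pmf p Q n)"
    then have "length ys = Suc n" by (rule length_path_pmf)
    then obtain z zs where ys: "ys = z # zs" by (cases ys) auto
    have "(\<integral>\<^sup>+ y. ennreal (of_bool (last (y # ys) = x) * prod_list (map e ys) * u y) \<partial>Q (hd ys))
      = (\<integral>\<^sup>+ y. ennreal (of_bool (last ys = x) * prod_list (map e ys)) * ennreal (u y) \<partial>Q (hd ys))"
      using p0[of ys] Suc.prems
      by (intro nn_integral_cong, subst ennreal_mult[symmetric]) (auto simp: ys last_ConsR simp del: last.simps list.map prod_list.Cons)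
    also have "\<dots> = ennreal (of_bool (last ys = x) * prod_list (map e ys)) * ennreal (measure_pmf.expectation (Q (hd ys)) u)"
      using Suc.prems by (simp add: nn_integral_cmult nn_integral_eq_integral integrable_pmf_bounded[where U=U])
    also have "\<dots> = ennreal (of_bool (last ys = x) * prod_list (map e (tl ys)) * fk e Q u (hd ys))"
      using p0 e Suc.prems
      by (subst ennreal_mult[symmetric]) (auto simp: ys fk_def mult_ac simp del: last.simps intro!: mult_nonneg_nonneg)
    finally show "(\<integral>\<^sup>+ y. ennreal (of_bool (last (y # ys) = x) * prod_list (map e ys) * u y) \<partial>Q (hd ys)) =
      ennreal (of_bool (last ys = x) * prod_list (map e (tl ys)) * fk e Q u (hd ys))" .
  qed
  also have "\<dots> = ennreal (pmf p x * (fk e Q ^^ n) (fk e Q u) x)"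
    using fk_bounds[of e E u U Q] e Suc.prems by (intro Suc.IH[where U="E * U"]) auto
  finally show ?case by (simp only: fk_iter_swap)
qed

section \<open>Finite-dimensional laws of a jump process\<close>

locale jump_process =
  fixes N :: "'b measure" and S :: "real \<Rightarrow> 'b \<Rightarrow> 's::countable" and K :: "real \<Rightarrow> 's \<Rightarrow> 's pmf"
    and x\<^sub>0 :: 's and L :: "('s \<Rightarrow> real) \<Rightarrow> 's \<Rightarrow> real"
  assumes mjp: "markov_jump_process N S K x\<^sub>0"
    and semigroup: "markov_semigroup K"
    and gen: "has_generator K L"
begin

sublocale prob_space N using mjp by (simp add: markov_jump_process_def)

lemma S_measurable: "t \<ge> 0 \<Longrightarrow> S t \<in> measurable N (count_space UNIV)"
  using mjp by (simp add: markov_jump_process_def)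

lemma S_rc: "\<eta> \<in> space N \<Longrightarrow> t \<ge> 0 \<Longrightarrow> eventually (\<lambda>u. S u \<eta> = S t \<eta>) (at_right t)"
  using mjp by (simp add: markov_jump_process_def)

lemma S_ll: "\<eta> \<in> space N \<Longrightarrow> t > 0 \<Longrightarrow> \<exists>y. eventually (\<lambda>u. S u \<eta> = y) (at_left t)"
  using mjp by (simp add: markov_jump_process_def)

lemma S_markov:
  "0 \<le> t 0 \<Longrightarrow> (\<And>i. i \<le> n \<Longrightarrow> t i \<le> t (Suc i)) \<Longrightarrow>
   prob {\<omega> \<in> space N. \<forall>i\<le>Suc n. S (t i) \<omega> = y i} =
   prob {\<omega> \<in> space N. \<forall>i\<le>n. S (t i) \<omega> = y i} * pmf (K (t (Suc n) - t n) (y n)) (y (Suc n))"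
  using mjp by (simp add: markov_jump_process_def)

lemma S_fun_measurable: "t \<ge> 0 \<Longrightarrow> (\<lambda>\<eta>. f (S t \<eta>)) \<in> borel_measurable N"
  by (rule measurable_compose[OF S_measurable]) auto

lemma S_pred_sets: "t \<ge> 0 \<Longrightarrow> {\<eta> \<in> space N. P (S t \<eta>)} \<in> sets N"
  using measurable_sets[OF S_measurable[of t], of "Collect P"] by (simp add: vimage_def Int_def conj_commute)

lemma K_0: "K 0 x = return_pmf x"
  using semigroup by (simp add: markov_semigroup_def)

lemma prob_S: assumes "t \<ge> 0" shows "prob {\<eta> \<in> space N. S t \<eta> = y} = pmf (K t x\<^sub>0) y"
proof -
  have ae: "AE \<eta> in N. S 0 \<eta> = x\<^sub>0" using mjp by (simp add: markov_jump_process_def)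
  define tt where "tt i = (if i = 0 then 0 else t)" for i :: nat
  define yy where "yy i = (if i = 0 then x\<^sub>0 else y)" for i :: nat
  have "prob {\<eta> \<in> space N. \<forall>i\<le>Suc 0. S (tt i) \<eta> = yy i} =
      prob {\<eta> \<in> space N. \<forall>i\<le>0. S (tt i) \<eta> = yy i} * pmf (K (tt (Suc 0) - tt 0) (yy 0)) (yy (Suc 0))"
    by (rule S_markov) (use assms in \<open>auto simp: tt_def\<close>)
  moreover have "{\<eta> \<in> space N. \<forall>i\<le>Suc 0. S (tt i) \<eta> = yy i} = {\<eta> \<in> space N. S 0 \<eta> = x\<^sub>0 \<and> S t \<eta> = y}"
    by (auto simp: tt_def yy_def le_Suc_eq)
  moreover have "prob {\<eta> \<in> space N. S 0 \<eta> = x\<^sub>0 \<and> S t \<eta> = y} = prob {\<eta> \<in> space N. S t \<eta> = y}"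
    using ae assms by (intro finite_measure_eq_AE) (auto intro!: sets.sets_Collect_conj S_pred_sets)
  moreover have "prob {\<eta> \<in> space N. \<forall>i\<le>0. S (tt i) \<eta> = yy i} = 1"
    using ae S_pred_sets[of 0 "\<lambda>y. y = x\<^sub>0"] prob_Collect_eq_1[of "\<lambda>\<eta>. S 0 \<eta> = x\<^sub>0"]
    by (simp add: tt_def yy_def)
  ultimately show ?thesis by (simp add: tt_def yy_def)
qed

abbreviation "skel a h n \<eta> \<equiv> rev (map (\<lambda>j. S (a + real j * h) \<eta>) [0..<Suc n])"

text \<open>For lists of the wrong length both sides vanish. The identity therefore covers all point
  masses on the countable type of lists and determines the image law.\<close>

lemma prob_skel:
  assumes a: "a \<ge> 0" and h: "h \<ge> 0"
  shows "prob {\<eta> \<in> space N. skel a h n \<eta> = ys} = pmf (path_pmf (K a x\<^sub>0) (K h) n) ys"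
proof (induction n arbitrary: ys)
  case 0
  show ?case
  proof (cases "\<exists>y. ys = [y]")
    case True
    then obtain y where ys: "ys = [y]" by blast
    have "inj (\<lambda>y::'s. [y])" by (auto simp: inj_def)
    then have "pmf (map_pmf (\<lambda>x. [x]) (K a x\<^sub>0)) [y] = pmf (K a x\<^sub>0) y"
      using pmf_map_inj'[of "\<lambda>y. [y]" "K a x\<^sub>0" y] by simp
    then show ?thesis using prob_S[OF a, of y] by (simp add: ys)
  next
    case False
    then have "ys \<notin> set_pmf (path_pmf (K a x\<^sub>0) (K h) 0)" by auto
    then have "pmf (path_pmf (K a x\<^sub>0) (K h) 0) ys = 0" by (rule pmf_eq_0_set_pmf[THEN iffD2])
    moreover have "{\<eta> \<in> space N. skel a h 0 \<eta> = ys} = {}" using False by auto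
    ultimately show ?thesis by (simp only: measure_empty)
  qed
next
  case (Suc n)
  have len: "length (skel a h m \<eta>) = Suc m" for m \<eta> by simp
  show ?case
  proof (cases "length ys = Suc (Suc n)")
    case False
    then have "ys \<notin> set_pmf (path_pmf (K a x\<^sub>0) (K h) (Suc n))" using length_path_pmf by metis
    then have "pmf (path_pmf (K a x\<^sub>0) (K h) (Suc n)) ys = 0" by (rule pmf_eq_0_set_pmf[THEN iffD2])
    moreover have "skel a h (Suc n) \<eta> \<noteq> ys" for \<eta>
    proof
      assume "skel a h (Suc n) \<eta> = ys"
      then have "length (skel a h (Suc n) \<eta>) = length ys" by (rule arg_cong)
      then show False using False unfolding len by simp
    qed
    then have "{\<eta> \<in> space N. skel a h (Suc n) \<eta> = ys} = {}" by blast
    ultimately show ?thesis by (simp only: measure_empty)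
  next
    case True
    then obtain z zs where ys: "ys = z # zs" and lz: "length zs = Suc n" by (cases ys) auto
    define y where "y i = rev ys ! i" for i
    have eq: "skel a h m \<eta> = ws \<longleftrightarrow> (\<forall>i\<le>m. S (a + real i * h) \<eta> = rev ws ! i)"
      if "length ws = Suc m" for m \<eta> ws
    proof -
      have "skel a h m \<eta> = ws \<longleftrightarrow> map (\<lambda>j. S (a + real j * h) \<eta>) [0..<Suc m] = rev ws"
        by (rule rev_swap)
      also have "\<dots> \<longleftrightarrow> (\<forall>i<Suc m. S (a + real i * h) \<eta> = rev ws ! i)"
        using that unfolding list_eq_iff_nth_eq by (simp del: upt_Suc)
      finally show ?thesis by (simp add: less_Suc_eq_le)
    qed
    have y1: "rev zs ! i = y i" if "i \<le> n" for i
      using that lz by (simp add: y_def ys nth_append)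
    have y2: "y (Suc n) = z" using lz by (simp add: y_def ys nth_append)
    have y3: "y n = hd zs" using lz by (cases zs) (auto simp: y_def ys nth_append)
    have "prob {\<eta> \<in> space N. skel a h (Suc n) \<eta> = ys} =
        prob {\<eta> \<in> space N. \<forall>i\<le>Suc n. S (a + real i * h) \<eta> = y i}"
      unfolding eq[OF True] y_def ..
    also have "\<dots> = prob {\<eta> \<in> space N. \<forall>i\<le>n. S (a + real i * h) \<eta> = y i} *
        pmf (K ((a + real (Suc n) * h) - (a + real n * h)) (y n)) (y (Suc n))"
      by (rule S_markov) (use a h in \<open>auto simp: algebra_simps\<close>)
    also have "{\<eta> \<in> space N. \<forall>i\<le>n. S (a + real i * h) \<eta> = y i} = {\<eta> \<in> space N. skel a h n \<eta> = zs}"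
      unfolding eq[OF lz] using y1 by auto
    also have "(a + real (Suc n) * h) - (a + real n * h) = h" by (simp add: algebra_simps)
    finally show ?thesis unfolding Suc.IH ys pmf_path_Suc y2 y3 .
  qed
qed

lemma skel_measurable:
  assumes "a \<ge> 0" "h \<ge> 0"
  shows "skel a h n \<in> measurable N (count_space UNIV)"
proof (induction n)
  case 0
  have "(\<lambda>\<eta>. [S a \<eta>]) \<in> measurable N (count_space UNIV)"
    by (rule measurable_compose[OF S_measurable[OF assms(1)]]) simp
  then show ?case by simp
next
  case (Suc n)
  have "(\<lambda>\<eta>. (S (a + real (Suc n) * h) \<eta>, skel a h n \<eta>)) \<in> measurable N (count_space UNIV \<Otimes>\<^sub>M count_space UNIV)"
    using Suc assms by (intro measurable_Pair S_measurable) auto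
  then have "(\<lambda>\<eta>. (S (a + real (Suc n) * h) \<eta>, skel a h n \<eta>)) \<in> measurable N (count_space UNIV)"
    by (simp add: pair_measure_countable)
  then have "(\<lambda>\<eta>. case_prod (#) (S (a + real (Suc n) * h) \<eta>, skel a h n \<eta>)) \<in> measurable N (count_space UNIV)"
    by (rule measurable_compose) simp
  then show ?case by (simp del: of_nat_Suc)
qed

lemma distr_skel:
  assumes "a \<ge> 0" "h \<ge> 0"
  shows "distr N (count_space UNIV) (skel a h n) = measure_pmf (path_pmf (K a x\<^sub>0) (K h) n)"
proof (rule measure_eqI_countable)
  fix ys :: "'s list"
  have "emeasure (distr N (count_space UNIV) (skel a h n)) {ys} =
      emeasure N {\<eta> \<in> space N. skel a h n \<eta> = ys}"
    using skel_measurable[OF assms, of n]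
    by (subst emeasure_distr) (auto intro!: arg_cong[where f="emeasure N"])
  then show "emeasure (distr N (count_space UNIV) (skel a h n)) {ys} =
      emeasure (measure_pmf (path_pmf (K a x\<^sub>0) (K h) n)) {ys}"
    by (simp only: emeasure_eq_measure prob_skel[OF assms] emeasure_pmf_single)
qed auto

text \<open>The indicator of \<open>S a = x\<close> takes the place of restarting the process at
  \<open>x\<close>. The lower bound relies on this: the walk first travels for time \<open>a\<close>
  and only then is weighted.\<close>

lemma skeleton_fk:
  assumes "a \<ge> 0" "h \<ge> 0" and e: "\<And>x. 0 \<le> e x" "\<And>x. e x \<le> E" and u: "\<And>x. 0 \<le> u x" "\<And>x. u x \<le> U"
  shows "(\<integral>\<^sup>+ \<eta>. ennreal (of_bool (S a \<eta> = x) * (\<Prod>j<n. e (S (a + real j * h) \<eta>)) * u (S (a + real n * h) \<eta>)) \<partial>N)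
    = ennreal (pmf (K a x\<^sub>0) x * (fk e (K h) ^^ n) u x)"
proof -
  let ?f = "\<lambda>ys. ennreal (of_bool (last ys = x) * prod_list (map e (tl ys)) * u (hd ys))"
  have "(\<integral>\<^sup>+ \<eta>. ennreal (of_bool (S a \<eta> = x) * (\<Prod>j<n. e (S (a + real j * h) \<eta>)) * u (S (a + real n * h) \<eta>)) \<partial>N)
    = (\<integral>\<^sup>+ \<eta>. ?f (skel a h n \<eta>) \<partial>N)"
  proof (intro nn_integral_cong arg_cong[where f=ennreal] arg_cong2[where f="(*)"])
    fix \<eta>
    have last: "last (skel a h n \<eta>) = S a \<eta>" by (simp only: last_rev) (simp add: upt_conv_Cons del: upt_Suc)
    then show "of_bool (S a \<eta> = x) = of_bool (last (skel a h n \<eta>) = x)" by simp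
    have "tl (skel a h n \<eta>) = rev (map (\<lambda>j. S (a + real j * h) \<eta>) [0..<n])" by simp
    then have "prod_list (map e (tl (skel a h n \<eta>))) = prod_list (map (\<lambda>j. e (S (a + real j * h) \<eta>)) [0..<n])"
      by (simp add: rev_map[symmetric] comp_def)
    then show "(\<Prod>j<n. e (S (a + real j * h) \<eta>)) = prod_list (map e (tl (skel a h n \<eta>)))"
      by (simp add: prod.list_conv_set_nth lessThan_atLeast0)
    show "u (S (a + real n * h) \<eta>) = u (hd (skel a h n \<eta>))" by simp
  qed
  also have "\<dots> = (\<integral>\<^sup>+ ys. ?f ys \<partial>distr N (count_space UNIV) (skel a h n))"
    using skel_measurable[OF assms(1,2), of n] by (subst nn_integral_distr) auto
  also have "\<dots> = ennreal (pmf (K a x\<^sub>0) x * (fk e (K h) ^^ n) u x)"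
    unfolding distr_skel[OF assms(1,2)] by (rule nn_integral_path_pmf[OF e u])
  finally show ?thesis .
qed

end

section \<open>From skeletons to continuous time: exponential functionals and exit from a
  set\<close>

context jump_process
begin

lemma generator_approx:
  assumes "bounded (range \<phi>)" "\<epsilon> > 0"
  obtains h\<^sub>0 where "h\<^sub>0 > 0"
    "\<And>h x. 0 < h \<Longrightarrow> h < h\<^sub>0 \<Longrightarrow> \<bar>measure_pmf.expectation (K h x) \<phi> - \<phi> x - h * L \<phi> x\<bar> \<le> h * \<epsilon>"
proof -
  have "uniform_limit UNIV (\<lambda>t x. (measure_pmf.expectation (K t x) \<phi> - \<phi> x) / t) (L \<phi>) (at_right 0)"
    using gen assms(1) by (simp add: has_generator_def)
  from uniform_limitD[OF this assms(2)] obtain b where b: "b > 0"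
    "\<And>h. 0 < h \<Longrightarrow> h < b \<Longrightarrow> \<forall>x. dist ((measure_pmf.expectation (K h x) \<phi> - \<phi> x) / h) (L \<phi> x) < \<epsilon>"
    unfolding eventually_at_right_field by auto
  show thesis
  proof (rule that[OF b(1)])
    fix h x assume h: "0 < h" "h < b"
    then have "\<bar>(measure_pmf.expectation (K h x) \<phi> - \<phi> x) / h - L \<phi> x\<bar> < \<epsilon>"
      using b(2) by (simp add: dist_real_def)
    then have "h * \<bar>(measure_pmf.expectation (K h x) \<phi> - \<phi> x) / h - L \<phi> x\<bar> \<le> h * \<epsilon>"
      using h by simp
    also have "h * \<bar>(measure_pmf.expectation (K h x) \<phi> - \<phi> x) / h - L \<phi> x\<bar> =
        \<bar>h * ((measure_pmf.expectation (K h x) \<phi> - \<phi> x) / h - L \<phi> x)\<bar>"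
      using h by (simp add: abs_mult)
    also have "h * ((measure_pmf.expectation (K h x) \<phi> - \<phi> x) / h - L \<phi> x) =
        measure_pmf.expectation (K h x) \<phi> - \<phi> x - h * L \<phi> x"
      using h by (simp add: field_simps)
    finally show "\<bar>measure_pmf.expectation (K h x) \<phi> - \<phi> x - h * L \<phi> x\<bar> \<le> h * \<epsilon>" .
  qed
qed

text \<open>Riemann sums along a step path converge, and \<open>exp (T * B)\<close> dominates. The
  same limit makes the time integral measurable in the path, as measurability is assumed only for
  the single maps \<open>S t\<close>.\<close>

lemma fk_limit:
  assumes V: "\<And>x. 0 \<le> V x" "\<And>x. V x \<le> B" and a: "0 \<le> a" and T: "0 < T"
  shows "(\<lambda>n. pmf (K a x\<^sub>0) x * (fk (\<lambda>y. exp (T / real (Suc n) * V y)) (K (T / real (Suc n))) ^^ Suc n) (\<lambda>_. 1) x)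
      \<longlonglongrightarrow> (LINT \<eta>|N. of_bool (S a \<eta> = x) * exp (LINT u:{a..a+T}|lborel. V (S u \<eta>)))"
    and "integrable N (\<lambda>\<eta>. of_bool (S a \<eta> = x) * exp (LINT u:{a..a+T}|lborel. V (S u \<eta>)))"
    and "(\<lambda>\<eta>. LINT u:{a..a+T}|lborel. V (S u \<eta>)) \<in> borel_measurable N"
proof -
  define h where "h n = T / real (Suc n)" for n
  have h0: "h n > 0" for n using T by (simp add: h_def)
  define f where "f n \<eta> = of_bool (S a \<eta> = x) * (\<Prod>j<Suc n. exp (h n * V (S (a + real j * h n) \<eta>)))" for n \<eta>
  have f_eq: "f n \<eta> = of_bool (S a \<eta> = x) * exp (h n * (\<Sum>j<Suc n. V (S (a + real j * h n) \<eta>)))" for n \<eta>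
    by (simp add: f_def exp_sum sum_distrib_left del: sum.lessThan_Suc prod.lessThan_Suc)
  have sm: "(\<lambda>\<eta>. \<Sum>j<Suc n. V (S (a + real j * h n) \<eta>)) \<in> borel_measurable N" for n
    using a h0[of n] by (intro borel_measurable_sum S_fun_measurable) (auto simp: less_imp_le)
  have fm: "f n \<in> borel_measurable N" for n
  proof -
    have "(\<lambda>\<eta>. of_bool (S a \<eta> = x) :: real) \<in> borel_measurable N"
      using S_fun_measurable[of a "\<lambda>y. of_bool (y = x)"] a by simp
    then show ?thesis unfolding f_eq[abs_def] using sm by measurable
  qed
  have bound: "norm (f n \<eta>) \<le> exp (T * B)" for n \<eta>
  proof -
    have "(\<Sum>j<Suc n. V (S (a + real j * h n) \<eta>)) \<le> real (Suc n) * B"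
      using sum_bounded_above[of "{..<Suc n}" "\<lambda>j. V (S (a + real j * h n) \<eta>)" B] V(2) by simp
    then have "h n * (\<Sum>j<Suc n. V (S (a + real j * h n) \<eta>)) \<le> h n * (real (Suc n) * B)"
      using h0[of n] by (intro mult_left_mono) auto
    then have *: "h n * (\<Sum>j<Suc n. V (S (a + real j * h n) \<eta>)) \<le> T * B" by (simp add: h_def)
    have "norm (f n \<eta>) \<le> exp (h n * (\<Sum>j<Suc n. V (S (a + real j * h n) \<eta>)))"
      unfolding f_eq by (auto simp: abs_mult)
    also have "\<dots> \<le> exp (T * B)" using * by (simp only: exp_le_cancel_iff)
    finally show ?thesis .
  qed
  have rie: "(\<lambda>n. h n * (\<Sum>j<Suc n. V (S (a + real j * h n) \<eta>))) \<longlonglongrightarrow> (LINT u:{a..a+T}|lborel. V (S u \<eta>))"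
    if "\<eta> \<in> space N" for \<eta>
    unfolding h_def using that by (intro riemann_sum_path S_rc S_ll a T)
  let ?g = "\<lambda>\<eta>. of_bool (S a \<eta> = x) * exp (LINT u:{a..a+T}|lborel. V (S u \<eta>))"
  have lim: "(\<lambda>n. f n \<eta>) \<longlonglongrightarrow> ?g \<eta>" if "\<eta> \<in> space N" for \<eta>
    unfolding f_eq by (intro tendsto_intros rie that)
  show meas: "(\<lambda>\<eta>. LINT u:{a..a+T}|lborel. V (S u \<eta>)) \<in> borel_measurable N"
  proof (rule borel_measurable_LIMSEQ_real)
    show "(\<lambda>n. h n * (\<Sum>j<Suc n. V (S (a + real j * h n) \<eta>))) \<longlonglongrightarrow> (LINT u:{a..a+T}|lborel. V (S u \<eta>))"
      if "\<eta> \<in> space N" for \<eta> using rie[OF that] .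
    show "(\<lambda>\<eta>. h n * (\<Sum>j<Suc n. V (S (a + real j * h n) \<eta>))) \<in> borel_measurable N" for n
      by (intro borel_measurable_times borel_measurable_const sm)
  qed
  have gm: "?g \<in> borel_measurable N"
    by (rule borel_measurable_LIMSEQ_real[OF lim fm])
  show "integrable N ?g"
    by (rule integrable_dominated_convergence[where w="\<lambda>_. exp (T * B)" and s=f])
      (simp_all add: gm fm lim bound[unfolded real_norm_def])
  have "(\<lambda>n. integral\<^sup>L N (f n)) \<longlonglongrightarrow> integral\<^sup>L N ?g"
    by (rule integral_dominated_convergence[where w="\<lambda>_. exp (T * B)"])
      (simp_all add: gm fm lim bound[unfolded real_norm_def])
  moreover have "integral\<^sup>L N (f n) = pmf (K a x\<^sub>0) x * (fk (\<lambda>y. exp (h n * V y)) (K (h n)) ^^ Suc n) (\<lambda>_. 1) x" for n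
  proof -
    have e: "exp (h n * V y) \<le> exp (h n * B)" for y using V h0[of n] by simp
    have "integral\<^sup>L N (f n) = enn2real (\<integral>\<^sup>+ \<eta>. ennreal (f n \<eta>) \<partial>N)"
      by (rule integral_eq_nn_integral) (use fm in \<open>auto simp: f_eq\<close>)
    also have "(\<integral>\<^sup>+ \<eta>. ennreal (f n \<eta>) \<partial>N) =
       ennreal (pmf (K a x\<^sub>0) x * (fk (\<lambda>y. exp (h n * V y)) (K (h n)) ^^ Suc n) (\<lambda>_. 1) x)"
      using skeleton_fk[of a "h n" "\<lambda>y. exp (h n * V y)" "exp (h n * B)" "\<lambda>_. 1" 1 x "Suc n"] a h0[of n] e
      unfolding f_def by (simp add: less_imp_le del: prod.lessThan_Suc funpow.simps)
    finally show ?thesis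
      using fk_iter_bounds[of "\<lambda>y. exp (h n * V y)" "exp (h n * B)" "\<lambda>_. 1" 1 "Suc n" "K (h n)" x] e
      by (simp del: funpow.simps)
  qed
  ultimately show "(\<lambda>n. pmf (K a x\<^sub>0) x * (fk (\<lambda>y. exp (T / real (Suc n) * V y)) (K (T / real (Suc n))) ^^ Suc n) (\<lambda>_. 1) x)
      \<longlonglongrightarrow> integral\<^sup>L N ?g" by (simp add: h_def)
qed

text \<open>Since \<open>1 + s \<le> exp s\<close>, a supersolution gains at most the factor
  \<open>exp (h * (\<mu> + \<epsilon>))\<close> per skeleton step, the weight
  \<open>exp (h * V)\<close> cancelling the term \<open>- V\<close>. The uniform generator error
  \<open>h * \<epsilon>\<close> is absorbed as a multiple of \<open>\<phi>\<close>, which is why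
  \<open>\<phi>\<close> is kept above 1; that bound also dominates the terminal function 1.\<close>

lemma fk_upper:
  assumes V: "\<And>x. 0 \<le> V x" "\<And>x. V x \<le> B" and a: "0 \<le> a" and T: "0 < T"
    and \<phi>: "\<And>x. 1 \<le> \<phi> x" "\<And>x. \<phi> x \<le> C" and L: "\<And>x. L \<phi> x + V x * \<phi> x \<le> \<mu> * \<phi> x"
  shows "(LINT \<eta>|N. of_bool (S a \<eta> = x) * exp (LINT u:{a..a+T}|lborel. V (S u \<eta>)))
     \<le> pmf (K a x\<^sub>0) x * (C * exp (\<mu> * T))" (is "?I \<le> _")
proof -
  define h where "h n = T / real (Suc n)" for n
  have h0: "h n > 0" for n using T by (simp add: h_def)
  have hlim: "h \<longlonglongrightarrow> 0" unfolding h_def by real_asymp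
  have \<phi>0: "0 \<le> \<phi> y" for y using \<phi>(1)[of y] by simp
  have bd: "bounded (range \<phi>)" using \<phi>(2) \<phi>0 by (intro boundedI[where B=C]) auto
  have "?I \<le> pmf (K a x\<^sub>0) x * (C * exp ((\<mu> + \<epsilon>) * T))" if \<epsilon>: "\<epsilon> > 0" for \<epsilon>
  proof (rule LIMSEQ_le_const2[OF fk_limit(1)[OF V a T]])
    obtain h\<^sub>0 where H: "h\<^sub>0 > 0"
      "\<And>h x. 0 < h \<Longrightarrow> h < h\<^sub>0 \<Longrightarrow> \<bar>measure_pmf.expectation (K h x) \<phi> - \<phi> x - h * L \<phi> x\<bar> \<le> h * \<epsilon>"
      using generator_approx[OF bd \<epsilon>] by blast
    obtain M where M: "\<And>n. n \<ge> M \<Longrightarrow> h n < h\<^sub>0"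
      using order_tendstoD(2)[OF hlim H(1)] by (auto simp: eventually_sequentially)
    have "pmf (K a x\<^sub>0) x * (fk (\<lambda>y. exp (h n * V y)) (K (h n)) ^^ Suc n) (\<lambda>_. 1) x
        \<le> pmf (K a x\<^sub>0) x * (C * exp ((\<mu> + \<epsilon>) * T))" if n: "n \<ge> M" for n
    proof (rule mult_left_mono)
      let ?e = "\<lambda>y. exp (h n * V y)" and ?q = "exp (h n * (\<mu> + \<epsilon>))"
      have e: "?e y \<le> exp (h n * B)" for y using V h0[of n] by simp
      have step: "fk ?e (K (h n)) \<phi> y \<le> ?q * \<phi> y" for y
      proof -
        have "measure_pmf.expectation (K (h n) y) \<phi> \<le> \<phi> y + h n * L \<phi> y + h n * \<epsilon>"
          using H(2)[OF h0 M[OF n], of y] by linarith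
        also have "h n * L \<phi> y \<le> h n * (\<mu> * \<phi> y - V y * \<phi> y)"
          using L[of y] h0[of n] by (intro mult_left_mono) auto
        also have "h n * \<epsilon> \<le> h n * \<epsilon> * \<phi> y" using h0[of n] \<epsilon> \<phi>(1)[of y] by simp
        finally have "measure_pmf.expectation (K (h n) y) \<phi> \<le> (1 + h n * (\<mu> + \<epsilon> - V y)) * \<phi> y"
          by (simp add: algebra_simps)
        also have "\<dots> \<le> exp (h n * (\<mu> + \<epsilon> - V y)) * \<phi> y"
          using \<phi>0 exp_ge_add_one_self by (intro mult_right_mono) auto
        finally have "fk ?e (K (h n)) \<phi> y \<le> exp (h n * V y) * (exp (h n * (\<mu> + \<epsilon> - V y)) * \<phi> y)"
          unfolding fk_def by (intro mult_left_mono) auto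
        also have "\<dots> = ?q * \<phi> y"
          by (simp add: exp_add[symmetric] mult.assoc[symmetric]) (simp add: algebra_simps)
        finally show ?thesis .
      qed
      have "(fk ?e (K (h n)) ^^ m) (\<lambda>_. 1) y \<le> ?q ^ m * \<phi> y" for m y
      proof (induction m arbitrary: y)
        case (Suc m)
        have it: "0 \<le> (fk ?e (K (h n)) ^^ m) (\<lambda>_. 1) z" for z
          using fk_iter_bounds[of ?e "exp (h n * B)" "\<lambda>_. 1" 1 m "K (h n)" z] e by simp
        have "(fk ?e (K (h n)) ^^ Suc m) (\<lambda>_. 1) y \<le> fk ?e (K (h n)) (\<lambda>z. ?q ^ m * \<phi> z) y"
          unfolding funpow.simps comp_def
          by (subst (1 2) fk_def, intro mult_left_mono expectation_pmf_mono[where B="?q ^ m * C"])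
            (use it Suc \<phi>(2) in auto)
        also have "\<dots> = ?q ^ m * fk ?e (K (h n)) \<phi> y" by (simp add: fk_def)
        also have "\<dots> \<le> ?q ^ m * (?q * \<phi> y)" using step by (intro mult_left_mono) auto
        finally show ?case by (simp add: mult_ac)
      qed (use \<phi> in auto)
      then have "(fk ?e (K (h n)) ^^ Suc n) (\<lambda>_. 1) x \<le> ?q ^ Suc n * \<phi> x" .
      also have "?q ^ Suc n = exp ((\<mu> + \<epsilon>) * T)"
        by (simp only: exp_of_nat_mult[symmetric]) (simp add: h_def)
      also have "exp ((\<mu> + \<epsilon>) * T) * \<phi> x \<le> exp ((\<mu> + \<epsilon>) * T) * C" using \<phi> by simp
      finally show "(fk ?e (K (h n)) ^^ Suc n) (\<lambda>_. 1) x \<le> C * exp ((\<mu> + \<epsilon>) * T)"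
        by (simp only: mult.commute)
    qed simp
    then show "\<exists>M. \<forall>n\<ge>M. pmf (K a x\<^sub>0) x * (fk (\<lambda>y. exp (T / real (Suc n) * V y)) (K (T / real (Suc n))) ^^ Suc n) (\<lambda>_. 1) x
        \<le> pmf (K a x\<^sub>0) x * (C * exp ((\<mu> + \<epsilon>) * T))"
      unfolding h_def by blast
  qed
  then have "eventually (\<lambda>\<epsilon>. ?I \<le> pmf (K a x\<^sub>0) x * (C * exp ((\<mu> + \<epsilon>) * T))) (at_right 0)"
    unfolding eventually_at_right_field by (intro exI[of _ 1]) auto
  moreover have "((\<lambda>\<epsilon>. pmf (K a x\<^sub>0) x * (C * exp ((\<mu> + \<epsilon>) * T))) \<longlongrightarrow> pmf (K a x\<^sub>0) x * (C * exp ((\<mu> + 0) * T))) (at_right 0)"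
    by (intro tendsto_intros)
  ultimately have "?I \<le> pmf (K a x\<^sub>0) x * (C * exp ((\<mu> + 0) * T))"
    by (intro tendsto_lowerbound) auto
  then show ?thesis by simp
qed

text \<open>Here \<open>\<phi>\<close> may vanish, so the generator error cannot be absorbed into
  it. It is carried additively: \<open>h * \<epsilon>\<close> per step, inflated by at most
  \<open>exp (h * \<Lambda>)\<close> at every later step, in total
  \<open>T * \<epsilon> * exp (T * \<Lambda>)\<close>, which vanishes with
  \<open>\<epsilon>\<close>. For the growth factor the bound \<open>1 + s \<le> exp s\<close> goes
  the wrong way, so \<open>(1 + h * \<mu>) ^ n\<close> is kept until the limit.\<close>

lemma fk_lower:
  assumes V: "\<And>x. 0 \<le> V x" "\<And>x. V x \<le> B" and a: "0 \<le> a" and T: "0 < T" and \<mu>: "0 \<le> \<mu>"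
    and \<phi>: "\<And>x. 0 \<le> \<phi> x" "\<And>x. \<phi> x \<le> 1" and L: "\<And>x. L \<phi> x + V x * \<phi> x \<ge> \<mu> * \<phi> x"
    and Lb: "\<And>x. \<bar>L \<phi> x\<bar> \<le> D"
  shows "(LINT \<eta>|N. of_bool (S a \<eta> = x) * exp (LINT u:{a..a+T}|lborel. V (S u \<eta>)))
     \<ge> pmf (K a x\<^sub>0) x * (exp (\<mu> * T) * \<phi> x)" (is "?I \<ge> _")
proof -
  define h where "h n = T / real (Suc n)" for n
  have h0: "h n > 0" for n using T by (simp add: h_def)
  have hlim: "h \<longlonglongrightarrow> 0" unfolding h_def by real_asymp
  have bd: "bounded (range \<phi>)" using \<phi> by (intro boundedI[where B=1]) auto
  have B0: "0 \<le> B" using V order_trans by blast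
  have D0: "0 \<le> D" using Lb[of x] by linarith
  \<comment> \<open>A common bound for both sources of growth: the weights, at most
    \<open>exp (h * B)\<close>, and the factor \<open>1 + h * \<mu>\<close>.\<close>
  define \<Lambda> where "\<Lambda> = max B \<mu>"
  have \<Lambda>: "0 \<le> \<Lambda>" "B \<le> \<Lambda>" "\<mu> \<le> \<Lambda>" using B0 by (auto simp: \<Lambda>_def)
  have main: "?I \<ge> pmf (K a x\<^sub>0) x * (exp (\<mu> * T) * \<phi> x - T * \<epsilon> * exp (T * \<Lambda>))" if \<epsilon>: "\<epsilon> > 0" for \<epsilon>
  proof (rule LIMSEQ_le[OF _ fk_limit(1)[OF V a T]])
    obtain h\<^sub>0 where H: "h\<^sub>0 > 0"
      "\<And>h x. 0 < h \<Longrightarrow> h < h\<^sub>0 \<Longrightarrow> \<bar>measure_pmf.expectation (K h x) \<phi> - \<phi> x - h * L \<phi> x\<bar> \<le> h * (\<epsilon>/2)"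
      using generator_approx[OF bd, of "\<epsilon>/2"] \<epsilon> by auto
    have "eventually (\<lambda>n. h n < h\<^sub>0) sequentially"
      by (rule order_tendstoD(2)[OF hlim H(1)])
    moreover have "((\<lambda>n. B * (h n * (D + \<epsilon>/2))) \<longlongrightarrow> B * (0 * (D + \<epsilon>/2))) sequentially"
      by (intro tendsto_intros hlim)
    then have "eventually (\<lambda>n. B * (h n * (D + \<epsilon>/2)) < \<epsilon>/2) sequentially"
      by (rule order_tendstoD(2)) (use \<epsilon> in simp)
    ultimately have ev: "eventually (\<lambda>n. h n < h\<^sub>0 \<and> B * (h n * (D + \<epsilon>/2)) < \<epsilon>/2) sequentially"
      by eventually_elim auto
    show "\<exists>M. \<forall>n\<ge>M. pmf (K a x\<^sub>0) x * ((1 + h n * \<mu>) ^ Suc n * \<phi> x - T * \<epsilon> * exp (T * \<Lambda>))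
        \<le> pmf (K a x\<^sub>0) x * (fk (\<lambda>y. exp (T / real (Suc n) * V y)) (K (T / real (Suc n))) ^^ Suc n) (\<lambda>_. 1) x"
      unfolding h_def[symmetric] eventually_sequentially[symmetric]
      using ev
    proof eventually_elim
      case (elim n)
      let ?e = "\<lambda>y. exp (h n * V y)"
      let ?q = "1 + h n * \<mu>"
      have e: "?e y \<le> exp (h n * B)" for y using V h0[of n] by simp
      have q: "0 \<le> ?q" "?q \<le> exp (h n * \<Lambda>)"
      proof -
        have "h n * \<mu> \<le> h n * \<Lambda>" using h0[of n] \<Lambda>(3) by (intro mult_left_mono) auto
        then show "?q \<le> exp (h n * \<Lambda>)" using exp_ge_add_one_self[of "h n * \<Lambda>"] by linarith
        show "0 \<le> ?q" using h0[of n] \<mu> by simp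
      qed
      have step: "fk ?e (K (h n)) \<phi> y \<ge> ?q * \<phi> y - h n * \<epsilon>" for y
      proof -
        let ?E = "measure_pmf.expectation (K (h n) y) \<phi>"
        have E0: "0 \<le> ?E" using \<phi> by simp
        have E1: "\<bar>?E - \<phi> y - h n * L \<phi> y\<bar> \<le> h n * (\<epsilon>/2)" using H(2) h0 elim by simp
        have hL: "\<bar>h n * L \<phi> y\<bar> \<le> h n * D" using Lb[of y] h0[of n] by (simp add: abs_mult)
        \<comment> \<open>The expectation falls below \<open>\<phi> y\<close> by O(h) at most. In
          the potential term, which already has a factor \<open>h\<close>, replacing one by the
          other costs a second-order error.\<close>
        have E2: "?E \<ge> \<phi> y - h n * (D + \<epsilon>/2)" 
          unfolding distrib_left using E1 hL by linarith
        have F1: "V y * ?E \<ge> V y * (\<phi> y - h n * (D + \<epsilon>/2))" using E2 V by (intro mult_left_mono)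
        have "V y * (h n * (D + \<epsilon>/2)) \<le> B * (h n * (D + \<epsilon>/2))"
          using V h0[of n] D0 \<epsilon> by (intro mult_right_mono) (auto intro!: mult_nonneg_nonneg)
        then have "V y * (\<phi> y - h n * (D + \<epsilon>/2)) \<ge> V y * \<phi> y - \<epsilon>/2"
          unfolding right_diff_distrib using elim by linarith
        with F1 have E3: "V y * ?E \<ge> V y * \<phi> y - \<epsilon>/2" by linarith
        have "?e y * ?E \<ge> (1 + h n * V y) * ?E"
          using E0 exp_ge_add_one_self by (intro mult_right_mono) auto
        moreover have "(1 + h n * V y) * ?E = ?E + h n * (V y * ?E)" by (simp add: algebra_simps)
        moreover have "h n * (V y * ?E) \<ge> h n * (V y * \<phi> y - \<epsilon>/2)"
          using E3 h0[of n] by (intro mult_left_mono) auto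
        moreover have "?E \<ge> \<phi> y + h n * L \<phi> y - h n * (\<epsilon>/2)" using E1 by linarith
        ultimately have "?e y * ?E \<ge> \<phi> y + h n * (L \<phi> y + V y * \<phi> y) - h n * \<epsilon>"
          by (simp add: algebra_simps)
        moreover have "h n * (L \<phi> y + V y * \<phi> y) \<ge> h n * (\<mu> * \<phi> y)"
          using L[of y] h0[of n] by (intro mult_left_mono) auto
        ultimately show ?thesis by (simp add: fk_def algebra_simps)
      qed
      have iter: "(fk ?e (K (h n)) ^^ m) (\<lambda>_. 1) y \<ge> ?q ^ m * \<phi> y - real m * (h n * \<epsilon>) * exp (h n * \<Lambda>) ^ m" for m y
      proof (induction m arbitrary: y)
        case (Suc m)
        let ?u = "(fk ?e (K (h n)) ^^ m) (\<lambda>_. 1)"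
        let ?c = "real m * (h n * \<epsilon>) * exp (h n * \<Lambda>) ^ m"
        have c0: "0 \<le> ?c" using h0[of n] \<epsilon> by simp
        have it: "0 \<le> ?u z \<and> ?u z \<le> exp (h n * B) ^ m" for z
          using fk_iter_bounds[of ?e "exp (h n * B)" "\<lambda>_. 1" 1 m "K (h n)" z] e by simp
        have iu: "integrable (K (h n) y) ?u"
          using it by (intro integrable_pmf_bounded[where U="exp (h n * B) ^ m"]) auto
        have i\<phi>: "integrable (K (h n) y) \<phi>" using \<phi> by (intro integrable_pmf_bounded[where U=1]) auto
        have "measure_pmf.expectation (K (h n) y) (\<lambda>z. ?q ^ m * \<phi> z - ?c) \<le> measure_pmf.expectation (K (h n) y) ?u"
          using Suc by (intro integral_mono iu) (auto intro!: i\<phi>)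
        moreover have "measure_pmf.expectation (K (h n) y) (\<lambda>z. ?q ^ m * \<phi> z - ?c) =
            ?q ^ m * measure_pmf.expectation (K (h n) y) \<phi> - ?c"
          by (subst Bochner_Integration.integral_diff) (auto intro!: i\<phi>)
        ultimately have "?e y * (?q ^ m * measure_pmf.expectation (K (h n) y) \<phi> - ?c) \<le> fk ?e (K (h n)) ?u y"
          unfolding fk_def by (intro mult_left_mono) auto
        moreover have "?e y * (?q ^ m * measure_pmf.expectation (K (h n) y) \<phi> - ?c) =
            ?q ^ m * fk ?e (K (h n)) \<phi> y - ?e y * ?c" by (simp add: fk_def algebra_simps)
        moreover have "?q ^ m * fk ?e (K (h n)) \<phi> y \<ge> ?q ^ m * (?q * \<phi> y - h n * \<epsilon>)"
          using step q by (intro mult_left_mono) auto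
        moreover have "?e y \<le> exp (h n * \<Lambda>)"
          using e[of y] \<Lambda>(2) h0[of n] by (meson exp_le_cancel_iff mult_left_mono less_imp_le order_trans)
        then have "?e y * ?c \<le> exp (h n * \<Lambda>) * ?c" using c0 by (rule mult_right_mono)
        moreover have "?q ^ m * (h n * \<epsilon>) \<le> exp (h n * \<Lambda>) ^ Suc m * (h n * \<epsilon>)"
        proof (rule mult_right_mono)
          have "?q ^ m \<le> exp (h n * \<Lambda>) ^ m" using q by (intro power_mono) auto
          also have "\<dots> \<le> exp (h n * \<Lambda>) ^ Suc m"
            using h0[of n] \<Lambda>(1) by (intro power_increasing) auto
          finally show "?q ^ m \<le> exp (h n * \<Lambda>) ^ Suc m" .
        qed (use h0[of n] \<epsilon> in auto)
        moreover have "exp (h n * \<Lambda>) * ?c + exp (h n * \<Lambda>) ^ Suc m * (h n * \<epsilon>) =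
           real (Suc m) * (h n * \<epsilon>) * exp (h n * \<Lambda>) ^ Suc m" by (simp add: algebra_simps)
        moreover have "?q ^ m * (?q * \<phi> y - h n * \<epsilon>) = ?q ^ Suc m * \<phi> y - ?q ^ m * (h n * \<epsilon>)"
          by (simp add: algebra_simps)
        ultimately show ?case unfolding funpow.simps comp_def by linarith
      qed (use \<phi> in auto)
      have "real (Suc n) * (h n * \<epsilon>) * exp (h n * \<Lambda>) ^ Suc n = T * \<epsilon> * exp (T * \<Lambda>)"
        by (simp only: exp_of_nat_mult[symmetric]) (simp add: h_def)
      then have "?q ^ Suc n * \<phi> x - T * \<epsilon> * exp (T * \<Lambda>) \<le> (fk ?e (K (h n)) ^^ Suc n) (\<lambda>_. 1) x"
        using iter[of "Suc n" x] by (simp only:)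
      then show ?case by (rule mult_left_mono) simp
    qed
    have "(\<lambda>n. (1 + (T * \<mu>) / real n) ^ n) \<longlonglongrightarrow> exp (T * \<mu>)"
      by (rule tendsto_exp_limit_sequentially)
    then have "(\<lambda>n. (1 + (T * \<mu>) / real (Suc n)) ^ Suc n) \<longlonglongrightarrow> exp (T * \<mu>)"
      by (rule LIMSEQ_Suc)
    then have "(\<lambda>n. (1 + h n * \<mu>) ^ Suc n) \<longlonglongrightarrow> exp (\<mu> * T)"
      by (simp add: h_def mult.commute)
    then show "(\<lambda>n. pmf (K a x\<^sub>0) x * ((1 + h n * \<mu>) ^ Suc n * \<phi> x - T * \<epsilon> * exp (T * \<Lambda>)))
       \<longlonglongrightarrow> pmf (K a x\<^sub>0) x * (exp (\<mu> * T) * \<phi> x - T * \<epsilon> * exp (T * \<Lambda>))"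
      by (intro tendsto_intros)
  qed
  then have "eventually (\<lambda>\<epsilon>. ?I \<ge> pmf (K a x\<^sub>0) x * (exp (\<mu> * T) * \<phi> x - T * \<epsilon> * exp (T * \<Lambda>))) (at_right 0)"
    unfolding eventually_at_right_field by (intro exI[of _ 1]) auto
  moreover have "((\<lambda>\<epsilon>. pmf (K a x\<^sub>0) x * (exp (\<mu> * T) * \<phi> x - T * \<epsilon> * exp (T * \<Lambda>))) \<longlongrightarrow>
     pmf (K a x\<^sub>0) x * (exp (\<mu> * T) * \<phi> x - T * 0 * exp (T * \<Lambda>))) (at_right 0)"
    by (intro tendsto_intros)
  ultimately have "?I \<ge> pmf (K a x\<^sub>0) x * (exp (\<mu> * T) * \<phi> x - T * 0 * exp (T * \<Lambda>))"
    by (intro tendsto_upperbound) auto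
  then show ?thesis by simp
qed

text \<open>A right-continuous step path found outside \<open>D\<close> keeps its value for a short
  while and is caught by every fine grid. Hence products of indicators along skeletons converge to
  the indicator of staying in \<open>D\<close>, which also gives measurability. Backwards from the
  final time, \<open>1 - q ^ m * \<phi>\<close> stays below the survival probability; the floor
  \<open>\<delta>\<close> turns the additive generator error into a multiple of
  \<open>\<phi>\<close>.\<close>

lemma exit_prob:
  assumes \<phi>: "\<And>x. \<delta> \<le> \<phi> x" "\<And>x. \<phi> x \<le> C" "\<And>x. x \<notin> D \<Longrightarrow> 1 \<le> \<phi> x" and \<delta>: "0 < \<delta>"
    and L: "\<And>x. L \<phi> x \<le> \<mu> * \<phi> x" and \<mu>: "0 \<le> \<mu>" and t: "0 < t"
  shows "{\<eta> \<in> space N. \<forall>u\<in>{0..t}. S u \<eta> \<in> D} \<in> sets N"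
    and "prob {\<eta> \<in> space N. \<forall>u\<in>{0..t}. S u \<eta> \<in> D} \<ge> 1 - \<phi> x\<^sub>0 * exp (\<mu> * t)"
proof -
  define h where "h n = t / real (Suc n)" for n
  have h0: "h n > 0" for n using t by (simp add: h_def)
  have hlim: "h \<longlonglongrightarrow> 0" unfolding h_def by real_asymp
  have \<phi>0: "0 < \<phi> y" for y using \<phi>(1)[of y] \<delta> by linarith
  have C0: "0 \<le> C" using \<phi>0[of x\<^sub>0] \<phi>(2)[of x\<^sub>0] by linarith
  have bd: "bounded (range \<phi>)" using \<phi>(2) \<phi>0 by (intro boundedI[where B=C]) (auto simp: less_imp_le)
  let ?G = "{\<eta> \<in> space N. \<forall>u\<in>{0..t}. S u \<eta> \<in> D}"
  define d where "d y = (of_bool (y \<in> D) :: real)" for y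
  define f where "f n \<eta> = (\<Prod>j<Suc n. d (S (0 + real j * h n) \<eta>)) * d (S (0 + real (Suc n) * h n) \<eta>)" for n \<eta>
  have d01: "0 \<le> d y" "d y \<le> 1" for y by (auto simp: d_def)
  have f01: "0 \<le> f n \<eta>" "f n \<eta> \<le> 1" for n \<eta>
    unfolding f_def using d01 by (auto intro!: mult_nonneg_nonneg prod_nonneg mult_le_one prod_le_1 simp del: prod.lessThan_Suc)
  have fm: "f n \<in> borel_measurable N" for n
    unfolding f_def using h0[of n]
    by (intro borel_measurable_times borel_measurable_prod S_fun_measurable) (auto simp: less_imp_le)
  have lim: "(\<lambda>n. f n \<eta>) \<longlonglongrightarrow> indicator ?G \<eta>" if \<eta>: "\<eta> \<in> space N" for \<eta>
  proof (cases "\<eta> \<in> ?G")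
    case True
    have "S (0 + real j * h n) \<eta> \<in> D" if "j \<le> Suc n" for j n
    proof -
      have "real j * h n \<le> real (Suc n) * h n" using that h0[of n] by (intro mult_right_mono) auto
      then have "real j * h n \<le> t" by (simp add: h_def)
      then show ?thesis using True h0[of n] by (auto simp: less_imp_le)
    qed
    then have "f n \<eta> = 1" for n unfolding f_def d_def by (simp del: prod.lessThan_Suc of_nat_Suc)
    then show ?thesis using True by simp
  next
    case False
    then obtain u where u: "0 \<le> u" "u \<le> t" "S u \<eta> \<notin> D" using \<eta> by auto
    from S_rc[OF \<eta> u(1)] obtain b where b: "b > u" "\<And>v. u < v \<Longrightarrow> v < b \<Longrightarrow> S v \<eta> = S u \<eta>"
      unfolding eventually_at_right_field by auto
    have "eventually (\<lambda>n. h n < b - u) sequentially"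
      using order_tendstoD(2)[OF hlim, of "b - u"] b by simp
    then have "eventually (\<lambda>n. f n \<eta> = 0) sequentially"
    proof eventually_elim
      case (elim n)
      \<comment> \<open>The first grid time not before \<open>u\<close>; it falls into the interval
        on which the path keeps its value at \<open>u\<close>.\<close>
      define j where "j = nat \<lceil>u / h n\<rceil>"
      have "0 \<le> u / h n" using u h0[of n] by simp
      then have j: "u / h n \<le> real j" "real j < u / h n + 1" unfolding j_def by linarith+
      have "u / h n \<le> t / h n" using u h0[of n] by (intro divide_right_mono) auto
      also have "t / h n = real (Suc n)" using t by (simp add: h_def)
      finally have "u / h n \<le> real (Suc n)" .
      then have "j \<le> Suc n" using j by linarith
      have "u \<le> real j * h n" "real j * h n < b" using j h0[of n] elim by (auto simp: field_simps)
      then have "S (0 + real j * h n) \<eta> = S u \<eta>" using b by (cases "u = real j * h n") auto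
      then have dj: "d (S (0 + real j * h n) \<eta>) = 0" using u by (simp add: d_def)
      show ?case
      proof (cases "j = Suc n")
        case True then show ?thesis using dj by (simp add: f_def)
      next
        case False
        then have "j < Suc n" using \<open>j \<le> Suc n\<close> by simp
        then have "(\<Prod>j<Suc n. d (S (0 + real j * h n) \<eta>)) = 0"
          using dj by (intro prod_zero) auto
        then show ?thesis by (simp add: f_def del: prod.lessThan_Suc)
      qed
    qed
    then have "(\<lambda>n. f n \<eta>) \<longlonglongrightarrow> 0" by (rule tendsto_eventually)
    then show ?thesis using False by simp
  qed
  have im: "(indicator ?G :: _ \<Rightarrow> real) \<in> borel_measurable N"
    by (rule borel_measurable_LIMSEQ_real[OF lim fm])
  then have "{\<eta> \<in> space N. indicator ?G \<eta> = (1::real)} \<in> sets N" by measurable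
  moreover have "{\<eta> \<in> space N. indicator ?G \<eta> = (1::real)} = ?G" by (auto simp: indicator_def)
  ultimately show sets: "?G \<in> sets N" by simp
  have conv: "(\<lambda>n. integral\<^sup>L N (f n)) \<longlonglongrightarrow> integral\<^sup>L N (indicator ?G)"
    by (rule integral_dominated_convergence[where w="\<lambda>_. 1"])
      (simp_all add: im fm lim f01)
  have "prob ?G \<ge> 1 - \<phi> x\<^sub>0 * exp ((\<mu> + \<epsilon>) * t)" if \<epsilon>: "\<epsilon> > 0" for \<epsilon>
  proof (rule LIMSEQ_le_const)
    show "(\<lambda>n. integral\<^sup>L N (f n)) \<longlonglongrightarrow> prob ?G" using conv sets by simp
    obtain h\<^sub>0 where H: "h\<^sub>0 > 0"
      "\<And>h x. 0 < h \<Longrightarrow> h < h\<^sub>0 \<Longrightarrow> \<bar>measure_pmf.expectation (K h x) \<phi> - \<phi> x - h * L \<phi> x\<bar> \<le> h * (\<epsilon> * \<delta>)"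
      using generator_approx[OF bd, of "\<epsilon> * \<delta>"] \<epsilon> \<delta> by auto
    obtain M where M: "\<And>n. n \<ge> M \<Longrightarrow> h n < h\<^sub>0"
      using order_tendstoD(2)[OF hlim H(1)] by (auto simp: eventually_sequentially)
    show "\<exists>M. \<forall>n\<ge>M. 1 - \<phi> x\<^sub>0 * exp ((\<mu> + \<epsilon>) * t) \<le> integral\<^sup>L N (f n)"
    proof (intro exI[of _ M] allI impI)
      fix n assume n: "M \<le> n"
      let ?q = "exp (h n * (\<mu> + \<epsilon>))"
      have q1: "1 \<le> ?q" using h0[of n] \<mu> \<epsilon> by simp
      have step: "measure_pmf.expectation (K (h n) y) \<phi> \<le> ?q * \<phi> y" for y
      proof -
        have "measure_pmf.expectation (K (h n) y) \<phi> \<le> \<phi> y + h n * L \<phi> y + h n * (\<epsilon> * \<delta>)"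
          using H(2)[OF h0 M[OF n], of y] by linarith
        also have "h n * L \<phi> y \<le> h n * (\<mu> * \<phi> y)" using L h0[of n] by (intro mult_left_mono) auto
        also have "h n * (\<epsilon> * \<delta>) \<le> h n * (\<epsilon> * \<phi> y)" using h0[of n] \<epsilon> \<phi>(1)[of y] by (intro mult_left_mono) auto
        finally have "measure_pmf.expectation (K (h n) y) \<phi> \<le> (1 + h n * (\<mu> + \<epsilon>)) * \<phi> y"
          by (simp add: algebra_simps)
        also have "\<dots> \<le> ?q * \<phi> y"
          using \<phi>0[of y] exp_ge_add_one_self by (intro mult_right_mono) auto
        finally show ?thesis .
      qed
      have it: "(fk d (K (h n)) ^^ m) d y \<ge> 1 - ?q ^ m * \<phi> y" for m y
      proof (induction m arbitrary: y)
        case 0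
        show ?case using \<phi>(3)[of y] \<phi>0[of y] by (auto simp: d_def)
      next
        case (Suc m)
        let ?u = "(fk d (K (h n)) ^^ m) d"
        show ?case
        proof (cases "y \<in> D")
          case False
          have "1 * 1 \<le> ?q ^ Suc m * \<phi> y"
            by (intro mult_mono one_le_power q1 \<phi>(3)[OF False]) (use q1 in auto)
          moreover have "(fk d (K (h n)) ^^ Suc m) d y = 0" using False by (simp add: fk_def d_def)
          ultimately show ?thesis by linarith
        next
          case True
          have b: "0 \<le> ?u z \<and> ?u z \<le> 1" for z
            using fk_iter_bounds[of d 1 d 1 m "K (h n)" z] d01 by simp
          have iu: "integrable (K (h n) y) ?u"
            using b by (intro integrable_pmf_bounded[where U=1]) auto
          have i\<phi>: "integrable (K (h n) y) \<phi>"
            using \<phi>(2) \<phi>0 by (intro integrable_pmf_bounded[where U=C]) (auto simp: less_imp_le)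
          have "measure_pmf.expectation (K (h n) y) (\<lambda>z. 1 - ?q ^ m * \<phi> z) \<le> measure_pmf.expectation (K (h n) y) ?u"
            using Suc by (intro integral_mono iu) (auto intro!: i\<phi>)
          moreover have "measure_pmf.expectation (K (h n) y) (\<lambda>z. 1 - ?q ^ m * \<phi> z) =
              1 - ?q ^ m * measure_pmf.expectation (K (h n) y) \<phi>"
            by (subst Bochner_Integration.integral_diff) (auto intro!: i\<phi>)
          moreover have "?q ^ m * measure_pmf.expectation (K (h n) y) \<phi> \<le> ?q ^ m * (?q * \<phi> y)"
            using step by (intro mult_left_mono) auto
          moreover have "?q ^ m * (?q * \<phi> y) = ?q ^ Suc m * \<phi> y" by simp
          moreover have dk: "fk d (K (h n)) u y = measure_pmf.expectation (K (h n) y) u" for u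
            using True by (simp add: fk_def d_def)
          note dk[of ?u]
          ultimately show ?thesis unfolding funpow.simps comp_def by linarith
        qed
      qed
      have "ennreal (1 - \<phi> x\<^sub>0 * exp ((\<mu> + \<epsilon>) * t)) \<le> ennreal ((fk d (K (h n)) ^^ Suc n) d x\<^sub>0)"
      proof (rule ennreal_leI)
        have "?q ^ Suc n = exp ((\<mu> + \<epsilon>) * t)"
          by (simp only: exp_of_nat_mult[symmetric]) (simp add: h_def)
        then show "1 - \<phi> x\<^sub>0 * exp ((\<mu> + \<epsilon>) * t) \<le> (fk d (K (h n)) ^^ Suc n) d x\<^sub>0"
          using it[of "Suc n" x\<^sub>0] by (simp only: mult.commute)
      qed
      also have "\<dots> = ennreal (pmf (K 0 x\<^sub>0) x\<^sub>0 * (fk d (K (h n)) ^^ Suc n) d x\<^sub>0)"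
        by (simp add: K_0)
      also have "\<dots> = (\<integral>\<^sup>+ \<eta>. ennreal (of_bool (S 0 \<eta> = x\<^sub>0) * (\<Prod>j<Suc n. d (S (0 + real j * h n) \<eta>)) * d (S (0 + real (Suc n) * h n) \<eta>)) \<partial>N)"
        using skeleton_fk[of 0 "h n" d 1 d 1 x\<^sub>0 "Suc n"] d01 h0[of n]
        by (simp add: less_imp_le del: prod.lessThan_Suc funpow.simps)
      also have "\<dots> \<le> (\<integral>\<^sup>+ \<eta>. ennreal (f n \<eta>) \<partial>N)"
      proof (intro nn_integral_mono ennreal_leI)
        fix \<eta> show "of_bool (S 0 \<eta> = x\<^sub>0) * (\<Prod>j<Suc n. d (S (0 + real j * h n) \<eta>)) * d (S (0 + real (Suc n) * h n) \<eta>) \<le> f n \<eta>"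
          using f01(1)[of n \<eta>] unfolding f_def by (cases "S 0 \<eta> = x\<^sub>0") (simp_all del: prod.lessThan_Suc)
      qed
      also have "\<dots> = ennreal (integral\<^sup>L N (f n))"
        using f01 fm by (intro nn_integral_eq_integral integrable_const_bound[where B=1]) auto
      finally have "ennreal (1 - \<phi> x\<^sub>0 * exp ((\<mu> + \<epsilon>) * t)) \<le> ennreal (integral\<^sup>L N (f n))" .
      \<comment> \<open>The lower bound may be negative, where \<open>ennreal\<close> truncates it
        to 0; nonnegativity of the integral covers that case.\<close>
      moreover have "0 \<le> integral\<^sup>L N (f n)" using f01 by simp
      ultimately show "1 - \<phi> x\<^sub>0 * exp ((\<mu> + \<epsilon>) * t) \<le> integral\<^sup>L N (f n)"
        by (simp add: ennreal_le_iff2) linarith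
    qed
  qed
  then have "eventually (\<lambda>\<epsilon>. prob ?G \<ge> 1 - \<phi> x\<^sub>0 * exp ((\<mu> + \<epsilon>) * t)) (at_right 0)"
    unfolding eventually_at_right_field by (intro exI[of _ 1]) auto
  moreover have "((\<lambda>\<epsilon>. 1 - \<phi> x\<^sub>0 * exp ((\<mu> + \<epsilon>) * t)) \<longlongrightarrow> 1 - \<phi> x\<^sub>0 * exp ((\<mu> + 0) * t)) (at_right 0)"
    by (intro tendsto_intros)
  ultimately have "prob ?G \<ge> 1 - \<phi> x\<^sub>0 * exp ((\<mu> + 0) * t)"
    by (intro tendsto_upperbound) auto
  then show "prob ?G \<ge> 1 - \<phi> x\<^sub>0 * exp (\<mu> * t)" by simp
qed

end

text \<open>A pointwise form of the second moment argument. Where \<open>w\<close> is below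
  \<open>A / 2\<close> the first term of \<open>?r\<close> suffices; elsewhere
  \<open>w \<le> A / (4 * C) * w^2 + C / A\<close> by comparing arithmetic and geometric means.
  After integration the first two terms use up three quarters of \<open>q * A\<close>. The number
  \<open>q\<close> bounds the mass of \<open>G\<close> and scales both moments, which replaces
  conditioning on \<open>G\<close>.\<close>

lemma (in prob_space) paley_zygmund_on:
  assumes G: "G \<in> sets M" and w: "w \<in> borel_measurable M"
    and i1: "integrable M (\<lambda>x. indicator G x * w x)" and i2: "integrable M (\<lambda>x. indicator G x * (w x)\<^sup>2)"
    and q: "prob G \<le> q" and A: "q * A \<le> (LINT x|M. indicator G x * w x)"
    and C: "(LINT x|M. indicator G x * (w x)\<^sup>2) \<le> q * C"
    and pos: "A > 0" "C > 0"
  shows "prob {x \<in> space M. x \<in> G \<and> A / 2 \<le> w x} \<ge> q * A\<^sup>2 / (4 * C)"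
proof -
  let ?E = "{x \<in> space M. x \<in> G \<and> A / 2 \<le> w x}"
  have E: "?E \<in> sets M" using G w by measurable
  let ?r = "\<lambda>x. A / 2 * indicator G x + A / (4 * C) * (indicator G x * (w x)\<^sup>2) + C / A * indicator ?E x"
  have le: "indicator G x * w x \<le> ?r x" if "x \<in> space M" for x
  proof (cases "x \<in> G \<and> A / 2 \<le> w x")
    case True
    have "0 \<le> (A * w x / (2 * C) - 1)\<^sup>2 * (C / A)" using pos by simp
    also have "\<dots> = A / (4 * C) * (w x)\<^sup>2 - w x + C / A"
      using pos by (simp add: power2_eq_square field_simps)
    finally show ?thesis using True that pos by simp
  next
    case False
    moreover have "0 \<le> A / (4 * C) * (w x)\<^sup>2" using pos by simp
    then have "w x \<le> A / 2 + A / (4 * C) * (w x)\<^sup>2" if "w x < A / 2" using that by linarith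
    ultimately show ?thesis using pos that by (auto simp: indicator_def not_le)
  qed
  have iI: "integrable M (indicator X :: 'a \<Rightarrow> real)" if "X \<in> sets M" for X
    using that by (intro integrable_real_indicator) (auto simp: emeasure_eq_measure)
  have ir: "integrable M ?r"
    by (intro Bochner_Integration.integrable_add integrable_mult_right iI i2 G E)
  have "q * A \<le> integral\<^sup>L M ?r"
    using A integral_mono[OF i1 ir le] by simp
  also have "integral\<^sup>L M ?r = A / 2 * prob G + A / (4 * C) * (LINT x|M. indicator G x * (w x)\<^sup>2) + C / A * prob ?E"
    using iI[OF G] iI[OF E] G E i2 by (simp add: Bochner_Integration.integral_add)
  also have "\<dots> \<le> A / 2 * q + A / (4 * C) * (q * C) + C / A * prob ?E"
    using q C pos by (intro add_mono mult_left_mono) auto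
  finally have "q * A * (1/4) \<le> C / A * prob ?E" using pos by (simp add: field_simps)
  then show ?thesis using pos by (simp add: field_simps power2_eq_square)
qed

section \<open>Local time at one site, and differentiability of the semigroup in time\<close>

context jump_process
begin

text \<open>The square of \<open>exp (\<theta> * l)\<close> is the same functional at
  \<open>2 * \<theta>\<close>, so \<open>\<phi>\<close> controls the first moment from below and
  \<open>\<psi>\<close> the second from above; the loss is the ratio of the squared first moment to
  the second. Taking half of the bound \<open>exp (\<mu> * T)\<close> as threshold produces
  \<open>ln 2\<close>.\<close>

lemma local_time_lower:
  fixes x :: 's
  defines "l \<equiv> \<lambda>a T \<eta>. LINT u:{a..a+T}|lborel. of_bool (S u \<eta> = x)"
  assumes a: "0 \<le> a" and T: "0 < T" and \<theta>: "0 < \<theta>" and \<mu>: "0 \<le> \<mu>"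
    and \<phi>: "\<And>y. 0 \<le> \<phi> y" "\<And>y. \<phi> y \<le> 1" "\<phi> x = 1"
    and L\<phi>: "\<And>y. L \<phi> y + \<theta> * of_bool (y = x) * \<phi> y \<ge> \<mu> * \<phi> y" "\<And>y. \<bar>L \<phi> y\<bar> \<le> D"
    and \<psi>: "\<And>y. 1 \<le> \<psi> y" "\<And>y. \<psi> y \<le> C"
    and L\<psi>: "\<And>y. L \<psi> y + 2 * \<theta> * of_bool (y = x) * \<psi> y \<le> \<nu> * \<psi> y"
  shows "prob {\<eta> \<in> space N. S a \<eta> = x \<and> (\<mu> * T - ln 2) / \<theta> \<le> l a T \<eta>}
    \<ge> pmf (K a x\<^sub>0) x * exp ((2 * \<mu> - \<nu>) * T) / (4 * C)"
    and "l a T \<in> borel_measurable N"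
proof -
  have int: "(LINT u:{a..a+T}|lborel. c * of_bool (S u \<eta> = x)) = c * l a T \<eta>" for c \<eta>
    unfolding l_def by (rule set_integral_mult_right)
  have C: "C > 0" using \<psi>[of x] by linarith
  show lm: "l a T \<in> borel_measurable N"
    unfolding l_def by (rule fk_limit(3)[of _ 1]) (use a T in auto)
  let ?G = "{\<eta> \<in> space N. S a \<eta> = x}"
  let ?w = "\<lambda>\<eta>. exp (\<theta> * l a T \<eta>)"
  have G: "?G \<in> sets N" by (rule S_pred_sets[OF a])
  have sq: "(?w \<eta>)\<^sup>2 = exp (2 * \<theta> * l a T \<eta>)" for \<eta>
    by (simp add: power2_eq_square exp_add[symmetric])
  have ind: "indicator ?G \<eta> = (of_bool (S a \<eta> = x) :: real)" if "\<eta> \<in> space N" for \<eta>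
    using that by (simp add: indicator_def)
  have i1: "integrable N (\<lambda>\<eta>. of_bool (S a \<eta> = x) * exp (c * l a T \<eta>))" if "c \<ge> 0" for c
    using fk_limit(2)[of "\<lambda>y. c * of_bool (y = x)" c a T x] that a T unfolding int by auto
  have "prob {\<eta> \<in> space N. \<eta> \<in> ?G \<and> exp (\<mu> * T) / 2 \<le> ?w \<eta>}
      \<ge> pmf (K a x\<^sub>0) x * (exp (\<mu> * T))\<^sup>2 / (4 * (C * exp (\<nu> * T)))"
  proof (rule paley_zygmund_on[OF G])
    show "?w \<in> borel_measurable N" using lm by measurable
    show "integrable N (\<lambda>\<eta>. indicator ?G \<eta> * ?w \<eta>)"
      using i1[of \<theta>] \<theta> by (subst Bochner_Integration.integrable_cong[OF refl, of _ _ "\<lambda>\<eta>. of_bool (S a \<eta> = x) * ?w \<eta>"]) (auto simp: ind)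
    show "integrable N (\<lambda>\<eta>. indicator ?G \<eta> * (?w \<eta>)\<^sup>2)"
      using i1[of "2 * \<theta>"] \<theta> unfolding sq
      by (subst Bochner_Integration.integrable_cong[OF refl, of _ _ "\<lambda>\<eta>. of_bool (S a \<eta> = x) * exp (2 * \<theta> * l a T \<eta>)"]) (auto simp: ind)
    show "prob ?G \<le> pmf (K a x\<^sub>0) x" using prob_S[OF a, of x] by simp
    have "pmf (K a x\<^sub>0) x * (exp (\<mu> * T) * \<phi> x) \<le> (LINT \<eta>|N. of_bool (S a \<eta> = x) * exp (LINT u:{a..a+T}|lborel. \<theta> * of_bool (S u \<eta> = x)))"
      by (rule fk_lower[where B=\<theta> and D=D]) (use a T \<theta> \<mu> \<phi> L\<phi> in auto)
    also have "\<dots> = (LINT \<eta>|N. indicator ?G \<eta> * ?w \<eta>)"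
      unfolding int by (rule Bochner_Integration.integral_cong) (auto simp: ind)
    finally show "pmf (K a x\<^sub>0) x * exp (\<mu> * T) \<le> (LINT \<eta>|N. indicator ?G \<eta> * ?w \<eta>)" using \<phi> by simp
    have "(LINT \<eta>|N. indicator ?G \<eta> * (?w \<eta>)\<^sup>2) =
        (LINT \<eta>|N. of_bool (S a \<eta> = x) * exp (LINT u:{a..a+T}|lborel. 2 * \<theta> * of_bool (S u \<eta> = x)))"
      unfolding int sq by (rule Bochner_Integration.integral_cong) (auto simp: ind)
    also have "\<dots> \<le> pmf (K a x\<^sub>0) x * (C * exp (\<nu> * T))"
      by (rule fk_upper[where B="2 * \<theta>" and \<phi>=\<psi>]) (use a T \<theta> \<psi> L\<psi> in auto)
    finally show "(LINT \<eta>|N. indicator ?G \<eta> * (?w \<eta>)\<^sup>2) \<le> pmf (K a x\<^sub>0) x * (C * exp (\<nu> * T))" .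
  qed (use C in auto)
  also have "{\<eta> \<in> space N. \<eta> \<in> ?G \<and> exp (\<mu> * T) / 2 \<le> ?w \<eta>} =
      {\<eta> \<in> space N. S a \<eta> = x \<and> (\<mu> * T - ln 2) / \<theta> \<le> l a T \<eta>}"
  proof -
    have "exp (\<mu> * T) / 2 = exp (\<mu> * T - ln 2)" by (simp add: exp_diff)
    then show ?thesis using \<theta> by (auto simp: divide_le_eq mult.commute)
  qed
  also have "pmf (K a x\<^sub>0) x * (exp (\<mu> * T))\<^sup>2 / (4 * (C * exp (\<nu> * T))) =
      pmf (K a x\<^sub>0) x * exp ((2 * \<mu> - \<nu>) * T) / (4 * C)"
  proof -
    have "exp ((2 * \<mu> - \<nu>) * T) = (exp (\<mu> * T))\<^sup>2 / exp (\<nu> * T)"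
      by (simp add: exp_diff[symmetric] power2_eq_square exp_add[symmetric] algebra_simps)
    then show ?thesis by simp
  qed
  finally show "prob {\<eta> \<in> space N. S a \<eta> = x \<and> (\<mu> * T - ln 2) / \<theta> \<le> l a T \<eta>}
    \<ge> pmf (K a x\<^sub>0) x * exp ((2 * \<mu> - \<nu>) * T) / (4 * C)" .
qed

lemma path_integrable:
  fixes \<zeta> :: "'s \<Rightarrow> real"
  assumes "\<eta> \<in> space N" "0 \<le> a" "0 < T"
  shows "set_integrable lborel {a..a+T} (\<lambda>u. \<zeta> (S u \<eta>))"
  by (rule riemann_sum_path(1)[where s="\<lambda>u. S u \<eta>" and \<zeta>=\<zeta> and a=a and T=T]) (use assms S_rc S_ll in auto)

lemma scenery_integral_ge_local_time:
  assumes \<eta>: "\<eta> \<in> space N" and a: "0 \<le> a" and T: "0 < T" and \<zeta>: "\<And>y. 0 \<le> \<zeta> y"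
  shows "\<zeta> x * (LINT u:{a..a+T}|lborel. of_bool (S u \<eta> = x)) \<le> scenery_integral \<zeta> (\<lambda>u. S u \<eta>) (a + T)"
proof -
  have i1: "integrable lborel (\<lambda>u. indicator {a..a+T} u *\<^sub>R (\<zeta> x * of_bool (S u \<eta> = x)))"
    using path_integrable[OF \<eta> a T, of "\<lambda>y. \<zeta> x * of_bool (y = x)"] unfolding set_integrable_def .
  have i2: "integrable lborel (\<lambda>u. indicator {0..a+T} u *\<^sub>R \<zeta> (S u \<eta>))"
    using path_integrable[OF \<eta>, of 0 "a + T" \<zeta>] a T unfolding set_integrable_def by simp
  have "\<zeta> x * (LINT u:{a..a+T}|lborel. of_bool (S u \<eta> = x)) =
      (LINT u:{a..a+T}|lborel. \<zeta> x * of_bool (S u \<eta> = x))" by (rule set_integral_mult_right[symmetric])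
  also have "\<dots> \<le> scenery_integral \<zeta> (\<lambda>u. S u \<eta>) (a + T)"
    unfolding scenery_integral_def set_lebesgue_integral_def
    by (rule integral_mono[OF i1 i2]) (use a \<zeta> in \<open>auto simp: indicator_def\<close>)
  finally show ?thesis .
qed

lemma scenery_integral_measurable:
  assumes t: "0 < t"
  shows "(\<lambda>\<eta>. scenery_integral \<zeta> (\<lambda>u. S u \<eta>) t) \<in> borel_measurable N"
proof (rule borel_measurable_LIMSEQ_real)
  show "(\<lambda>n. t / real (Suc n) * (\<Sum>j<Suc n. \<zeta> (S (0 + real j * (t / real (Suc n))) \<eta>)))
     \<longlonglongrightarrow> scenery_integral \<zeta> (\<lambda>u. S u \<eta>) t" if "\<eta> \<in> space N" for \<eta>
    using riemann_sum_path(2)[where s="\<lambda>u. S u \<eta>" and a=0 and T=t and \<zeta>=\<zeta>] S_rc S_ll that t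
    by (simp add: scenery_integral_def)
  show "(\<lambda>\<eta>. t / real (Suc n) * (\<Sum>j<Suc n. \<zeta> (S (0 + real j * (t / real (Suc n))) \<eta>))) \<in> borel_measurable N" for n
    using t by (intro borel_measurable_times borel_measurable_const borel_measurable_sum S_fun_measurable) auto
qed

text \<open>Proved first for nonnegative functions, where iterated integrals of
  \<open>bind_pmf\<close> are exact; the shift by \<open>B\<close> carries it over to bounded signed
  ones.\<close>

lemma expectation_semigroup:
  fixes f :: "'s \<Rightarrow> real"
  assumes f: "\<And>x. \<bar>f x\<bar> \<le> B" and st: "0 \<le> s" "0 \<le> t"
  shows "measure_pmf.expectation (K (s + t) x) f =
    measure_pmf.expectation (K s x) (\<lambda>y. measure_pmf.expectation (K t y) f)"
proof -
  have pos: "measure_pmf.expectation (K (s + t) x) g =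
    measure_pmf.expectation (K s x) (\<lambda>y. measure_pmf.expectation (K t y) g)"
    if g: "\<And>x. 0 \<le> g x" "\<And>x. g x \<le> U" for g :: "'s \<Rightarrow> real" and U
  proof -
    have U: "0 \<le> U" using g[of x] by linarith
    have ig: "integrable (measure_pmf p) g" for p using g by (rule integrable_pmf_bounded)
    have b: "measure_pmf.expectation (K t y) g \<le> U" for y
      using expectation_pmf_mono[of g "\<lambda>_. U" U "K t y"] g by simp
    have "ennreal (measure_pmf.expectation (K (s + t) x) g) = (\<integral>\<^sup>+ y. ennreal (g y) \<partial>K (s + t) x)"
      using g ig by (simp add: nn_integral_eq_integral)
    also have "\<dots> = (\<integral>\<^sup>+ y. (\<integral>\<^sup>+ z. ennreal (g z) \<partial>K t y) \<partial>K s x)"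
      using semigroup st by (simp add: markov_semigroup_def)
    also have "\<dots> = (\<integral>\<^sup>+ y. ennreal (measure_pmf.expectation (K t y) g) \<partial>K s x)"
      using g ig by (simp add: nn_integral_eq_integral)
    also have "\<dots> = ennreal (measure_pmf.expectation (K s x) (\<lambda>y. measure_pmf.expectation (K t y) g))"
      using g b by (intro nn_integral_eq_integral integrable_pmf_bounded[where U=U]) auto
    finally show ?thesis using g by simp
  qed
  have B: "0 \<le> B" using f[of x] by linarith
  have i: "integrable (measure_pmf p) f" for p
    using f by (intro measure_pmf.integrable_const_bound[where B=B]) auto
  have b: "\<bar>measure_pmf.expectation (K t y) f\<bar> \<le> B" for y
    using measure_pmf.integral_ge_const[OF i[of "K t y"], of "- B"]
      measure_pmf.integral_le_const[OF i[of "K t y"], of B] f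
    by (auto simp: abs_le_iff minus_le_iff)
  have i': "integrable (K s x) (\<lambda>y. measure_pmf.expectation (K t y) f)"
    using b by (intro measure_pmf.integrable_const_bound[where B=B]) auto
  have fB: "0 \<le> f y + B" "f y + B \<le> B + B" for y using f[of y] by linarith+
  have "measure_pmf.expectation (K (s + t) x) (\<lambda>y. f y + B) =
    measure_pmf.expectation (K s x) (\<lambda>y. measure_pmf.expectation (K t y) (\<lambda>y. f y + B))"
    by (rule pos[OF fB])
  then show ?thesis using i i' by (simp add: Bochner_Integration.integral_add)
qed

lemma expectation_dist_le:
  fixes f g :: "'s \<Rightarrow> real"
  assumes f: "\<And>x. \<bar>f x\<bar> \<le> A" and g: "\<And>x. \<bar>g x\<bar> \<le> B" and fg: "\<And>x. \<bar>f x - g x\<bar> \<le> \<epsilon>"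
  shows "\<bar>measure_pmf.expectation p f - measure_pmf.expectation p g\<bar> \<le> \<epsilon>"
proof -
  have i: "integrable (measure_pmf p) f" "integrable (measure_pmf p) g"
    using measure_pmf.integrable_const_bound[where f=f and B=A and M=p]
      measure_pmf.integrable_const_bound[where f=g and B=B and M=p] f g by auto
  have "measure_pmf.expectation p f - measure_pmf.expectation p g = measure_pmf.expectation p (\<lambda>x. f x - g x)"
    using i by simp
  moreover have id: "integrable (measure_pmf p) (\<lambda>x. f x - g x)" using i by simp
  moreover have "- \<epsilon> \<le> f x - g x \<and> f x - g x \<le> \<epsilon>" for x using fg[of x] by linarith
  ultimately show ?thesis
    using measure_pmf.integral_ge_const[OF id, of "- \<epsilon>"] measure_pmf.integral_le_const[OF id, of \<epsilon>]
    by (auto simp: abs_le_iff)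
qed

lemma expectation_abs_le:
  fixes f :: "'s \<Rightarrow> real"
  assumes "\<And>x. \<bar>f x\<bar> \<le> B"
  shows "\<bar>measure_pmf.expectation p f\<bar> \<le> B"
  using expectation_dist_le[of f B "\<lambda>_. 0" 0 B p] assms by simp

text \<open>The generator speaks of increments from time 0. Its error is uniform in the state, hence
  survives averaging under \<open>K s x\<close>; with the semigroup law this gives one bound for all
  times \<open>s\<close>.\<close>

lemma semigroup_increment:
  assumes f: "\<And>x. \<bar>f x\<bar> \<le> A" and Lf: "\<And>x. \<bar>L f x\<bar> \<le> B" and \<epsilon>: "0 < \<epsilon>"
  obtains h\<^sub>0 where "h\<^sub>0 > 0"
    "\<And>h s x. 0 < h \<Longrightarrow> h < h\<^sub>0 \<Longrightarrow> 0 \<le> s \<Longrightarrow>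
      \<bar>measure_pmf.expectation (K (s + h) x) f - measure_pmf.expectation (K s x) f
        - h * measure_pmf.expectation (K s x) (L f)\<bar> \<le> h * \<epsilon>"
proof -
  have bd: "bounded (range f)" using f by (intro boundedI[where B=A]) auto
  obtain h\<^sub>0 where H: "h\<^sub>0 > 0"
    "\<And>h x. 0 < h \<Longrightarrow> h < h\<^sub>0 \<Longrightarrow> \<bar>measure_pmf.expectation (K h x) f - f x - h * L f x\<bar> \<le> h * \<epsilon>"
    using generator_approx[OF bd \<epsilon>] by blast
  show thesis
  proof (rule that[OF H(1)])
    fix h s x assume h: "0 < h" "h < h\<^sub>0" "(0::real) \<le> s"
    let ?g = "\<lambda>y. measure_pmf.expectation (K h y) f"
    let ?k = "\<lambda>y. f y + h * L f y"
    have k: "\<bar>?k y\<bar> \<le> A + h * B" for y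
    proof -
      have "\<bar>h * L f y\<bar> \<le> h * B" using Lf[of y] h by (simp add: abs_mult)
      then show ?thesis using f[of y] by linarith
    qed
    have "\<bar>measure_pmf.expectation (K s x) ?g - measure_pmf.expectation (K s x) ?k\<bar> \<le> h * \<epsilon>"
      using expectation_dist_le[of ?g A ?k "A + h * B" "h * \<epsilon>" "K s x"] expectation_abs_le[of f A, OF f] k H(2)[OF h(1,2)]
      by (simp add: diff_diff_eq)
    moreover have "measure_pmf.expectation (K s x) ?g = measure_pmf.expectation (K (s + h) x) f"
      using expectation_semigroup[OF f, of s h x] h by simp
    moreover have "measure_pmf.expectation (K s x) ?k =
        measure_pmf.expectation (K s x) f + h * measure_pmf.expectation (K s x) (L f)"
    proof -
      have "integrable (K s x) f" "integrable (K s x) (L f)"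
        using measure_pmf.integrable_const_bound[where f=f and B=A and M="K s x"]
          measure_pmf.integrable_const_bound[where f="L f" and B=B and M="K s x"] f Lf by auto
      then show ?thesis by simp
    qed
    ultimately show "\<bar>measure_pmf.expectation (K (s + h) x) f - measure_pmf.expectation (K s x) f
        - h * measure_pmf.expectation (K s x) (L f)\<bar> \<le> h * \<epsilon>" by (simp add: diff_diff_eq)
  qed
qed

lemma semigroup_continuous:
  assumes f: "\<And>x. \<bar>f x\<bar> \<le> A" and Lf: "\<And>x. \<bar>L f x\<bar> \<le> B"
  shows "continuous_on {0..} (\<lambda>t. measure_pmf.expectation (K t x) f)"
proof -
  obtain h\<^sub>0 where H: "h\<^sub>0 > 0"
    "\<And>h s x. 0 < h \<Longrightarrow> h < h\<^sub>0 \<Longrightarrow> 0 \<le> s \<Longrightarrow>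
      \<bar>measure_pmf.expectation (K (s + h) x) f - measure_pmf.expectation (K s x) f
        - h * measure_pmf.expectation (K s x) (L f)\<bar> \<le> h * 1"
    using semigroup_increment[OF f Lf, of 1] by auto
  have B: "0 \<le> B" using Lf[of x] by linarith
  have lip: "\<bar>measure_pmf.expectation (K t x) f - measure_pmf.expectation (K s x) f\<bar> \<le> (t - s) * (1 + B)"
    if "0 \<le> s" "s \<le> t" "t - s < h\<^sub>0" for s t
  proof (cases "s = t")
    case False
    have "\<bar>(t - s) * measure_pmf.expectation (K s x) (L f)\<bar> \<le> (t - s) * B"
      using expectation_abs_le[of "L f" B "K s x", OF Lf] that by (simp add: abs_mult mult_left_mono)
    then show ?thesis using H(2)[of "t - s" s x] that False by (simp add: distrib_left)
  qed simp
  show ?thesis unfolding continuous_on_iff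
  proof (intro ballI allI impI)
    fix t e :: real assume t: "t \<in> {0..}" and e: "0 < e"
    define \<delta> where "\<delta> = min h\<^sub>0 (e / (1 + B))"
    have \<delta>: "\<delta> > 0" using H(1) e B by (simp add: \<delta>_def)
    have "dist (measure_pmf.expectation (K s x) f) (measure_pmf.expectation (K t x) f) < e"
      if s: "s \<in> {0..}" "dist s t < \<delta>" for s
    proof -
      have d: "\<bar>s - t\<bar> < h\<^sub>0" "\<bar>s - t\<bar> * (1 + B) < e"
        using s(2) B by (auto simp: \<delta>_def dist_real_def pos_less_divide_eq)
      have "\<bar>measure_pmf.expectation (K s x) f - measure_pmf.expectation (K t x) f\<bar> \<le> \<bar>s - t\<bar> * (1 + B)"
        using lip[of s t] lip[of t s] s t d by (cases "s \<le> t") (auto simp: abs_minus_commute)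
      then show ?thesis using d by (simp add: dist_real_def)
    qed
    then show "\<exists>d>0. \<forall>x'\<in>{0..}. dist x' t < d \<longrightarrow>
        dist (measure_pmf.expectation (K x' x) f) (measure_pmf.expectation (K t x) f) < e"
      using \<delta> by blast
  qed
qed

text \<open>The increment bound handles difference quotients to the right. To the left it is applied
  at \<open>t - k\<close> and yields the average of \<open>L f\<close> at that time; continuity of
  this average, for which \<open>L (L f)\<close> is taken bounded, moves it to
  \<open>t\<close>.\<close>

lemma semigroup_deriv:
  assumes f: "\<And>x. \<bar>f x\<bar> \<le> A" and Lf: "\<And>x. \<bar>L f x\<bar> \<le> B" and LLf: "\<And>x. \<bar>L (L f) x\<bar> \<le> C" and t: "0 < t"
  shows "((\<lambda>t. measure_pmf.expectation (K t x) f) has_real_derivative measure_pmf.expectation (K t x) (L f)) (at t)"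
proof -
  let ?F = "\<lambda>t. measure_pmf.expectation (K t x) f" and ?G = "\<lambda>t. measure_pmf.expectation (K t x) (L f)"
  have cont: "continuous_on {0..} ?G" by (rule semigroup_continuous[OF Lf LLf])
  show ?thesis unfolding DERIV_def LIM_def dist_real_def
  proof (intro allI impI)
    fix e :: real assume e: "0 < e"
    obtain h\<^sub>0 where H: "h\<^sub>0 > 0"
      "\<And>h s x. 0 < h \<Longrightarrow> h < h\<^sub>0 \<Longrightarrow> 0 \<le> s \<Longrightarrow>
        \<bar>measure_pmf.expectation (K (s + h) x) f - measure_pmf.expectation (K s x) f
          - h * measure_pmf.expectation (K s x) (L f)\<bar> \<le> h * (e/3)"
      using semigroup_increment[OF f Lf, of "e/3"] e by auto
    obtain \<delta> where \<delta>: "\<delta> > 0" "\<And>s. 0 \<le> s \<Longrightarrow> dist s t < \<delta> \<Longrightarrow> dist (?G s) (?G t) < e/3"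
      using cont t e unfolding continuous_on_iff by (metis atLeast_iff divide_pos_pos less_imp_le zero_less_numeral)
    have "norm ((?F (t + h) - ?F t) / h - ?G t) < e" if h: "h \<noteq> 0" "\<bar>h\<bar> < Min {h\<^sub>0, \<delta>, t}" for h
    proof (cases "h > 0")
      case True
      have "\<bar>(?F (t + h) - ?F t) / h - ?G t\<bar> * h = \<bar>?F (t + h) - ?F t - h * ?G t\<bar>"
      proof -
        have "((?F (t + h) - ?F t) / h - ?G t) * h = ?F (t + h) - ?F t - h * ?G t"
          using True by (simp add: field_simps)
        then show ?thesis using True by (metis abs_mult abs_of_pos)
      qed
      also have "\<dots> \<le> h * (e/3)" using H(2)[of h t x] True h t by simp
      finally show ?thesis using True e by (simp add: mult.commute)
    next
      case False
      define k where "k = - h"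
      have k: "0 < k" "k < h\<^sub>0" "k < \<delta>" "k < t" using False h by (auto simp: k_def)
      have "\<bar>(?F (t - k) - ?F t) / (- k) - ?G (t - k)\<bar> * k = \<bar>?F t - ?F (t - k) - k * ?G (t - k)\<bar>"
      proof -
        have "((?F (t - k) - ?F t) / (- k) - ?G (t - k)) * k = ?F t - ?F (t - k) - k * ?G (t - k)"
          using k by (simp add: field_simps)
        then show ?thesis using k by (metis abs_mult abs_of_pos)
      qed
      also have "\<dots> \<le> k * (e/3)" using H(2)[of k "t - k" x] k by simp
      finally have "\<bar>(?F (t - k) - ?F t) / (- k) - ?G (t - k)\<bar> \<le> e/3" using k by (simp add: mult.commute)
      moreover have "\<bar>?G (t - k) - ?G t\<bar> < e/3" using \<delta>(2)[of "t - k"] k by (simp add: dist_real_def)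
      ultimately have "\<bar>(?F (t - k) - ?F t) / (- k) - ?G t\<bar> < e" using e by linarith
      then show ?thesis by (simp add: k_def)
    qed
    moreover have "Min {h\<^sub>0, \<delta>, t} > 0" using H \<delta> t by simp
    ultimately show "\<exists>s>0. \<forall>h. h \<noteq> 0 \<and> \<bar>h - 0\<bar> < s \<longrightarrow> \<bar>(?F (t + h) - ?F t) / h - ?G t\<bar> < e"
      by (intro exI[of _ "Min {h\<^sub>0, \<delta>, t}"]) (simp del: Min_gr_iff Min_insert)
  qed
qed

end

section \<open>The heat kernel of the walk\<close>

definition nbr :: "'d \<times> bool \<Rightarrow> int ^ 'd::finite" where
  "nbr j = (if snd j then axis (fst j) 1 else - axis (fst j) 1)"

lemma nbr_nth: "nbr j $ i = (if i = fst j then (if snd j then 1 else -1) else 0)"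
  by (auto simp: nbr_def axis_def)

lemma UNIV_nbr: "(UNIV :: ('d \<times> bool) set) = UNIV \<times> UNIV"
  by simp

lemma sum_nbr:
  fixes g :: "'d::finite \<times> bool \<Rightarrow> 'a::comm_monoid_add"
  shows "(\<Sum>j\<in>UNIV. g j) = (\<Sum>i\<in>UNIV. g (i, True) + g (i, False))"
  unfolding UNIV_nbr sum.cartesian_product' by (simp add: UNIV_bool add.commute)

definition walk_avg :: "(int ^ 'd::finite \<Rightarrow> real) \<Rightarrow> int ^ 'd \<Rightarrow> real" where
  "walk_avg f x = (\<Sum>j\<in>UNIV. f (x + nbr j)) / (2 * real CARD('d))"

abbreviation walk_gen :: "(int ^ 'd::finite \<Rightarrow> real) \<Rightarrow> int ^ 'd \<Rightarrow> real" where
  "walk_gen f x \<equiv> discrete_laplacian f x / (2 * real CARD('d))"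

lemma walk_gen_avg: "walk_gen f x = walk_avg f x - f (x :: int ^ 'd::finite)"
proof -
  have "discrete_laplacian f x = (\<Sum>j\<in>UNIV. f (x + nbr j) - f x)"
    unfolding discrete_laplacian_def sum_nbr by (simp add: nbr_def)
  also have "\<dots> = (\<Sum>j\<in>UNIV. f (x + nbr j)) - 2 * real CARD('d) * f x"
    by (simp add: sum_subtractf card_UNIV_bool card_cartesian_product UNIV_nbr del: UNIV_Times_UNIV)
  finally show ?thesis by (simp add: walk_avg_def diff_divide_distrib)
qed

lemma walk_avg_bound:
  fixes f :: "int ^ 'd::finite \<Rightarrow> real"
  assumes "\<And>x. \<bar>f x\<bar> \<le> B"
  shows "\<bar>walk_avg f x\<bar> \<le> B"
proof -
  have "\<bar>\<Sum>j\<in>UNIV. f (x + nbr j)\<bar> \<le> (\<Sum>j\<in>(UNIV::('d\<times>bool) set). B)"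
    using assms by (intro order_trans[OF sum_abs] sum_mono)
  also have "\<dots> = B * (2 * real CARD('d))"
    by (simp add: card_cartesian_product UNIV_nbr del: UNIV_Times_UNIV)
  finally show ?thesis by (simp add: walk_avg_def divide_le_eq)
qed

lemma walk_gen_bound:
  fixes f :: "int ^ 'd::finite \<Rightarrow> real"
  assumes "\<And>x. \<bar>f x\<bar> \<le> B"
  shows "\<bar>walk_gen f x\<bar> \<le> 2 * B"
  using walk_avg_bound[of f B x, OF assms] assms[of x] unfolding walk_gen_avg by linarith

text \<open>Stirling's formula up to a factor of order sqrt m; polynomial factors are invisible on
  the scale \<open>exp (- t powr p)\<close>.\<close>

lemma ln_fact_upper:
  assumes "1 \<le> m"
  shows "ln (fact m) \<le> 1 + ln (real m) + real m * ln (real m) - real m"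
  using assms
proof (induction m rule: dec_induct)
  case (step m)
  have m: "real m > 0" using step by simp
  have "ln (real m / (real m + 1)) \<le> real m / (real m + 1) - 1"
    using m by (intro ln_le_minus_one) simp
  then have "ln (real m) - ln (real m + 1) \<le> - 1 / (real m + 1)"
    using m by (simp add: ln_div field_simps)
  then have "(real m + 1) * (ln (real m) - ln (real m + 1)) \<le> (real m + 1) * (- 1 / (real m + 1))"
    using m by (intro mult_left_mono) auto
  then have "(real m + 1) * ln (real m) + 1 \<le> (real m + 1) * ln (real m + 1)"
    using m by (simp add: right_diff_distrib)
  moreover have "ln (fact (Suc m)) = ln (real m + 1) + ln (fact m)"
    using m by (simp add: ln_mult add.commute)
  ultimately show ?case using step.IH by (simp add: algebra_simps)
qed simp

text \<open>A Poisson weight is at least Gaussian up to polynomial factors: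
  \<open>ln (m / \<kappa>) \<le> m / \<kappa> - 1\<close> bounds the exponent
  \<open>m * ln (m / \<kappa>) - m + \<kappa>\<close> by
  \<open>(m - \<kappa>)^2 / \<kappa>\<close>.\<close>

lemma poisson_term_lower:
  fixes \<kappa> :: real
  assumes \<kappa>: "0 < \<kappa>"
  shows "exp (- ((real m - \<kappa>)\<^sup>2 / \<kappa>) - 1) / (real m + 1) \<le> \<kappa> ^ m * exp (- \<kappa>) / fact m"
proof (cases "m = 0")
  case True
  then show ?thesis using \<kappa> by (simp add: power2_eq_square)
next
  case False
  then have m: "real m > 0" "1 \<le> m" by auto
  have "ln (real m / \<kappa>) \<le> real m / \<kappa> - 1" using m \<kappa> by (intro ln_le_minus_one) simp
  then have "real m * (ln (real m) - ln \<kappa>) \<le> real m * (real m / \<kappa> - 1)"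
    using m \<kappa> by (intro mult_left_mono) (auto simp: ln_div)
  moreover have "real m * (real m / \<kappa> - 1) = (real m - \<kappa>)\<^sup>2 / \<kappa> + real m - \<kappa>"
    using \<kappa> by (simp add: power2_eq_square field_simps)
  moreover have "ln (real m) \<le> ln (real m + 1)" using m by simp
  ultimately have "- ((real m - \<kappa>)\<^sup>2 / \<kappa>) - 1 - ln (real m + 1) \<le> real m * ln \<kappa> - \<kappa> - ln (fact m)"
    using ln_fact_upper[OF m(2)] by (simp add: algebra_simps)
  then have "exp (- ((real m - \<kappa>)\<^sup>2 / \<kappa>) - 1 - ln (real m + 1)) \<le> exp (real m * ln \<kappa> - \<kappa> - ln (fact m))"
    by (simp only: exp_le_cancel_iff)
  moreover have "exp (real m * ln \<kappa> - \<kappa> - ln (fact m)) = \<kappa> ^ m * exp (- \<kappa>) / fact m"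
    using \<kappa> by (simp add: exp_diff exp_of_nat_mult exp_minus exp_add field_simps)
  moreover have "exp (- ((real m - \<kappa>)\<^sup>2 / \<kappa>) - 1 - ln (real m + 1)) = exp (- ((real m - \<kappa>)\<^sup>2 / \<kappa>) - 1) / (real m + 1)"
    using m by (simp add: exp_diff)
  ultimately show ?thesis by simp
qed

section \<open>Gaussian lower bound for the continuous-time heat kernel\<close>

locale walk = jump_process N S K 0 "walk_gen :: (int ^ 'd::finite \<Rightarrow> real) \<Rightarrow> int ^ 'd \<Rightarrow> real"
  for N :: "'b measure" and S :: "real \<Rightarrow> 'b \<Rightarrow> int ^ 'd" and K :: "real \<Rightarrow> int ^ 'd \<Rightarrow> (int ^ 'd) pmf"
begin

lemma expectation_of_bool: "measure_pmf.expectation p (\<lambda>z. of_bool (z = y)) = pmf p y"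
proof -
  have "(\<lambda>z. of_bool (z = y)) = (indicator {y} :: _ \<Rightarrow> real)" by (auto simp: indicator_def)
  then show ?thesis by (simp add: measure_pmf_single)
qed

text \<open>Kolmogorov's forward equation. The factor \<open>exp s\<close> removes the loss at rate
  1; the remaining right side is nonnegative, so lower bounds can be integrated.\<close>

lemma pmf_kernel_deriv:
  assumes t: "0 < t"
  shows "((\<lambda>s. exp s * pmf (K s x) y) has_real_derivative
    exp t * (\<Sum>j\<in>UNIV. pmf (K t x) (y - nbr j)) / (2 * real CARD('d))) (at t)"
proof -
  define f :: "int ^ 'd \<Rightarrow> real" where "f z = of_bool (z = y)" for z
  have f: "\<bar>f z\<bar> \<le> 1" for z by (simp add: f_def)
  have Lf: "\<bar>walk_gen f z\<bar> \<le> 2" for z using walk_gen_bound[of f 1 z] f by simp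
  have LLf: "\<bar>walk_gen (walk_gen f) z\<bar> \<le> 4" for z using walk_gen_bound[of "walk_gen f" 2 z] Lf by simp
  have "measure_pmf.expectation (K t x) (walk_gen f) =
      measure_pmf.expectation (K t x) (\<lambda>z. walk_avg f z - f z)" by (simp only: walk_gen_avg)
  also have "\<dots> = measure_pmf.expectation (K t x) (walk_avg f) - measure_pmf.expectation (K t x) f"
    using f walk_avg_bound[of f 1]
    by (intro Bochner_Integration.integral_diff measure_pmf.integrable_const_bound[where B=1]) auto
  also have "measure_pmf.expectation (K t x) (walk_avg f) =
      (\<Sum>j\<in>UNIV. measure_pmf.expectation (K t x) (\<lambda>z. f (z + nbr j))) / (2 * real CARD('d))"
  proof -
    have "integrable (K t x) (\<lambda>z. f (z + nbr j))" for j
      using f by (intro measure_pmf.integrable_const_bound[where B=1]) auto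
    then show ?thesis unfolding walk_avg_def by (simp add: Bochner_Integration.integral_sum)
  qed
  also have "\<dots> = (\<Sum>j\<in>UNIV. measure_pmf.expectation (K t x) (\<lambda>z. of_bool (z = y - nbr j))) / (2 * real CARD('d))"
    by (simp add: f_def eq_diff_eq)
  finally have E: "measure_pmf.expectation (K t x) (walk_gen f) =
      (\<Sum>j\<in>UNIV. pmf (K t x) (y - nbr j)) / (2 * real CARD('d)) - measure_pmf.expectation (K t x) f"
    by (simp only: expectation_of_bool)
  have "((\<lambda>s. exp s * measure_pmf.expectation (K s x) f) has_real_derivative
      exp t * measure_pmf.expectation (K t x) f + measure_pmf.expectation (K t x) (walk_gen f) * exp t) (at t)"
    by (rule DERIV_mult[OF DERIV_exp semigroup_deriv[of f 1 2 4]]) (use f Lf LLf t in auto)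
  moreover have "exp t * measure_pmf.expectation (K t x) f + measure_pmf.expectation (K t x) (walk_gen f) * exp t =
      exp t * (\<Sum>j\<in>UNIV. pmf (K t x) (y - nbr j)) / (2 * real CARD('d))"
    unfolding E by (simp add: algebra_simps)
  moreover have "(\<lambda>s. exp s * measure_pmf.expectation (K s x) f) = (\<lambda>s. exp s * pmf (K s x) y)"
    unfolding f_def by (simp only: expectation_of_bool)
  ultimately show ?thesis by simp
qed

lemma pmf_kernel_continuous: "continuous_on {0..} (\<lambda>s. exp s * pmf (K s x) y)"
proof -
  have "continuous_on {0..} (\<lambda>s. measure_pmf.expectation (K s x) (\<lambda>z. of_bool (z = y) :: real))"
    using walk_gen_bound[of "\<lambda>z. of_bool (z = y)" 1]
    by (intro semigroup_continuous[where A=1 and B=2]) auto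
  then show ?thesis unfolding expectation_of_bool by (intro continuous_intros)
qed

text \<open>\<open>m j\<close> counts the steps in direction \<open>j\<close>. Times
  \<open>exp (- t)\<close>, the left side is the probability of exactly these counts, which are
  independent Poisson variables with mean \<open>t / (2 * d)\<close>. The induction removes the last
  step and adds up its possible directions in the forward equation.\<close>

lemma kernel_lower_counts:
  fixes m :: "'d \<times> bool \<Rightarrow> nat"
  assumes "\<And>i. y $ i = x $ i + int (m (i, True)) - int (m (i, False))" "(\<Sum>j\<in>UNIV. m j) = n" "0 \<le> t"
  shows "t ^ n / ((2 * real CARD('d)) ^ n * (\<Prod>j\<in>UNIV. fact (m j))) \<le> exp t * pmf (K t x) y"
  using assms
proof (induction n arbitrary: m y t)
  case 0
  have m0: "m j = 0" for j using 0(2) by (cases j) (simp add: sum_eq_0_iff)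
  then have yx: "y = x" using 0(1) by (simp add: vec_eq_iff)
  have "exp 0 * pmf (K 0 x) x \<le> exp t * pmf (K t x) x"
  proof -
    have "0 \<le> t" using 0 by simp
    then show ?thesis
    proof (rule DERIV_nonneg_imp_increasing_open[where f="\<lambda>s. exp s * pmf (K s x) x"])
      fix s :: real assume s: "0 < s" "s < t"
      show "\<exists>y. ((\<lambda>s. exp s * pmf (K s x) x) has_real_derivative y) (at s) \<and> 0 \<le> y"
        using pmf_kernel_deriv[OF s(1), of x x] by (intro exI conjI) (auto intro!: divide_nonneg_nonneg mult_nonneg_nonneg sum_nonneg)
    qed (rule continuous_on_subset[OF pmf_kernel_continuous], auto)
  qed
  then show ?case by (simp add: m0 yx K_0)
next
  case (Suc n)
  define c where "c = (2 * real CARD('d)) ^ Suc n * (\<Prod>j\<in>UNIV. fact (m j))"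
  have c: "c > 0" unfolding c_def by (intro mult_pos_pos zero_less_power prod_pos) auto
  let ?F = "\<lambda>s. exp s * pmf (K s x) y - s ^ Suc n / c"
  have real_sum: "(\<Sum>j\<in>UNIV. real (m j)) = real (Suc n)"
    using Suc.prems(2) by (metis of_nat_sum)
  have step: "real (m j) * s ^ n / ((2 * real CARD('d)) ^ n * (\<Prod>j\<in>UNIV. fact (m j))) \<le> exp s * pmf (K s x) (y - nbr j)"
    if s: "0 < s" for s j
  proof (cases "m j = 0")
    case False
    \<comment> \<open>One step in direction \<open>j\<close> less: counts for the neighbour
      \<open>y - nbr j\<close>.\<close>
    define m' where "m' = m(j := m j - 1)"
    have "(\<Sum>i\<in>UNIV. m' i) + 1 = (\<Sum>i\<in>UNIV. m i)"
      using False by (simp add: m'_def sum.remove[of UNIV j])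
    then have 1: "(\<Sum>i\<in>UNIV. m' i) = n" using Suc.prems(2) by simp
    have 2: "(y - nbr j) $ i = x $ i + int (m' (i, True)) - int (m' (i, False))" for i
      using Suc.prems(1)[of i] False by (cases j) (auto simp: m'_def nbr_nth)
    have "(\<Prod>i\<in>UNIV. fact (m i)) = fact (m j) * (\<Prod>i\<in>UNIV-{j}. fact (m i) :: real)"
      by (simp add: prod.remove[of UNIV j])
    also have "\<dots> = real (m j) * (\<Prod>i\<in>UNIV. fact (m' i))"
      using False fact_num_eq_if[of "m j", where 'a=real] by (simp add: m'_def prod.remove[of UNIV j])
    finally have 3: "(\<Prod>i\<in>UNIV. fact (m i)) = real (m j) * (\<Prod>i\<in>UNIV. fact (m' i))" .
    have "s ^ n / ((2 * real CARD('d)) ^ n * (\<Prod>j\<in>UNIV. fact (m' j))) \<le> exp s * pmf (K s x) (y - nbr j)"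
      using s by (intro Suc.IH 1 2) simp
    then show ?thesis unfolding 3 using False by simp
  qed simp
  have "?F 0 \<le> ?F t"
  proof -
    have "0 \<le> t" using Suc.prems by simp
    then show ?thesis
    proof (rule DERIV_nonneg_imp_increasing_open[where f="?F"])
      fix s :: real assume s: "0 < s" "s < t"
      have d: "(?F has_real_derivative exp s * (\<Sum>j\<in>UNIV. pmf (K s x) (y - nbr j)) / (2 * real CARD('d)) - real (Suc n) * s ^ n / c) (at s)"
        by (rule DERIV_diff[OF pmf_kernel_deriv[OF s(1)]], rule DERIV_cdivide, rule DERIV_cong[OF DERIV_pow]) simp
      have "real (Suc n) * s ^ n / c = (\<Sum>j\<in>UNIV. real (m j) * s ^ n / ((2 * real CARD('d)) ^ n * (\<Prod>j\<in>UNIV. fact (m j)))) / (2 * real CARD('d))"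
        unfolding sum_divide_distrib[symmetric] sum_distrib_right[symmetric] real_sum
        by (simp add: c_def mult_ac)
      also have "\<dots> \<le> (\<Sum>j\<in>UNIV. exp s * pmf (K s x) (y - nbr j)) / (2 * real CARD('d))"
        by (intro divide_right_mono sum_mono step s) simp
      finally show "\<exists>y. (?F has_real_derivative y) (at s) \<and> 0 \<le> y"
        using d by (intro exI[of _ "exp s * (\<Sum>j\<in>UNIV. pmf (K s x) (y - nbr j)) / (2 * real CARD('d)) - real (Suc n) * s ^ n / c"])
          (simp add: sum_distrib_left)
    next
      show "continuous_on {0..t} ?F"
      proof (rule continuous_on_diff)
        show "continuous_on {0..t} (\<lambda>s. exp s * pmf (K s x) y)"
          by (rule continuous_on_subset[OF pmf_kernel_continuous]) auto
        show "continuous_on {0..t} (\<lambda>s. s ^ Suc n / c)" using c by (intro continuous_intros) auto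
      qed
    qed
  qed
  moreover have "0 \<le> ?F 0" by simp
  ultimately have "t ^ Suc n / c \<le> exp t * pmf (K t x) y" by linarith
  then show ?case by (simp only: c_def)
qed

text \<open>\<open>\<kappa>\<close> is the mean number of steps in each of the 2d directions. Giving
  every direction the integer part of \<open>\<kappa>\<close>, and adding the displacement to the
  directions that point towards \<open>y\<close>, keeps each count within \<open>R + 1\<close> of
  its mean, so all Poisson factors obey the same bound.\<close>

lemma heat_kernel_lower:
  assumes t: "0 < t" and R: "\<And>i. \<bar>real_of_int (y $ i)\<bar> \<le> R"
  defines "\<kappa> \<equiv> t / (2 * real CARD('d))"
  shows "(exp (- ((R + 1)\<^sup>2 / \<kappa>) - 1) / (\<kappa> + R + 1)) ^ (2 * CARD('d)) \<le> pmf (K t 0) y"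
proof -
  have \<kappa>: "\<kappa> > 0" using t by (simp add: \<kappa>_def)
  have R0: "0 \<le> R" using R[of undefined] by linarith
  define k where "k = nat \<lfloor>\<kappa>\<rfloor>"
  have k: "real k \<le> \<kappa>" "\<kappa> < real k + 1" using \<kappa> unfolding k_def by linarith+
  define m where "m j = k + (if snd j then nat (y $ fst j) else nat (- (y $ fst j)))" for j :: "'d \<times> bool"
  have m: "\<bar>real (m j) - \<kappa>\<bar> \<le> R + 1 \<and> real (m j) \<le> \<kappa> + R" for j
  proof -
    have "real (m j) = real k \<or> real (m j) = real k + \<bar>real_of_int (y $ fst j)\<bar>"
      by (auto simp: m_def)
    then show ?thesis using k R[of "fst j"] R0 by linarith
  qed
  let ?n = "\<Sum>j\<in>UNIV. m j"
  let ?b = "exp (- ((R + 1)\<^sup>2 / \<kappa>) - 1) / (\<kappa> + R + 1)"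
  have trm: "?b \<le> \<kappa> ^ m j * exp (- \<kappa>) / fact (m j)" for j
  proof -
    have "(real (m j) - \<kappa>)\<^sup>2 \<le> (R + 1)\<^sup>2" using m[of j] by (metis abs_le_square_iff abs_of_nonneg R0 add_nonneg_nonneg zero_le_one)
    then have "(real (m j) - \<kappa>)\<^sup>2 / \<kappa> \<le> (R + 1)\<^sup>2 / \<kappa>" using \<kappa> by (intro divide_right_mono) auto
    then have "?b \<le> exp (- ((real (m j) - \<kappa>)\<^sup>2 / \<kappa>) - 1) / (real (m j) + 1)"
      using m[of j] \<kappa> by (intro frac_le) auto
    also have "\<dots> \<le> \<kappa> ^ m j * exp (- \<kappa>) / fact (m j)" by (rule poisson_term_lower[OF \<kappa>])
    finally show ?thesis .
  qed
  have "?b ^ (2 * CARD('d)) = (\<Prod>j\<in>(UNIV :: ('d \<times> bool) set). ?b)"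
    by (simp add: card_cartesian_product UNIV_nbr mult.commute del: UNIV_Times_UNIV)
  also have "\<dots> \<le> (\<Prod>j\<in>UNIV. \<kappa> ^ m j * exp (- \<kappa>) / fact (m j))"
    using trm \<kappa> R0 by (intro prod_mono) (auto intro!: divide_nonneg_nonneg)
  also have "\<dots> = \<kappa> ^ ?n * exp (- \<kappa>) ^ (2 * CARD('d)) / (\<Prod>j\<in>UNIV. fact (m j))"
    by (simp add: prod.distrib prod_dividef power_sum card_cartesian_product UNIV_nbr mult.commute del: UNIV_Times_UNIV)
  also have "exp (- \<kappa>) ^ (2 * CARD('d)) = exp (- t)"
    by (simp only: exp_of_nat_mult[symmetric]) (simp add: \<kappa>_def)
  also have "\<kappa> ^ ?n * exp (- t) / (\<Prod>j\<in>UNIV. fact (m j)) =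
      exp (- t) * (t ^ ?n / ((2 * real CARD('d)) ^ ?n * (\<Prod>j\<in>UNIV. fact (m j))))"
    by (simp add: \<kappa>_def power_divide mult_ac)
  also have "\<dots> \<le> exp (- t) * (exp t * pmf (K t 0) y)"
    using t by (intro mult_left_mono kernel_lower_counts) (auto simp: m_def)
  also have "\<dots> = pmf (K t 0) y" by (simp add: exp_minus)
  finally show ?thesis .
qed

end

section \<open>Discrete Green functions and supersolutions\<close>

primrec srw1 :: "nat \<Rightarrow> int \<Rightarrow> real" where
  "srw1 0 s = of_bool (s = 0)"
| "srw1 (Suc n) s = (srw1 n (s + 1) + srw1 n (s - 1)) / 2"

lemma srw1_nonneg: "0 \<le> srw1 n s"
  by (induction n arbitrary: s) (auto intro!: add_nonneg_nonneg)

text \<open>The lower index counts the steps to the right. The guard excludes negative indices,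
  which \<open>nat\<close> would turn into 0 and thus into the coefficient 1; above \<open>n\<close>
  the coefficient vanishes by itself.\<close>

lemma srw1_binomial:
  "srw1 n s = (if even (s + int n) \<and> 0 \<le> s + int n then real (n choose nat ((s + int n) div 2)) / 2 ^ n else 0)"
proof (induction n arbitrary: s)
  case 0
  show ?case
  proof (cases "even s \<and> 0 < s")
    case True
    then have "0 < nat (s div 2)" by (auto elim!: evenE)
    then show ?thesis using True by (simp add: binomial_eq_0)
  qed (auto elim!: evenE)
next
  case (Suc n)
  show ?case
  proof (cases "even (s + int (Suc n)) \<and> 0 \<le> s + int (Suc n)")
    case False
    then have "\<not> (even (s + 1 + int n) \<and> 0 \<le> s + 1 + int n)" "\<not> (even (s - 1 + int n) \<and> 0 \<le> s - 1 + int n)"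
      by auto
    then have "srw1 n (s + 1) = 0" "srw1 n (s - 1) = 0"
      unfolding Suc.IH by (simp_all only: if_False)
    then show ?thesis unfolding if_not_P[OF False] by simp
  next
    case True
    then obtain m where m: "s + int (Suc n) = 2 * m" by (elim conjE evenE)
    define k where "k = nat m"
    have sk: "s + int (Suc n) = 2 * int k" using m True by (simp add: k_def)
    have 1: "srw1 n (s + 1) = real (n choose k) / 2 ^ n"
    proof -
      have "s + 1 + int n = 2 * int k" using sk by simp
      then show ?thesis unfolding Suc by simp
    qed
    have 2: "srw1 n (s - 1) = (if k = 0 then 0 else real (n choose (k - 1)) / 2 ^ n)"
    proof (cases k)
      case 0
      then have "s - 1 + int n = - 2" using sk by simp
      then show ?thesis unfolding Suc using 0 by simp
    next
      case (Suc k')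
      then have "s - 1 + int n = 2 * int k'" using sk by simp
      then show ?thesis unfolding Suc.IH using Suc by simp
    qed
    have "srw1 (Suc n) s = real (Suc n choose k) / 2 ^ Suc n"
      by (cases k) (auto simp: 1 2 add_divide_distrib)
    then show ?thesis using True sk by simp
  qed
qed

text \<open>The quantity \<open>(c k)\<^sup>2 * (2 * k + 1)\<close> is 1 at k = 0 and nonincreasing,
  because \<open>(2 * k + 1) * (2 * k + 3) \<le> (2 * k + 2)^2\<close>.\<close>

lemma central_binomial_upper: "real ((2 * k) choose k) / 4 ^ k \<le> 1 / sqrt (2 * real k + 1)"
proof -
  define c where "c k = real ((2 * k) choose k) / 4 ^ k" for k
  have rec: "c (Suc k) = c k * (2 * real k + 1) / (2 * real k + 2)" for k
  proof -
    have "Suc k * (Suc (2 * k) choose Suc k) = Suc (2 * k) * ((2 * k) choose k)"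
      by (rule Suc_times_binomial)
    then have "real (Suc k) * real (Suc (2 * k) choose Suc k) = real (Suc (2 * k)) * real ((2 * k) choose k)"
      by (metis of_nat_mult)
    moreover have "(2 * Suc k) choose Suc k = 2 * (Suc (2 * k) choose Suc k)"
    proof -
      have "(2 * Suc k) choose Suc k = (Suc (2 * k) choose k) + (Suc (2 * k) choose Suc k)" by simp
      also have "Suc (2 * k) choose k = Suc (2 * k) choose Suc k"
        using binomial_symmetric[of k "Suc (2 * k)"] by (simp add: Suc_diff_le)
      finally show ?thesis by simp
    qed
    moreover define p q where "p = real ((2 * k) choose k)" and "q = real (Suc (2 * k) choose Suc k)"
    ultimately have pq: "(real k + 1) * q = (2 * real k + 1) * p" "real ((2 * Suc k) choose Suc k) = 2 * q"
      by (simp_all only: of_nat_Suc of_nat_mult of_nat_numeral add.commute)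
    have "c (Suc k) = 2 * q / (4 * 4 ^ k)" unfolding c_def pq by simp
    also have "q = p * (2 * real k + 1) / (real k + 1)" using pq(1) by (simp add: field_simps)
    finally have e: "c (Suc k) = 2 * (p * (2 * real k + 1) / (real k + 1)) / (4 * 4 ^ k)" .
    have ck: "c k = p / 4 ^ k" by (simp add: c_def p_def)
    show ?thesis unfolding e ck by (simp add: divide_simps)
  qed
  have "(c k)\<^sup>2 * (2 * real k + 1) \<le> 1"
  proof (induction k)
    case (Suc k)
    have "(c (Suc k))\<^sup>2 * (2 * real (Suc k) + 1) =
        ((c k)\<^sup>2 * (2 * real k + 1)) * ((2 * real k + 1) * (2 * real k + 3) / (2 * real k + 2)\<^sup>2)"
      unfolding rec by (simp add: power2_eq_square algebra_simps)
    also have "\<dots> \<le> 1 * 1"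
    proof (rule mult_mono[OF Suc.IH])
      show "(2 * real k + 1) * (2 * real k + 3) / (2 * real k + 2)\<^sup>2 \<le> 1"
      proof (subst divide_le_eq_1_pos)
        show "0 < (2 * real k + 2)\<^sup>2" by (intro zero_less_power) simp
      qed (simp add: power2_eq_square algebra_simps)
    qed auto
    finally show ?case by simp
  qed (simp add: c_def)
  then have "(c k)\<^sup>2 \<le> 1 / (2 * real k + 1)" by (simp add: field_simps)
  then have "sqrt ((c k)\<^sup>2) \<le> sqrt (1 / (2 * real k + 1))" by (rule real_sqrt_le_mono)
  then show ?thesis by (simp add: c_def real_sqrt_divide)
qed

text \<open>For odd \<open>n\<close> the middle coefficient is half of the central one in the next
  row, which brings it back to the even case.\<close>

lemma binomial_upper: "real (n choose k) / 2 ^ n \<le> 1 / sqrt (real n + 1)"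
proof (cases "even n")
  case True
  then obtain m where n: "n = 2 * m" by (elim evenE)
  have "real (n choose k) / 2 ^ n \<le> real (n choose (n div 2)) / 2 ^ n"
    by (intro divide_right_mono of_nat_mono binomial_maximum) simp
  then show ?thesis using central_binomial_upper[of m] by (simp add: n power_mult)
next
  case False
  then obtain m where n: "n = 2 * m + 1" by (elim oddE)
  have "real (n choose k) / 2 ^ n \<le> real (n choose (n div 2)) / 2 ^ n"
    by (intro divide_right_mono of_nat_mono binomial_maximum) simp
  also have "n choose (n div 2) = Suc (2 * m) choose m" by (simp add: n)
  also have "real (Suc (2 * m) choose m) / 2 ^ n = real ((2 * Suc m) choose Suc m) / 4 ^ Suc m"
  proof -
    have "(2 * Suc m) choose Suc m = (Suc (2 * m) choose m) + (Suc (2 * m) choose Suc m)" by simp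
    also have "Suc (2 * m) choose Suc m = Suc (2 * m) choose m"
      using binomial_symmetric[of m "Suc (2 * m)"] by (simp add: Suc_diff_le)
    finally have "(2 * Suc m) choose Suc m = 2 * (Suc (2 * m) choose m)" by simp
    moreover have "(4::real) ^ Suc m = 2 * 2 ^ n" by (simp add: n power_mult power_add)
    ultimately show ?thesis by simp
  qed
  also have "\<dots> \<le> 1 / sqrt (2 * real (Suc m) + 1)" by (rule central_binomial_upper)
  also have "\<dots> \<le> 1 / sqrt (real n + 1)" by (intro divide_left_mono) (auto simp: n)
  finally show ?thesis .
qed

lemma srw1_upper: "srw1 n s \<le> 1 / sqrt (real n + 1)"
  using binomial_upper[of n] unfolding srw1_binomial by auto

text \<open>The mean of \<open>c\<close> at a binomial variable with \<open>n\<close> trials of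
  success probability \<open>a\<close>; the recursion splits off one trial.\<close>

primrec bavg :: "real \<Rightarrow> nat \<Rightarrow> (nat \<Rightarrow> real) \<Rightarrow> real" where
  "bavg a 0 c = c 0"
| "bavg a (Suc n) c = (1 - a) * bavg a n c + a * bavg a n (\<lambda>m. c (Suc m))"

lemma bavg_mono:
  assumes "0 \<le> a" "a \<le> 1" "\<And>m. c m \<le> c' m"
  shows "bavg a n c \<le> bavg a n c'"
  using assms(3)
proof (induction n arbitrary: c c')
  case (Suc n)
  show ?case using Suc.IH[of c c'] Suc.IH[of "\<lambda>m. c (Suc m)" "\<lambda>m. c' (Suc m)"] Suc.prems assms(1,2)
    by (auto intro!: add_mono mult_left_mono)
qed simp

lemma bavg_add: "bavg a n (\<lambda>m. c m + c' m) = bavg a n c + bavg a n c'"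
  by (induction n arbitrary: c c') (auto simp: algebra_simps)

lemma bavg_cmult: "bavg a n (\<lambda>m. k * c m) = k * bavg a n c"
  by (induction n arbitrary: c) (auto simp: algebra_simps)

text \<open>In the bound each success raises the denominator by 2, that is by \<open>2 * a\<close>
  per trial on average, while only \<open>a\<close> is claimed; the difference pays for the
  convexity of the reciprocal. The shift \<open>r\<close> records earlier successes and closes the
  induction. The constant 3 is what the case \<open>n = 0\<close> dictates.\<close>

lemma bavg_inverse:
  assumes a: "0 < a" "a \<le> 1"
  shows "bavg a n (\<lambda>m. 1 / (real m + real r + 1)) \<le> 3 / (a * (real n + 1) + 2 * real r + 2)"
proof (induction n arbitrary: r)
  case 0
  show ?case using a by (simp add: field_simps)
next
  case (Suc n)
  define X where "X = a * (real n + 1) + 2 * real r + 2"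
  have X: "X \<ge> 2" using a by (simp add: X_def)
  have "bavg a (Suc n) (\<lambda>m. 1 / (real m + real r + 1)) =
     (1 - a) * bavg a n (\<lambda>m. 1 / (real m + real r + 1)) + a * bavg a n (\<lambda>m. 1 / (real m + real (Suc r) + 1))"
    by (simp add: add_ac)
  also have "\<dots> \<le> (1 - a) * (3 / X) + a * (3 / (X + 2))"
    using Suc[of r] Suc[of "Suc r"] a by (intro add_mono mult_left_mono) (auto simp: X_def algebra_simps)
  also have "\<dots> \<le> 3 / (X + a)"
  proof -
    have "3 / (X + a) - ((1 - a) * (3 / X) + a * (3 / (X + 2))) = 3 * a * (X - 2 * (1 - a)) / (X * (X + 2) * (X + a))"
      using X a by (simp add: divide_simps) (simp add: algebra_simps)
    moreover have "\<dots> \<ge> 0" using X a by (intro divide_nonneg_nonneg mult_nonneg_nonneg) auto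
    ultimately show ?thesis by linarith
  qed
  finally show ?case by (simp add: X_def algebra_simps)
qed

primrec heat :: "nat \<Rightarrow> int ^ 'd::finite \<Rightarrow> real" where
  "heat 0 x = of_bool (x = 0)"
| "heat (Suc n) x = walk_avg (heat n) x"

lemma heat_nonneg: "0 \<le> heat n x"
  by (induction n arbitrary: x) (auto simp: walk_avg_def intro!: divide_nonneg_nonneg sum_nonneg)

lemma walk_avg_mono: "(\<And>j. f (x + nbr j) \<le> g (x + nbr j)) \<Longrightarrow> walk_avg f x \<le> walk_avg g x"
  unfolding walk_avg_def by (intro divide_right_mono sum_mono) auto

lemma heat_support: "heat n x \<noteq> 0 \<Longrightarrow> \<bar>x $ i\<bar> \<le> int n"
proof (induction n arbitrary: x)
  case (Suc n)
  then obtain j where "heat n (x + nbr j) \<noteq> 0"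
    by (auto simp: walk_avg_def elim!: sum.not_neutral_contains_not_neutral)
  then have "\<bar>(x + nbr j) $ i\<bar> \<le> int n" by (rule Suc.IH)
  then show ?case by (auto simp: nbr_nth split: if_splits)
qed (auto split: if_splits)

lemma heat_sum_le:
  fixes x :: "int ^ 'd::finite"
  assumes B: "finite B"
  shows "(\<Sum>y\<in>B. heat n (x - y)) \<le> 1"
proof (induction n arbitrary: x)
  case 0
  have "(\<Sum>y\<in>B. heat 0 (x - y)) = (\<Sum>y\<in>B. if y = x then 1 else 0)" by (intro sum.cong) auto
  also have "\<dots> \<le> 1" using B by (simp add: sum.delta)
  finally show ?case .
next
  case (Suc n)
  have "(\<Sum>y\<in>B. heat (Suc n) (x - y)) = walk_avg (\<lambda>x. \<Sum>y\<in>B. heat n (x - y)) x"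
    unfolding heat.simps walk_avg_def by (subst sum.swap) (simp add: sum_divide_distrib[symmetric] algebra_simps)
  also have "\<dots> \<le> walk_avg (\<lambda>_. 1) x" by (intro walk_avg_mono Suc)
  also have "\<dots> \<le> 1" using walk_avg_bound[of "\<lambda>_. 1" 1 x] by linarith
  finally show ?case .
qed

lemma heat_upper_1:
  fixes x :: "int ^ 'd::finite"
  assumes "CARD('d) = 1"
  shows "heat n x \<le> 1 / sqrt (real n + 1)"
proof -
  obtain i where U: "(UNIV :: 'd set) = {i}" using assms by (auto simp: card_1_singleton_iff)
  have "heat n x \<le> srw1 n (x $ i)" for n and x :: "int ^ 'd"
  proof (induction n arbitrary: x)
    case (Suc n)
    have "heat (Suc n) x \<le> walk_avg (\<lambda>x. srw1 n (x $ i)) x"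
      unfolding heat.simps by (intro walk_avg_mono Suc)
    then show ?case by (simp add: walk_avg_def sum_nbr U nbr_nth)
  qed auto
  then show ?thesis using srw1_upper[of n "x $ i"] by (meson order_trans)
qed

text \<open>Only two coordinates \<open>i\<close> and \<open>j\<close> are followed. The number of
  steps in them is binomial with success probability \<open>2 / d\<close>, and after
  \<open>m\<close> such steps their sum and difference are independent one-dimensional walks, each
  at a given value with probability at most \<open>1 / sqrt (m + 1)\<close>. It remains to average
  \<open>1 / (m + 1)\<close>.\<close>

lemma heat_upper_2:
  fixes x :: "int ^ 'd::finite"
  assumes d: "CARD('d) \<ge> 2"
  shows "heat n x \<le> 3 * real CARD('d) / (real n + 1)"
proof -
  obtain i j :: 'd where ij: "i \<noteq> j"
    using d card_le_Suc0_iff_eq[of "UNIV :: 'd set"] by (auto simp: numeral_2_eq_2 not_le Suc_le_eq)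
  define a where "a = 2 / real CARD('d)"
  have a: "0 < a" "a \<le> 1" using d by (auto simp: a_def)
  define c where "c x m = srw1 m (x $ i + x $ j) * srw1 m (x $ i - x $ j)" for x :: "int ^ 'd" and m
  have "heat n x \<le> bavg a n (c x)" for n x
  proof (induction n arbitrary: x)
    case 0
    show ?case by (auto simp: c_def)
  next
    case (Suc n)
    define \<Phi> where "\<Phi> x = bavg a n (c x)" for x
    let ?p = "\<lambda>k. \<Phi> (x + nbr (k, True)) + \<Phi> (x + nbr (k, False))"
    have "heat (Suc n) x \<le> walk_avg \<Phi> x"
      unfolding heat.simps \<Phi>_def by (intro walk_avg_mono Suc)
    also have "\<dots> = (\<Sum>k\<in>UNIV. ?p k) / (2 * real CARD('d))"
      unfolding walk_avg_def sum_nbr ..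
    also have "(\<Sum>k\<in>UNIV. ?p k) = ?p i + ?p j + (\<Sum>k\<in>UNIV - {i} - {j}. ?p k)"
      using ij by (simp add: sum.remove[of UNIV i] sum.remove[of "UNIV - {i}" j])
    also have "(\<Sum>k\<in>UNIV - {i} - {j}. ?p k) = (\<Sum>k\<in>UNIV - {i} - {j}. 2 * \<Phi> x)"
    proof (intro sum.cong refl)
      fix k assume "k \<in> UNIV - {i} - {j}"
      then have "c (x + nbr (k, b)) = c x" for b by (auto simp: c_def nbr_nth fun_eq_iff)
      then show "?p k = 2 * \<Phi> x" by (simp add: \<Phi>_def)
    qed
    also have "\<dots> = (2 * real CARD('d) - 4) * \<Phi> x"
      using d ij by (simp add: card_Diff_singleton_if of_nat_diff algebra_simps)
    also have "?p i + ?p j = 4 * bavg a n (\<lambda>m. c x (Suc m))"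
    proof -
      have "?p i + ?p j = bavg a n (\<lambda>m. (c (x + nbr (i, True)) m + c (x + nbr (i, False)) m) +
          (c (x + nbr (j, True)) m + c (x + nbr (j, False)) m))"
        unfolding \<Phi>_def bavg_add ..
      \<comment> \<open>The four moves realise all four sign combinations of the sum and the
        difference, so their total factorises.\<close>
      also have "(\<lambda>m. (c (x + nbr (i, True)) m + c (x + nbr (i, False)) m) +
          (c (x + nbr (j, True)) m + c (x + nbr (j, False)) m)) = (\<lambda>m. 4 * c x (Suc m))"
        using ij by (auto simp: fun_eq_iff c_def nbr_nth algebra_simps)
      finally show ?thesis by (simp only: bavg_cmult)
    qed
    also have "(4 * bavg a n (\<lambda>m. c x (Suc m)) + (2 * real CARD('d) - 4) * \<Phi> x) / (2 * real CARD('d)) =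
        bavg a (Suc n) (c x)"
      using d by (simp add: \<Phi>_def a_def field_simps)
    finally show ?case .
  qed
  also have "bavg a n (c x) \<le> bavg a n (\<lambda>m. 1 / (real m + real 0 + 1))"
  proof (rule bavg_mono)
    fix m
    have "c x m \<le> (1 / sqrt (real m + 1)) * (1 / sqrt (real m + 1))"
      unfolding c_def by (intro mult_mono srw1_upper srw1_nonneg) auto
    then show "c x m \<le> 1 / (real m + real 0 + 1)" by simp
  qed (use a in auto)
  also have "\<dots> \<le> 3 / (a * (real n + 1) + 2 * real 0 + 2)" by (rule bavg_inverse[OF a])
  also have "\<dots> \<le> 3 / (a * (real n + 1))" using mult_pos_pos[of a "real n + 1"] a by (intro frac_le) simp_all
  also have "\<dots> \<le> 3 * real CARD('d) / (real n + 1)" by (simp add: a_def divide_simps)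
  finally show ?thesis .
qed

definition green :: "nat \<Rightarrow> int ^ 'd::finite \<Rightarrow> real" where
  "green n x = (\<Sum>m<n. heat m x)"

lemma green_nonneg: "0 \<le> green n x"
  unfolding green_def by (intro sum_nonneg heat_nonneg)

lemma green_support: "green n x \<noteq> 0 \<Longrightarrow> \<bar>x $ i\<bar> \<le> int n"
  unfolding green_def using heat_support[of _ x i]
  by (fastforce elim!: sum.not_neutral_contains_not_neutral)

lemma green_sum_le:
  assumes "finite B"
  shows "(\<Sum>y\<in>B. green n (x - y)) \<le> real n"
proof -
  have "(\<Sum>y\<in>B. green n (x - y)) = (\<Sum>m<n. \<Sum>y\<in>B. heat m (x - y))"
    unfolding green_def by (rule sum.swap)
  also have "\<dots> \<le> (\<Sum>m<n. 1)" by (intro sum_mono heat_sum_le assms)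
  finally show ?thesis by simp
qed

lemma walk_avg_sum: "walk_avg (\<lambda>x. \<Sum>y\<in>B. f y x) x = (\<Sum>y\<in>B. walk_avg (f y) x)"
  unfolding walk_avg_def by (subst sum.swap) (simp add: sum_divide_distrib)

lemma walk_avg_green: "walk_avg (green n) x = green n x + heat n x - of_bool (x = 0)"
proof -
  have "walk_avg (green n) x = (\<Sum>m<n. heat (Suc m) x)"
    unfolding green_def[abs_def] walk_avg_sum by simp
  moreover have "(\<Sum>m<n. heat (Suc m) x - heat m x) = heat n x - heat 0 x"
    by (rule sum_lessThan_telescope)
  ultimately show ?thesis by (simp add: green_def sum_subtractf)
qed

lemma walk_avg_shift: "walk_avg (\<lambda>x. f (x - y)) x = walk_avg f (x - y)"
  unfolding walk_avg_def by (simp add: algebra_simps)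

lemma walk_avg_cmult: "walk_avg (\<lambda>x. c * f x) x = c * walk_avg f x"
  unfolding walk_avg_def by (simp add: sum_distrib_left)

lemma walk_avg_add: "walk_avg (\<lambda>x. f x + g x) x = walk_avg f x + walk_avg g x"
  unfolding walk_avg_def by (simp add: sum.distrib add_divide_distrib)

lemma walk_avg_const: "walk_avg (\<lambda>_. c) (x :: int ^ 'd::finite) = c"
  unfolding walk_avg_def by (simp add: card_cartesian_product UNIV_nbr del: UNIV_Times_UNIV)

text \<open>The potential \<open>\<theta> \<zeta>\<close> is so small at scale \<open>n\<close> that a first-order corrector,
  inflated by the factor \<open>1 + a\<close>, absorbs the quadratic error.\<close>

lemma corrector_supersolution:
  fixes \<zeta> :: "int ^ 'd::finite \<Rightarrow> real" and B :: "(int ^ 'd) set"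
  assumes B: "finite B" and \<zeta>: "\<And>y. 0 \<le> \<zeta> y" and \<theta>: "0 < \<theta>" and a: "0 < a" and b: "0 \<le> b"
    and G: "\<And>x. (1 + a) * \<theta> * (\<Sum>y\<in>B. green n (x - y) * \<zeta> y) \<le> a"
    and H: "\<And>x. (\<Sum>y\<in>B. heat n (x - y) * \<zeta> y) \<le> b"
  defines "\<phi> \<equiv> \<lambda>x. 1 + (1 + a) * \<theta> * (\<Sum>y\<in>B. green n (x - y) * \<zeta> y)"
  shows "1 \<le> \<phi> x" "\<phi> x \<le> 1 + a"
    "walk_gen \<phi> x + \<theta> * (of_bool (x \<in> B) * \<zeta> x) * \<phi> x \<le> (1 + a) * \<theta> * b * \<phi> x"
proof -
  have g0: "0 \<le> (1 + a) * \<theta> * (\<Sum>y\<in>B. green n (x - y) * \<zeta> y)" for x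
    using \<theta> a \<zeta> by (intro mult_nonneg_nonneg sum_nonneg green_nonneg) auto
  show \<phi>1: "1 \<le> \<phi> x" using g0[of x] by (simp add: \<phi>_def)
  show \<phi>a: "\<phi> x \<le> 1 + a" using G[of x] by (simp add: \<phi>_def)
  have "walk_avg (\<lambda>x. \<Sum>y\<in>B. green n (x - y) * \<zeta> y) x = (\<Sum>y\<in>B. \<zeta> y * walk_avg (green n) (x - y))"
    unfolding walk_avg_sum
    by (intro sum.cong refl) (simp add: mult.commute walk_avg_cmult walk_avg_shift[of "green n"])
  also have "\<dots> = (\<Sum>y\<in>B. green n (x - y) * \<zeta> y + heat n (x - y) * \<zeta> y - of_bool (x = y) * \<zeta> y)"
    unfolding walk_avg_green by (intro sum.cong refl) (auto simp: algebra_simps)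
  also have "\<dots> = (\<Sum>y\<in>B. green n (x - y) * \<zeta> y) + (\<Sum>y\<in>B. heat n (x - y) * \<zeta> y) - of_bool (x \<in> B) * \<zeta> x"
  proof -
    have "(\<Sum>y\<in>B. of_bool (x = y) * \<zeta> y) = (\<Sum>y\<in>B. if y = x then \<zeta> y else 0)" by (intro sum.cong) auto
    also have "\<dots> = of_bool (x \<in> B) * \<zeta> x" using B by (simp add: sum.delta)
    finally show ?thesis by (simp add: sum.distrib sum_subtractf)
  qed
  finally have e: "walk_avg (\<lambda>x. \<Sum>y\<in>B. green n (x - y) * \<zeta> y) x =
    (\<Sum>y\<in>B. green n (x - y) * \<zeta> y) + (\<Sum>y\<in>B. heat n (x - y) * \<zeta> y) - of_bool (x \<in> B) * \<zeta> x" .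
  have "walk_gen \<phi> x = (1 + a) * \<theta> * ((\<Sum>y\<in>B. heat n (x - y) * \<zeta> y) - of_bool (x \<in> B) * \<zeta> x)"
    unfolding walk_gen_avg \<phi>_def walk_avg_add walk_avg_const walk_avg_cmult e by (simp add: algebra_simps)
  also have "\<dots> \<le> (1 + a) * \<theta> * (b - of_bool (x \<in> B) * \<zeta> x)"
    using H[of x] a \<theta> by (intro mult_left_mono) auto
  finally have 1: "walk_gen \<phi> x \<le> (1 + a) * \<theta> * b - \<theta> * (of_bool (x \<in> B) * \<zeta> x) * (1 + a)"
    by (simp add: algebra_simps)
  have "\<theta> * (of_bool (x \<in> B) * \<zeta> x) * \<phi> x \<le> \<theta> * (of_bool (x \<in> B) * \<zeta> x) * (1 + a)"
    using \<phi>a \<theta> \<zeta> by (intro mult_left_mono) auto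
  moreover have "(1 + a) * \<theta> * b * 1 \<le> (1 + a) * \<theta> * b * \<phi> x"
    using \<phi>1 a \<theta> b by (intro mult_left_mono) auto
  ultimately show "walk_gen \<phi> x + \<theta> * (of_bool (x \<in> B) * \<zeta> x) * \<phi> x \<le> (1 + a) * \<theta> * b * \<phi> x"
    using 1 by linarith
qed

section \<open>Tail bounds for a fixed scenery\<close>

definition cube :: "nat \<Rightarrow> (int ^ 'd::finite) set" where
  "cube R = {x. \<forall>i. \<bar>x $ i\<bar> \<le> int R}"

lemma cube_bij: "bij_betw (\<lambda>f. \<chi> i. f i) (Pi\<^sub>E UNIV (\<lambda>_. {- int R..int R})) (cube R)"
proof (rule bij_betw_byWitness[where f'="\<lambda>x i. x $ i"])
  show "\<forall>a\<in>Pi\<^sub>E UNIV (\<lambda>_. {- int R..int R}). (\<lambda>i. (\<chi> i. a i) $ i) = a" by simp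
  show "\<forall>a'\<in>cube R. (\<chi> i. a' $ i) = a'" by (simp add: vec_eq_iff)
  show "(\<lambda>f. \<chi> i. f i) ` Pi\<^sub>E UNIV (\<lambda>_. {- int R..int R}) \<subseteq> cube R"
    by (auto simp: cube_def PiE_iff abs_le_iff minus_le_iff)
  show "(\<lambda>x i. x $ i) ` cube R \<subseteq> Pi\<^sub>E UNIV (\<lambda>_. {- int R..int R})"
    by (auto simp: cube_def PiE_iff abs_le_iff minus_le_iff)
qed

lemma finite_cube: "finite (cube R :: (int ^ 'd::finite) set)"
  by (rule bij_betw_finite[OF cube_bij, THEN iffD1]) (intro finite_PiE, auto)

lemma card_cube: "card (cube R :: (int ^ 'd::finite) set) = (2 * R + 1) ^ CARD('d)"
proof -
  have "card (cube R :: (int ^ 'd) set) = card (Pi\<^sub>E (UNIV :: 'd set) (\<lambda>_. {- int R..int R}))"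
    by (rule bij_betw_same_card[OF cube_bij, symmetric])
  also have "\<dots> = (2 * R + 1) ^ CARD('d)"
    by (subst card_PiE) (auto simp: nat_add_distrib nat_mult_distrib)
  finally show ?thesis .
qed

lemma cosh_le: "0 \<le> k \<Longrightarrow> k \<le> 1 \<Longrightarrow> cosh (k :: real) \<le> 1 + k\<^sup>2"
proof -
  assume k: "0 \<le> k" "k \<le> 1"
  have "exp (- k) \<le> 1 / (1 + k)"
    using exp_ge_add_one_self[of k] k by (simp add: exp_minus inverse_eq_divide frac_le)
  also have "\<dots> \<le> 1 - k + k\<^sup>2"
  proof -
    have "(1 - k + k\<^sup>2) * (1 + k) = 1 + k ^ 3" by (simp add: power2_eq_square power3_eq_cube algebra_simps)
    moreover have "0 \<le> k ^ 3" using k by simp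
    ultimately show ?thesis using k by (simp add: pos_divide_le_eq)
  qed
  finally show "cosh k \<le> 1 + k\<^sup>2" using exp_bound[OF k] by (simp add: cosh_field_def)
qed

text \<open>The 2d signed coordinates: a point lies outside the cube of radius \<open>R\<close>
  exactly when one of them exceeds \<open>R\<close>.\<close>

definition coord :: "'d \<times> bool \<Rightarrow> int ^ 'd::finite \<Rightarrow> real" where
  "coord j x = (if snd j then 1 else -1) * real_of_int (x $ fst j)"

lemma walk_avg_exp_coord:
  assumes k: "0 \<le> k" "k \<le> 1"
  shows "walk_avg (\<lambda>x. exp (k * coord j x)) x \<le> (1 + k\<^sup>2) * exp (k * coord j (x :: int ^ 'd::finite))"
proof -
  have "exp (k * coord j (x + nbr (i, True))) + exp (k * coord j (x + nbr (i, False)))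
      \<le> 2 * ((1 + k\<^sup>2) * exp (k * coord j x))" for i
  proof (cases "i = fst j")
    case False
    then have "coord j (x + nbr (i, b)) = coord j x" for b by (simp add: coord_def nbr_nth)
    moreover have "1 * exp (k * coord j x) \<le> (1 + k\<^sup>2) * exp (k * coord j x)"
      by (intro mult_right_mono) auto
    ultimately show ?thesis by simp
  next
    case True
    have "exp (k * coord j (x + nbr (i, True))) + exp (k * coord j (x + nbr (i, False))) =
        2 * (cosh k * exp (k * coord j x))"
      using True by (auto simp: coord_def nbr_nth cosh_field_def algebra_simps exp_add[symmetric])
    also have "\<dots> \<le> 2 * ((1 + k\<^sup>2) * exp (k * coord j x))"
      using cosh_le[OF k] by (intro mult_left_mono mult_right_mono) auto
    finally show ?thesis .
  qed
  then have "(\<Sum>l\<in>UNIV. exp (k * coord j (x + nbr l))) \<le> (\<Sum>i\<in>(UNIV::'d set). 2 * ((1 + k\<^sup>2) * exp (k * coord j x)))"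
    unfolding sum_nbr by (intro sum_mono)
  then show ?thesis unfolding walk_avg_def by (simp add: divide_le_eq algebra_simps)
qed

text \<open>The generator is given on bounded functions, so the exponential test functions have to
  be cut off; a minimum with a constant preserves the inequality.\<close>

lemma walk_avg_min:
  assumes "walk_avg f x \<le> q * f x" "1 \<le> q" "0 \<le> b"
  shows "walk_avg (\<lambda>x. min (f x) b) x \<le> q * min (f x) (b::real)"
proof -
  have "walk_avg (\<lambda>x. min (f x) b) x \<le> q * f x"
    using walk_avg_mono[of "\<lambda>x. min (f x) b" x f] assms(1) by simp
  moreover have "walk_avg (\<lambda>x. min (f x) b) x \<le> q * b"
  proof -
    have "walk_avg (\<lambda>x. min (f x) b) x \<le> walk_avg (\<lambda>_. b) x" by (rule walk_avg_mono) simp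
    also have "\<dots> = 1 * b" by (simp add: walk_avg_const)
    also have "\<dots> \<le> q * b" using assms by (intro mult_right_mono)
    finally show ?thesis .
  qed
  ultimately show ?thesis by (simp add: min_def)
qed

lemma walk_gen_of_int_fun:
  fixes g :: "int \<Rightarrow> real" and x y :: "int ^ 'd::finite"
  assumes "CARD('d) = 1"
  shows "walk_gen (\<lambda>y. g (y $ i - x $ i)) y = (g (y $ i - x $ i + 1) + g (y $ i - x $ i - 1)) / 2 - g (y $ i - x $ i)"
proof -
  obtain j where j: "(UNIV :: 'd set) = {j}" using assms card_1_singletonE by blast
  moreover have "i \<in> (UNIV :: 'd set)" by simp
  then have "i = j" unfolding j by simp
  ultimately have U: "(UNIV :: 'd set) = {i}" by simp
  show ?thesis unfolding walk_gen_avg by (simp add: walk_avg_def sum_nbr U nbr_nth algebra_simps)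
qed

context walk
begin

lemma stay_prob:
  assumes k: "0 < k" "k \<le> 1" and t: "0 < t"
  shows "{\<eta> \<in> space N. \<forall>u\<in>{0..t}. S u \<eta> \<in> cube R} \<in> sets N"
    and "prob {\<eta> \<in> space N. \<forall>u\<in>{0..t}. S u \<eta> \<in> cube R} \<ge>
      1 - (2 * real CARD('d) + 1) * exp (k\<^sup>2 * t - k * real R)"
proof -
  let ?b = "exp (k * real R)"
  define f where "f j x = min (exp (k * coord j x)) ?b" for j :: "'d \<times> bool" and x
  \<comment> \<open>Normalised to be at least 1 off the cube. The cut-off level in \<open>f\<close>
    is the value at radius \<open>R\<close>; the additional 1 keeps \<open>\<phi>\<close> above a
    positive constant.\<close>
  define \<phi> where "\<phi> x = exp (- (k * real R)) * (1 + (\<Sum>j\<in>UNIV. f j x))" for x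
  have f: "0 \<le> f j x" "f j x \<le> ?b" for j x by (auto simp: f_def)
  have s0: "0 \<le> (\<Sum>j\<in>UNIV. f j x)" for x by (intro sum_nonneg f)
  have sb: "(\<Sum>j\<in>UNIV. f j x) \<le> 2 * real CARD('d) * ?b" for x
    using sum_bounded_above[of UNIV "\<lambda>j. f j x" ?b] f(2)
    by (simp add: card_cartesian_product UNIV_nbr del: UNIV_Times_UNIV)
  have L: "walk_gen \<phi> x \<le> k\<^sup>2 * \<phi> x" for x
  proof -
    have "walk_avg (f j) x \<le> (1 + k\<^sup>2) * f j x" for j
      unfolding f_def using k by (intro walk_avg_min walk_avg_exp_coord) auto
    then have "(\<Sum>j\<in>UNIV. walk_avg (f j) x) \<le> (1 + k\<^sup>2) * (\<Sum>j\<in>UNIV. f j x)"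
      unfolding sum_distrib_left by (intro sum_mono)
    then have "walk_avg \<phi> x \<le> exp (- (k * real R)) * (1 + (1 + k\<^sup>2) * (\<Sum>j\<in>UNIV. f j x))"
      unfolding \<phi>_def walk_avg_cmult walk_avg_add walk_avg_const walk_avg_sum by simp
    also have "\<dots> \<le> (1 + k\<^sup>2) * \<phi> x"
      unfolding \<phi>_def by (simp add: algebra_simps)
    finally show ?thesis unfolding walk_gen_avg by (simp add: algebra_simps)
  qed
  have off: "1 \<le> \<phi> x" if out: "x \<notin> cube R" for x
  proof -
    obtain i where "\<not> \<bar>x $ i\<bar> \<le> int R" using out by (auto simp: cube_def)
    then obtain j where "real R \<le> coord j x"
    proof (cases "x $ i \<ge> 0")
      case True
      then show thesis using that[of "(i, True)"] \<open>\<not> \<bar>x $ i\<bar> \<le> int R\<close> by (simp add: coord_def)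
    next
      case False
      then show thesis using that[of "(i, False)"] \<open>\<not> \<bar>x $ i\<bar> \<le> int R\<close> by (simp add: coord_def)
    qed
    then have "f j x = ?b" using k by (simp add: f_def)
    moreover have "f j x \<le> (\<Sum>j\<in>UNIV. f j x)" by (intro member_le_sum f) auto
    ultimately have "?b \<le> 1 + (\<Sum>j\<in>UNIV. f j x)" by linarith
    then have "exp (- (k * real R)) * ?b \<le> \<phi> x" unfolding \<phi>_def by (intro mult_left_mono) auto
    then show ?thesis by (simp add: exp_minus)
  qed
  have lo: "exp (- (k * real R)) \<le> \<phi> x" for x
    using s0[of x] unfolding \<phi>_def by (simp add: algebra_simps)
  have hi: "\<phi> x \<le> exp (- (k * real R)) * (1 + 2 * real CARD('d) * ?b)" for x
    unfolding \<phi>_def using sb[of x] by (intro mult_left_mono) auto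
  show "{\<eta> \<in> space N. \<forall>u\<in>{0..t}. S u \<eta> \<in> cube R} \<in> sets N"
    by (rule exit_prob(1)[OF lo hi off _ L _ t]) auto
  have "prob {\<eta> \<in> space N. \<forall>u\<in>{0..t}. S u \<eta> \<in> cube R} \<ge> 1 - \<phi> 0 * exp (k\<^sup>2 * t)"
    by (rule exit_prob(2)[OF lo hi off _ L _ t]) auto
  moreover have "\<phi> 0 \<le> exp (- (k * real R)) * (2 * real CARD('d) + 1)"
  proof -
    have "(\<Sum>j\<in>UNIV. f j 0) \<le> 2 * real CARD('d) * 1"
      using sum_bounded_above[of UNIV "\<lambda>j. f j 0" 1]
      by (simp add: f_def coord_def card_cartesian_product UNIV_nbr del: UNIV_Times_UNIV)
    then show ?thesis unfolding \<phi>_def by (intro mult_left_mono) auto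
  qed
  then have "\<phi> 0 * exp (k\<^sup>2 * t) \<le> exp (- (k * real R)) * (2 * real CARD('d) + 1) * exp (k\<^sup>2 * t)"
    by (intro mult_right_mono) auto
  moreover have "exp (- (k * real R)) * (2 * real CARD('d) + 1) * exp (k\<^sup>2 * t) =
      (2 * real CARD('d) + 1) * exp (k\<^sup>2 * t - k * real R)"
    by (simp add: exp_diff exp_minus field_simps)
  ultimately show "prob {\<eta> \<in> space N. \<forall>u\<in>{0..t}. S u \<eta> \<in> cube R} \<ge>
      1 - (2 * real CARD('d) + 1) * exp (k\<^sup>2 * t - k * real R)" by linarith
qed

text \<open>Exponential Chebyshev for the scenery cut off outside the cube, for which the corrector
  gives the growth rate \<open>(1 + a) * \<theta> * b\<close>. On paths that stay in the cube the
  cut-off changes nothing; the others are charged to \<open>stay_prob\<close>.\<close>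

lemma upper_tail:
  assumes t: "0 < t" and \<zeta>: "\<And>y. 0 \<le> \<zeta> y" and k: "0 < k" "k \<le> 1" and \<theta>: "0 < \<theta>" and a: "0 < a" and b: "0 \<le> b"
    and G: "\<And>x. (1 + a) * \<theta> * (\<Sum>y\<in>cube R. green n (x - y) * \<zeta> y) \<le> a"
    and H: "\<And>x. (\<Sum>y\<in>cube R. heat n (x - y) * \<zeta> y) \<le> b"
  shows "prob {\<eta> \<in> space N. scenery_integral \<zeta> (\<lambda>u. S u \<eta>) t \<ge> c * t}
    \<le> (2 * real CARD('d) + 1) * exp (k\<^sup>2 * t - k * real R) + (1 + a) * exp (- (\<theta> * t * (c - (1 + a) * b)))"
proof -
  define V where "V x = \<theta> * (of_bool (x \<in> cube R) * \<zeta> x)" for x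
  have V0: "0 \<le> V x" for x using \<theta> \<zeta> by (simp add: V_def)
  have VB: "V x \<le> \<theta> * (\<Sum>y\<in>cube R. \<zeta> y)" for x
    unfolding V_def using \<theta> \<zeta> member_le_sum[of x "cube R" \<zeta>] finite_cube
    by (intro mult_left_mono) (auto intro!: sum_nonneg)
  note corr = corrector_supersolution[OF finite_cube \<zeta> \<theta> a b G H]
  define I where "I \<eta> = (LINT u:{0..t}|lborel. V (S u \<eta>))" for \<eta>
  \<comment> \<open>The indicator matches the form of the Feynman-Kac bounds; the paths that do not
    start at 0 form a null set, removed through \<open>?Z\<close>.\<close>
  define W where "W \<eta> = of_bool (S 0 \<eta> = 0) * exp (I \<eta>)" for \<eta>
  have IW: "integrable N W" and Im: "I \<in> borel_measurable N"
    using fk_limit(2)[OF V0 VB order_refl t, of 0] fk_limit(3)[OF V0 VB order_refl t] unfolding W_def I_def by simp_all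
  have "(LINT \<eta>|N. of_bool (S 0 \<eta> = 0) * exp (LINT u:{0..0+t}|lborel. V (S u \<eta>)))
      \<le> pmf (K 0 0) 0 * ((1 + a) * exp ((1 + a) * \<theta> * b * t))"
    by (rule fk_upper[OF V0 VB order_refl t,
          where \<phi>="\<lambda>x. 1 + (1 + a) * \<theta> * (\<Sum>y\<in>cube R. green n (x - y) * \<zeta> y)"])
      (use corr in \<open>simp_all only: V_def\<close>)
  then have EW: "integral\<^sup>L N W \<le> (1 + a) * exp ((1 + a) * \<theta> * b * t)"
    unfolding W_def I_def by (simp add: K_0)
  let ?A = "{\<eta> \<in> space N. \<forall>u\<in>{0..t}. S u \<eta> \<in> cube R}"
  let ?E = "{\<eta> \<in> space N. scenery_integral \<zeta> (\<lambda>u. S u \<eta>) t \<ge> c * t}"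
  let ?F = "{\<eta> \<in> space N. exp (\<theta> * (c * t)) \<le> W \<eta>}"
  let ?Z = "{\<eta> \<in> space N. S 0 \<eta> = 0}"
  have A: "?A \<in> sets N" by (rule stay_prob(1)[OF k t])
  have Z: "?Z \<in> sets N" by (rule S_pred_sets) simp
  have F: "?F \<in> sets N" using IW by measurable
  have sub: "?E \<subseteq> (space N - ?A) \<union> (space N - ?Z) \<union> ?F"
  proof
    fix \<eta> assume E: "\<eta> \<in> ?E"
    show "\<eta> \<in> (space N - ?A) \<union> (space N - ?Z) \<union> ?F"
    proof (cases "\<eta> \<in> ?A \<and> \<eta> \<in> ?Z")
      case True
      have "I \<eta> = (LINT u:{0..t}|lborel. \<theta> * \<zeta> (S u \<eta>))"
        unfolding I_def by (rule set_lebesgue_integral_cong) (use True in \<open>auto simp: V_def\<close>)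
      also have "\<dots> = \<theta> * scenery_integral \<zeta> (\<lambda>u. S u \<eta>) t"
        unfolding scenery_integral_def by (rule set_integral_mult_right)
      finally have "\<theta> * (c * t) \<le> I \<eta>" using E \<theta> by (simp add: mult_left_mono)
      then show ?thesis using True by (simp add: W_def)
    qed (use E in auto)
  qed
  have "prob ?E \<le> prob ((space N - ?A) \<union> (space N - ?Z) \<union> ?F)"
    using A Z F by (intro finite_measure_mono[OF sub]) auto
  also have "\<dots> \<le> prob (space N - ?A) + prob (space N - ?Z) + prob ?F"
    using A Z F by (intro order_trans[OF measure_Un_le] add_mono measure_Un_le) auto
  also have "prob (space N - ?Z) = 0"
    using prob_compl[OF Z] prob_S[of 0 0] by (simp add: K_0)
  also have "prob (space N - ?A) \<le> (2 * real CARD('d) + 1) * exp (k\<^sup>2 * t - k * real R)"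
    using prob_compl[OF A] stay_prob(2)[OF k t, of R] by simp
  also have "prob ?F \<le> integral\<^sup>L N W / exp (\<theta> * (c * t))"
    by (rule integral_Markov_inequality_measure[where A="{}", OF IW]) (auto simp: W_def)
  also have "\<dots> \<le> (1 + a) * exp ((1 + a) * \<theta> * b * t) / exp (\<theta> * (c * t))"
    using EW by (intro divide_right_mono) auto
  also have "\<dots> = (1 + a) * exp (- (\<theta> * t * (c - (1 + a) * b)))"
  proof -
    have "- (\<theta> * t * (c - (1 + a) * b)) = (1 + a) * \<theta> * b * t - \<theta> * (c * t)"
      by (simp add: algebra_simps)
    then show ?thesis by (simp only: exp_diff times_divide_eq_right)
  qed
  finally show ?thesis by simp
qed

text \<open>The first \<open>a\<close> units of time are for the journey to \<open>x\<close>, the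
  remaining \<open>T\<close> for the stay. As the scenery is nonnegative, what is collected on the
  way can only help.\<close>

lemma lower_tail:
  assumes "0 \<le> a" "0 < T" and \<zeta>: "\<And>y. 0 \<le> \<zeta> y" and s: "c * (a + T) \<le> \<zeta> x * ((\<mu> * T - ln 2) / \<theta>)"
    and loc: "pmf (K a 0) x * exp ((2 * \<mu> - \<nu>) * T) / (4 * C) \<le>
      prob {\<eta> \<in> space N. S a \<eta> = x \<and> (\<mu> * T - ln 2) / \<theta> \<le> (LINT u:{a..a+T}|lborel. of_bool (S u \<eta> = x))}"
  shows "pmf (K a 0) x * exp ((2 * \<mu> - \<nu>) * T) / (4 * C) \<le>
      prob {\<eta> \<in> space N. scenery_integral \<zeta> (\<lambda>u. S u \<eta>) (a + T) \<ge> c * (a + T)}"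
proof (rule order_trans[OF loc], rule finite_measure_mono)
  show "{\<eta> \<in> space N. scenery_integral \<zeta> (\<lambda>u. S u \<eta>) (a + T) \<ge> c * (a + T)} \<in> sets N"
  proof -
    have "0 < a + T" using assms(1,2) by simp
    from scenery_integral_measurable[OF this, of \<zeta>] show ?thesis by measurable
  qed
  show "{\<eta> \<in> space N. S a \<eta> = x \<and> (\<mu> * T - ln 2) / \<theta> \<le> (LINT u:{a..a+T}|lborel. of_bool (S u \<eta> = x))}
    \<subseteq> {\<eta> \<in> space N. scenery_integral \<zeta> (\<lambda>u. S u \<eta>) (a + T) \<ge> c * (a + T)}"
  proof safe
    fix \<eta> assume \<eta>: "\<eta> \<in> space N" and l: "(\<mu> * T - ln 2) / \<theta> \<le> (LINT u:{a..a+T}|lborel. of_bool (S u \<eta> = S a \<eta>))"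
      and x: "x = S a \<eta>"
    have "c * (a + T) \<le> \<zeta> x * (LINT u:{a..a+T}|lborel. of_bool (S u \<eta> = S a \<eta>))"
      using s l \<zeta>[of x] by (meson mult_left_mono order_trans)
    also have "\<dots> \<le> scenery_integral \<zeta> (\<lambda>u. S u \<eta>) (a + T)"
      unfolding x by (rule scenery_integral_ge_local_time[OF \<eta> assms(1,2) \<zeta>])
    finally show "c * (a + T) \<le> scenery_integral \<zeta> (\<lambda>u. S u \<eta>) (a + T)" .
  qed
qed

text \<open>A point mass at \<open>x\<close> satisfies \<open>L \<phi> \<ge> - \<phi>\<close>, so
  the potential 2 leaves growth rate 1. For a constant \<open>\<psi>\<close> the doubled potential
  gives rate 4. Hence the exponent \<open>2 * 1 - 4 = - 2\<close>.\<close>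

lemma lower_tail_general:
  assumes "0 \<le> a" "0 < T" and \<zeta>: "\<And>y. 0 \<le> \<zeta> y" and s: "c * (a + T) \<le> \<zeta> x * ((T - ln 2) / 2)"
  shows "pmf (K a 0) x * exp (- 2 * T) / 4 \<le>
      prob {\<eta> \<in> space N. scenery_integral \<zeta> (\<lambda>u. S u \<eta>) (a + T) \<ge> c * (a + T)}"
proof -
  define \<phi> :: "int ^ 'd \<Rightarrow> real" where "\<phi> y = of_bool (y = x)" for y
  have L\<phi>: "walk_gen \<phi> y + 2 * of_bool (y = x) * \<phi> y \<ge> 1 * \<phi> y" for y
  proof -
    have "0 \<le> walk_avg \<phi> y" unfolding walk_avg_def \<phi>_def by (intro divide_nonneg_nonneg sum_nonneg) auto
    then show ?thesis unfolding walk_gen_avg by (cases "y = x") (auto simp: \<phi>_def)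
  qed
  have Lb: "\<bar>walk_gen \<phi> y\<bar> \<le> 2" for y using walk_gen_bound[of \<phi> 1 y] by (simp add: \<phi>_def)
  have L\<psi>: "walk_gen (\<lambda>_. 1) y + 2 * 2 * of_bool (y = x) * 1 \<le> 4 * 1" for y :: "int ^ 'd"
    unfolding walk_gen_avg walk_avg_const by simp
  have "pmf (K a 0) x * exp ((2 * 1 - 4) * T) / (4 * 1) \<le>
     prob {\<eta> \<in> space N. S a \<eta> = x \<and> (1 * T - ln 2) / 2 \<le> (LINT u:{a..a+T}|lborel. of_bool (S u \<eta> = x))}"
    by (rule local_time_lower(1)[where \<phi>=\<phi> and \<psi>="\<lambda>_. 1" and D=2])
      (use assms(1,2) L\<phi> Lb L\<psi> in \<open>simp_all add: \<phi>_def\<close>)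
  then have "pmf (K a 0) x * exp ((2 * 1 - 4) * T) / (4 * 1) \<le>
      prob {\<eta> \<in> space N. scenery_integral \<zeta> (\<lambda>u. S u \<eta>) (a + T) \<ge> c * (a + T)}"
    by (rule lower_tail[where \<zeta>=\<zeta> and \<theta>=2, rotated -1]) (use assms(1,2) \<zeta> s in simp_all)
  then show ?thesis by simp
qed

text \<open>Local time of order \<open>u * T\<close> at a cost of order \<open>u^2 * T\<close> in
  the exponent: for \<open>r\<close> near \<open>1 / (4 * u)\<close> the rate \<open>1 / r^2\<close>
  of the second moment is of order \<open>u^2\<close>. The gain \<open>u^2 * T\<close> from the
  first moment is given away at the end.\<close>

lemma lower_tail_one_dim:
  assumes d: "CARD('d) = 1" and "0 \<le> a" "0 < T" and \<zeta>: "\<And>y. 0 \<le> \<zeta> y"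
    and u: "0 < u" "4 * u * real r \<le> 1" "1 \<le> r"
    and s: "c * (a + T) \<le> \<zeta> x * ((u\<^sup>2 / 2 * T - ln 2) / (2 * u))"
  shows "pmf (K a 0) x * exp (- (T / (real r)\<^sup>2)) / 8 \<le>
      prob {\<eta> \<in> space N. scenery_integral \<zeta> (\<lambda>u. S u \<eta>) (a + T) \<ge> c * (a + T)}"
proof -
  obtain i where U: "(UNIV :: 'd set) = {i}" using d by (auto simp: card_1_singleton_iff)
  have r: "real r \<ge> 1" using u by simp
  have "4 * u * 1 \<le> 4 * u * real r" using u r by (intro mult_left_mono) auto
  then have u4: "u \<le> 1 / 4" using u by linarith
  have yx: "y = x \<longleftrightarrow> y $ i - x $ i = 0" for y :: "int ^ 'd"
  proof -
    have "(\<forall>j. y $ j = x $ j) \<longleftrightarrow> (\<forall>j\<in>{i}. y $ j = x $ j)" unfolding U[symmetric] by simp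
    then show ?thesis by (simp add: vec_eq_iff)
  qed
  define q where "q = 1 - u"
  have q: "0 < q" "q < 1" using u u4 by (auto simp: q_def)
  \<comment> \<open>A geometric profile of width \<open>1 / u\<close>. Away from 0 the generator
    gives \<open>u^2 / 2\<close> times the inner neighbour's value; at 0 the kink costs
    \<open>u\<close>, half of the potential \<open>2 * u\<close>.\<close>
  define g where "g s = q ^ nat \<bar>s\<bar>" for s :: int
  define \<phi> where "\<phi> y = g (y $ i - x $ i)" for y :: "int ^ 'd"
  have g01: "0 \<le> g s" "g s \<le> 1" for s using q by (auto simp: g_def power_le_one)
  have gL: "(g (s + 1) + g (s - 1)) / 2 - g s + 2 * u * of_bool (s = 0) * g s \<ge> u\<^sup>2 / 2 * g s" for s
  proof (cases "s = 0")
    case True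
    have "u * u \<le> u * 1" using u u4 by (intro mult_left_mono) auto
    then have "u\<^sup>2 / 2 * g s \<le> u" using True u u4 by (simp add: g_def power2_eq_square)
    moreover have "(g (s + 1) + g (s - 1)) / 2 - g s + 2 * u * of_bool (s = 0) * g s = u"
      using True by (simp add: g_def q_def field_simps)
    ultimately show ?thesis by (simp only:)
  next
    case False
    define m where "m = nat \<bar>s\<bar> - 1"
    have s: "nat \<bar>s\<bar> = Suc m" using False by (simp add: m_def)
    have "g (s + 1) + g (s - 1) = q ^ (m + 2) + q ^ m"
    proof (cases "s > 0")
      case True
      then have n: "nat \<bar>s + 1\<bar> = m + 2" "nat \<bar>s - 1\<bar> = m" using s by auto
      show ?thesis unfolding g_def n ..
    next
      case neg: False
      then have n: "nat \<bar>s + 1\<bar> = m" "nat \<bar>s - 1\<bar> = m + 2" using s False by auto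
      show ?thesis unfolding g_def n by (rule add.commute)
    qed
    then have "(g (s + 1) + g (s - 1)) / 2 - g s = q ^ m * (u\<^sup>2 / 2)"
      by (simp add: g_def s q_def power2_eq_square algebra_simps) (simp add: field_simps)
    moreover have "g s \<le> q ^ m" using q by (simp add: g_def s mult_left_le_one_le)
    then have "u\<^sup>2 / 2 * g s \<le> u\<^sup>2 / 2 * q ^ m" by (intro mult_left_mono) auto
    ultimately show ?thesis using False by (simp add: mult.commute)
  qed
  have L\<phi>: "walk_gen \<phi> y + 2 * u * of_bool (y = x) * \<phi> y \<ge> u\<^sup>2 / 2 * \<phi> y" for y
    unfolding \<phi>_def walk_gen_of_int_fun[OF d] yx by (rule gL)
  have Lb: "\<bar>walk_gen \<phi> y\<bar> \<le> 2" for y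
    using walk_gen_bound[of \<phi> 1 y] g01 by (simp add: \<phi>_def)
  \<comment> \<open>A squared tent of radius \<open>r\<close>: away from its centre the generator
    gives at most 1, and division by \<open>r^2\<close> yields the rate of
    \<open>\<psi>\<close>.\<close>
  define p where "p s = (max 0 (real r - \<bar>real_of_int s\<bar>))\<^sup>2" for s :: int
  define w where "w s = 1 + p s / (real r)\<^sup>2" for s :: int
  define \<psi> where "\<psi> y = w (y $ i - x $ i)" for y :: "int ^ 'd"
  have p0: "0 \<le> p s" for s by (simp add: p_def)
  have p1: "p s \<le> (real r)\<^sup>2" for s unfolding p_def using r by (intro power_mono) auto
  have w1: "1 \<le> w s" "w s \<le> 2" for s using p0[of s] p1[of s] r by (auto simp: w_def divide_le_eq)
  have sq: "(max 0 (v + 1))\<^sup>2 + (max 0 (v - 1))\<^sup>2 \<le> 2 * (max 0 v)\<^sup>2 + 2" for v :: real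
  proof -
    consider "v \<le> -1" | "-1 \<le> v" "v \<le> 0" | "0 \<le> v" "v \<le> 1" | "1 \<le> v" by linarith
    then show ?thesis
    proof cases
      case 1
      then have "max 0 (v + 1) = 0" "max 0 (v - 1) = 0" by auto
      then show ?thesis by simp
    next
      case 2
      have "(v + 1)\<^sup>2 \<le> 1\<^sup>2" using 2 by (intro power_mono) auto
      then show ?thesis using 2 by (simp add: max_def)
    next
      case 3
      have "0 \<le> (1 - v)\<^sup>2" by simp
      then show ?thesis using 3 by (simp add: max_def power2_eq_square algebra_simps)
    qed (auto simp: max_def power2_eq_square algebra_simps)
  qed
  have pL: "(p (s + 1) + p (s - 1)) / 2 - p s \<le> 1" if "s \<noteq> 0" for s
  proof -
    have "p (s + 1) + p (s - 1) = (max 0 ((real r - \<bar>real_of_int s\<bar>) + 1))\<^sup>2 + (max 0 ((real r - \<bar>real_of_int s\<bar>) - 1))\<^sup>2"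
    proof (cases "s > 0")
      case True then show ?thesis by (simp add: p_def algebra_simps)
    next
      case False
      then have "\<bar>real_of_int (s + 1)\<bar> = - real_of_int s - 1" "\<bar>real_of_int (s - 1)\<bar> = - real_of_int s + 1"
        "\<bar>real_of_int s\<bar> = - real_of_int s" using that by auto
      then show ?thesis unfolding p_def by (simp add: algebra_simps)
    qed
    also have "\<dots> \<le> 2 * p s + 2" unfolding p_def by (rule sq)
    finally have "p (s + 1) + p (s - 1) \<le> 2 * p s + 2" .
    then have "(p (s + 1) + p (s - 1)) / 2 \<le> (2 * p s + 2) / 2" by (rule divide_right_mono) simp
    then show ?thesis by (simp add: add_divide_distrib)
  qed
  have wL: "(w (s + 1) + w (s - 1)) / 2 - w s + 2 * (2 * u) * of_bool (s = 0) * w s \<le> 1 / (real r)\<^sup>2 * w s" for s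
  proof -
    have eq: "(w (s + 1) + w (s - 1)) / 2 - w s = ((p (s + 1) + p (s - 1)) / 2 - p s) / (real r)\<^sup>2"
      by (simp add: w_def add_divide_distrib diff_divide_distrib)
    have "(w (s + 1) + w (s - 1)) / 2 - w s + 2 * (2 * u) * of_bool (s = 0) * w s \<le> 1 / (real r)\<^sup>2"
    proof (cases "s = 0")
      case False
      then show ?thesis unfolding eq using divide_right_mono[OF pL[OF False], of "(real r)\<^sup>2"] by simp
    next
      case True
      have pv: "p (s + 1) = (real r - 1)\<^sup>2" "p (s - 1) = (real r - 1)\<^sup>2" "p s = (real r)\<^sup>2"
        using r True by (auto simp: p_def)
      have "(w (s + 1) + w (s - 1)) / 2 - w s = (1 - 2 * real r) / (real r)\<^sup>2"
      proof -
        have "((real r - 1)\<^sup>2 + (real r - 1)\<^sup>2) / 2 - (real r)\<^sup>2 = 1 - 2 * real r"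
          by (simp add: power2_eq_square field_simps)
        then show ?thesis unfolding eq pv by simp
      qed
      moreover have "w s = 2" using True r by (simp add: w_def p_def)
      \<comment> \<open>At the centre the doubled potential \<open>2 * (2 * u)\<close> meets
        \<open>w = 2\<close>. The downward kink of the tent, of order \<open>2 / r\<close>, pays for
        it; this is the origin of the condition \<open>4 * u * r \<le> 1\<close>.\<close>
      moreover have "8 * u \<le> 2 * real r / (real r)\<^sup>2"
        using u r by (simp add: power2_eq_square le_divide_eq mult_ac)
      ultimately show ?thesis using True by (simp add: diff_divide_distrib)
    qed
    also have "\<dots> \<le> 1 / (real r)\<^sup>2 * w s" using w1(1)[of s] mult_left_mono[of 1 "w s" "1 / (real r)\<^sup>2"] by simp
    finally show ?thesis .
  qed
  have L\<psi>: "walk_gen \<psi> y + 2 * (2 * u) * of_bool (y = x) * \<psi> y \<le> 1 / (real r)\<^sup>2 * \<psi> y" for y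
    unfolding \<psi>_def walk_gen_of_int_fun[OF d] yx by (rule wL)
  have "pmf (K a 0) x * exp ((2 * (u\<^sup>2 / 2) - 1 / (real r)\<^sup>2) * T) / (4 * 2) \<le>
     prob {\<eta> \<in> space N. S a \<eta> = x \<and> (u\<^sup>2 / 2 * T - ln 2) / (2 * u) \<le> (LINT u:{a..a+T}|lborel. of_bool (S u \<eta> = x))}"
  proof (rule local_time_lower(1)[where \<phi>=\<phi> and \<psi>=\<psi> and D=2])
    show "walk_gen \<phi> y + 2 * u * of_bool (y = x) * \<phi> y \<ge> u\<^sup>2 / 2 * \<phi> y" for y by (rule L\<phi>)
    show "walk_gen \<psi> y + 2 * (2 * u) * of_bool (y = x) * \<psi> y \<le> 1 / (real r)\<^sup>2 * \<psi> y" for y by (rule L\<psi>)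
    show "\<bar>walk_gen \<phi> y\<bar> \<le> 2" for y by (rule Lb)
  qed (use assms(2,3) u g01 w1 in \<open>simp_all add: \<phi>_def \<psi>_def\<close>, simp add: g_def)
  then have "pmf (K a 0) x * exp ((2 * (u\<^sup>2 / 2) - 1 / (real r)\<^sup>2) * T) / (4 * 2) \<le>
      prob {\<eta> \<in> space N. scenery_integral \<zeta> (\<lambda>u. S u \<eta>) (a + T) \<ge> c * (a + T)}"
    by (rule lower_tail[where \<zeta>=\<zeta> and \<theta>="2 * u", rotated -1]) (use assms(2,3) \<zeta> s in simp_all)
  moreover have "exp (- (T / (real r)\<^sup>2)) \<le> exp ((2 * (u\<^sup>2 / 2) - 1 / (real r)\<^sup>2) * T)"
    using assms(3) by (simp add: algebra_simps)
  then have "pmf (K a 0) x * exp (- (T / (real r)\<^sup>2)) / 8 \<le> pmf (K a 0) x * exp ((2 * (u\<^sup>2 / 2) - 1 / (real r)\<^sup>2) * T) / (4 * 2)"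
    by (intro divide_right_mono mult_left_mono frac_le) auto
  ultimately show ?thesis by linarith
qed

end

section \<open>The random scenery\<close>

locale iid_scenery = prob_space M for M :: "'a measure" +
  fixes z :: "'i \<Rightarrow> 'a \<Rightarrow> real" and \<alpha> :: real and x\<^sub>0 :: 'i
  assumes iid: "iid_family M z"
    and nonneg: "AE \<omega> in M. 0 \<le> z x \<omega>"
    and decay: "polynomial_decay (\<lambda>r. prob {\<omega> \<in> space M. z x\<^sub>0 \<omega> > r}) \<alpha>"
    and \<alpha>1: "1 < \<alpha>"
begin

lemma indep: "indep_vars (\<lambda>_. borel) z UNIV"
  using iid by (simp add: iid_family_def)

lemma z_measurable [measurable]: "z x \<in> borel_measurable M"
  using indep by (auto simp: indep_vars_def)

lemma distr_z: "distr M borel (z x) = distr M borel (z y)"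
  using iid by (simp add: iid_family_def)

definition tail :: "real \<Rightarrow> real" where
  "tail r = prob {\<omega> \<in> space M. z x\<^sub>0 \<omega> > r}"

lemma prob_z_greater: "prob {\<omega> \<in> space M. z x \<omega> > r} = tail r"
proof -
  have "prob {\<omega> \<in> space M. z y \<omega> > r} = measure (distr M borel (z y)) {r<..}" for y
    by (subst measure_distr) (auto intro!: arg_cong[where f=prob])
  then show ?thesis unfolding tail_def by (simp only: distr_z[of x x\<^sub>0])
qed

lemma tail_nonneg: "0 \<le> tail r"
  by (simp add: tail_def)

lemma tail_bounds:
  assumes "0 < \<epsilon>" "\<epsilon> < \<alpha>"
  shows "eventually (\<lambda>r. tail r \<le> r powr (- (\<alpha> - \<epsilon>)) \<and> r powr (- (\<alpha> + \<epsilon>)) \<le> tail r) at_top"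
proof -
  have lim: "((\<lambda>r. ln (tail r) / ln r) \<longlongrightarrow> - \<alpha>) at_top"
    using decay unfolding polynomial_decay_def tail_def .
  have "eventually (\<lambda>r. ln (tail r) / ln r < - \<alpha> + \<epsilon>) at_top"
    by (rule order_tendstoD(2)[OF lim]) (use assms in simp)
  moreover have "eventually (\<lambda>r. - \<alpha> - \<epsilon> < ln (tail r) / ln r) at_top"
    by (rule order_tendstoD(1)[OF lim]) (use assms in simp)
  ultimately show ?thesis using eventually_gt_at_top[of 1]
  proof eventually_elim
    case (elim r)
    have l: "0 < ln r" using elim by simp
    have 1: "ln (tail r) < (- \<alpha> + \<epsilon>) * ln r" using elim l by (simp add: divide_less_eq)
    have 2: "(- \<alpha> - \<epsilon>) * ln r < ln (tail r)" using elim l by (simp add: less_divide_eq)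
    have "(- \<alpha> + \<epsilon>) * ln r < 0" using l assms by (intro mult_neg_pos) auto
    \<comment> \<open>Because \<open>ln 0 = 0\<close>, a strictly negative logarithm excludes the
      value 0.\<close>
    with 1 have "tail r \<noteq> 0" by auto
    moreover have "0 \<le> tail r" by (simp add: tail_def)
    ultimately have t: "tail r = exp (ln (tail r))" by simp
    have "tail r \<le> exp ((- \<alpha> + \<epsilon>) * ln r)" "exp ((- \<alpha> - \<epsilon>) * ln r) \<le> tail r"
      using 1 2 by (subst t, simp)+
    then show ?case using elim by (simp add: powr_def algebra_simps)
  qed
qed

text \<open>Dyadic layers: \<open>z\<close> is at most 1 plus the sum of those \<open>2 ^ k\<close>
  which it exceeds. An exponent strictly between 1 and \<alpha>, here the midpoint \<open>a\<close>,
  makes the weighted tails geometric.\<close>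

lemma integrable_z: "integrable M (z x)"
proof -
  define a where "a = (1 + \<alpha>) / 2"
  have a: "1 < a" "0 < \<alpha> - a" "\<alpha> - a < \<alpha>" using \<alpha>1 by (auto simp: a_def field_simps)
  have "eventually (\<lambda>r. tail r \<le> r powr (- a)) at_top"
    using tail_bounds[OF a(2,3)] by eventually_elim simp
  then obtain r0 where r0: "\<And>r. r \<ge> r0 \<Longrightarrow> tail r \<le> r powr (- a)"
    by (auto simp: eventually_at_top_linorder)
  define q where "q = (2::real) powr (1 - a)"
  have q: "0 < q" "q < 1" using a powr_less_mono[of "1 - a" 0 2] by (auto simp: q_def)
  have trm: "2 ^ k * tail (2 ^ k) \<le> q ^ k" if "r0 \<le> 2 ^ k" for k
  proof -
    have "2 ^ k * tail (2 ^ k) \<le> 2 ^ k * (2 ^ k) powr (- a)"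
      using r0[OF that] by (intro mult_left_mono) auto
    also have "(2::real) ^ k * (2 ^ k) powr (- a) = (2 powr real k) powr (1 - a)"
      by (simp add: powr_realpow[symmetric] powr_powr powr_add[symmetric] algebra_simps)
    also have "\<dots> = q ^ k" by (simp add: q_def powr_powr powr_realpow[symmetric] mult.commute)
    finally show ?thesis .
  qed
  have ev: "eventually (\<lambda>k. r0 \<le> (2::real) ^ k) sequentially"
    by (rule filterlim_at_top[THEN iffD1, rule_format]) real_asymp
  have summ: "summable (\<lambda>k. 2 ^ k * tail (2 ^ k))"
  proof (rule summable_comparison_test_ev)
    show "eventually (\<lambda>k. norm (2 ^ k * tail (2 ^ k)) \<le> q ^ k) sequentially"
      using ev by eventually_elim (use trm in \<open>auto simp: tail_def abs_mult\<close>)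
    show "summable (\<lambda>k. q ^ k)" using q by (intro summable_geometric) auto
  qed
  have "(\<integral>\<^sup>+ \<omega>. ennreal (z x \<omega>) \<partial>M) \<le>
      (\<integral>\<^sup>+ \<omega>. 1 + (\<Sum>k. ennreal (2 ^ k) * indicator {\<omega> \<in> space M. z x \<omega> > 2 ^ k} \<omega>) \<partial>M)"
  proof (rule nn_integral_mono)
    fix \<omega> assume \<omega>: "\<omega> \<in> space M"
    obtain m where m: "z x \<omega> \<le> 2 ^ m" using real_arch_pow[of 2 "z x \<omega>"] by (auto intro: less_imp_le)
    define m where "m = (LEAST m. z x \<omega> \<le> 2 ^ m)"
    have m1: "z x \<omega> \<le> 2 ^ m" unfolding m_def
      by (rule LeastI[of "\<lambda>m. z x \<omega> \<le> 2 ^ m", OF m])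
    have m2: "z x \<omega> > 2 ^ k" if "k < m" for k
      using not_less_Least[of k "\<lambda>m. z x \<omega> \<le> 2 ^ m"] that by (simp add: m_def not_le)
    have "ennreal (z x \<omega>) \<le> ennreal (1 + (\<Sum>k<m. 2 ^ k))"
    proof (rule ennreal_leI)
      have "(\<Sum>k<m. (2::real) ^ k) = 2 ^ m - 1" by (induction m) auto
      then show "z x \<omega> \<le> 1 + (\<Sum>k<m. 2 ^ k)" using m1 by simp
    qed
    also have "\<dots> = 1 + (\<Sum>k<m. ennreal (2 ^ k))"
      by (subst ennreal_plus) (auto intro: sum_nonneg simp: sum_ennreal)
    also have "(\<Sum>k<m. ennreal (2 ^ k)) = (\<Sum>k<m. ennreal (2 ^ k) * indicator {\<omega> \<in> space M. z x \<omega> > 2 ^ k} \<omega>)"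
      using m2 \<omega> by (intro sum.cong) auto
    also have "\<dots> \<le> (\<Sum>k. ennreal (2 ^ k) * indicator {\<omega> \<in> space M. z x \<omega> > 2 ^ k} \<omega>)"
      by (intro sum_le_suminf) auto
    finally show "ennreal (z x \<omega>) \<le> 1 + (\<Sum>k. ennreal (2 ^ k) * indicator {\<omega> \<in> space M. z x \<omega> > 2 ^ k} \<omega>)"
      by (simp add: add_left_mono)
  qed
  also have "\<dots> = 1 + (\<Sum>k. ennreal (2 ^ k) * emeasure M {\<omega> \<in> space M. z x \<omega> > 2 ^ k})"
    by (simp add: nn_integral_add nn_integral_suminf nn_integral_cmult emeasure_space_1)
  also have "\<dots> = 1 + (\<Sum>k. ennreal (2 ^ k * tail (2 ^ k)))"
    by (simp add: emeasure_eq_measure prob_z_greater ennreal_mult tail_nonneg)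
  also have "\<dots> < \<infinity>"
  proof -
    have "(\<Sum>k. ennreal (2 ^ k * tail (2 ^ k))) = ennreal (\<Sum>k. 2 ^ k * tail (2 ^ k))"
      by (rule suminf_ennreal2[OF _ summ]) (simp add: tail_nonneg)
    then show ?thesis by (simp add: ennreal_add_eq_top)
  qed
  finally have fin: "(\<integral>\<^sup>+ \<omega>. ennreal (z x \<omega>) \<partial>M) < \<infinity>" .
  have "(\<integral>\<^sup>+ \<omega>. ennreal (norm (z x \<omega>)) \<partial>M) = (\<integral>\<^sup>+ \<omega>. ennreal (z x \<omega>) \<partial>M)"
    using nonneg[of x] by (intro nn_integral_cong_AE) (auto elim!: eventually_mono)
  with fin show ?thesis by (intro integrableI_bounded z_measurable) simp
qed

definition mean :: real where "mean = expectation (z x\<^sub>0)"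

lemma mean_eq: "expectation (z x) = mean"
proof -
  have "expectation (z y) = integral\<^sup>L (distr M borel (z y)) (\<lambda>v. v)" for y
    by (subst integral_distr) auto
  then show ?thesis unfolding mean_def by (simp only: distr_z[of x x\<^sub>0])
qed

lemma mean_nonneg: "0 \<le> mean"
  unfolding mean_def by (rule integral_nonneg_AE[OF nonneg])

text \<open>Truncation bounds the exponential moments at every sample point. The cut at 0 is there
  because nonnegativity of the scenery holds only almost surely.\<close>

definition clip :: "real \<Rightarrow> real \<Rightarrow> real" where "clip Z v = max 0 (min v Z)"

text \<open>A bound linear in \<open>u\<close> whose slope is close to 1 for small
  \<open>\<rho>\<close>; through it the mean of the scenery alone enters the Chernoff
  estimate.\<close>

lemma exp_le_chord: "0 \<le> u \<Longrightarrow> u \<le> \<rho> \<Longrightarrow> exp u \<le> 1 + u * exp (\<rho> :: real)"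
proof -
  assume u: "0 \<le> u" "u \<le> \<rho>"
  have "exp u * (1 - u) \<le> exp u * exp (- u)"
    using exp_ge_add_one_self[of "- u"] by (intro mult_left_mono) auto
  then have "exp u \<le> 1 + u * exp u" by (simp add: exp_minus algebra_simps)
  also have "u * exp u \<le> u * exp \<rho>" using u by (intro mult_left_mono) auto
  finally show ?thesis by simp
qed

text \<open>Each summand in the exponent is at most \<open>\<rho>\<close>, where the exponential is
  nearly linear. By independence and total weight at most 1 the exponential moment is then at most
  \<open>exp (l * exp \<rho> * mean)\<close>.\<close>

lemma weighted_sum_chernoff:
  assumes B: "finite B" and w: "\<And>y. 0 \<le> w y" "(\<Sum>y\<in>B. w y) \<le> 1" and Z: "0 \<le> Z"
    and l: "0 \<le> l" "\<And>y. l * w y * Z \<le> \<rho>"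
  shows "prob {\<omega> \<in> space M. b < (\<Sum>y\<in>B. w y * clip Z (z y \<omega>))} \<le> exp (- (l * (b - exp \<rho> * mean)))"
proof -
  define X where "X y \<omega> = exp (l * w y * clip Z (z y \<omega>))" for y \<omega>
  have clip: "0 \<le> clip Z v" "clip Z v \<le> Z" for v using Z by (auto simp: clip_def)
  have u: "0 \<le> l * w y * clip Z v" "l * w y * clip Z v \<le> \<rho>" for y v
    using l w(1)[of y] clip[of v] by (auto intro!: order_trans[OF _ l(2)[of y]] mult_left_mono)
  have Xm [measurable]: "X y \<in> borel_measurable M" for y unfolding X_def clip_def by measurable
  have iX: "integrable M (X y)" for y
  proof (rule integrable_const_bound[where B="exp \<rho>"])
    show "AE \<omega> in M. norm (X y \<omega>) \<le> exp \<rho>" using u(2) by (simp add: X_def)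
  qed measurable
  have iclip: "integrable M (\<lambda>\<omega>. clip Z (z y \<omega>))" for y
  proof (rule integrable_const_bound[where B=Z])
    show "AE \<omega> in M. norm (clip Z (z y \<omega>)) \<le> Z" using clip by simp
  qed (unfold clip_def, measurable)
  have EX: "expectation (X y) \<le> exp (l * exp \<rho> * mean * w y)" for y
  proof -
    have "expectation (X y) \<le> expectation (\<lambda>\<omega>. 1 + l * w y * exp \<rho> * clip Z (z y \<omega>))"
    proof (rule integral_mono)
      show "integrable M (\<lambda>\<omega>. 1 + l * w y * exp \<rho> * clip Z (z y \<omega>))" using iclip by simp
      show "X y \<omega> \<le> 1 + l * w y * exp \<rho> * clip Z (z y \<omega>)" for \<omega>
        using exp_le_chord[OF u] by (simp add: X_def mult_ac)
    qed (rule iX)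
    also have "\<dots> = 1 + l * w y * exp \<rho> * expectation (\<lambda>\<omega>. clip Z (z y \<omega>))"
      using iclip by (simp add: prob_space)
    also have "\<dots> \<le> 1 + l * w y * exp \<rho> * mean"
    proof -
      have "expectation (\<lambda>\<omega>. clip Z (z y \<omega>)) \<le> expectation (z y)"
        using nonneg[of y] by (intro integral_mono_AE iclip integrable_z) (auto elim!: eventually_mono simp: clip_def)
      then show ?thesis using l w(1)[of y] unfolding mean_eq by (intro add_left_mono mult_left_mono) auto
    qed
    also have "\<dots> \<le> exp (l * w y * exp \<rho> * mean)" by (rule exp_ge_add_one_self)
    finally show ?thesis by (simp add: mult_ac)
  qed
  have "indep_vars (\<lambda>_. borel) (\<lambda>y \<omega>. (\<lambda>v. exp (l * w y * clip Z v)) (z y \<omega>)) B"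
    by (rule indep_vars_compose2[OF indep_vars_subset[OF indep]]) (auto simp: clip_def)
  then have ind: "indep_vars (\<lambda>_. borel) X B" by (simp add: X_def[abs_def])
  have iP: "integrable M (\<lambda>\<omega>. \<Prod>y\<in>B. X y \<omega>)" by (rule indep_vars_integrable[OF B ind iX])
  have "prob {\<omega> \<in> space M. b < (\<Sum>y\<in>B. w y * clip Z (z y \<omega>))} \<le>
      prob {\<omega> \<in> space M. exp (l * b) \<le> (\<Prod>y\<in>B. X y \<omega>)}"
  proof (rule finite_measure_mono)
    show "{\<omega> \<in> space M. exp (l * b) \<le> (\<Prod>y\<in>B. X y \<omega>)} \<in> sets M" by measurable
    show "{\<omega> \<in> space M. b < (\<Sum>y\<in>B. w y * clip Z (z y \<omega>))} \<subseteq> {\<omega> \<in> space M. exp (l * b) \<le> (\<Prod>y\<in>B. X y \<omega>)}"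
    proof safe
      fix \<omega> assume "b < (\<Sum>y\<in>B. w y * clip Z (z y \<omega>))"
      then have "l * b \<le> l * (\<Sum>y\<in>B. w y * clip Z (z y \<omega>))" using l by (intro mult_left_mono) auto
      then show "exp (l * b) \<le> (\<Prod>y\<in>B. X y \<omega>)"
        using B by (simp add: X_def exp_sum[symmetric] sum_distrib_left mult.assoc)
    qed
  qed
  also have "\<dots> \<le> expectation (\<lambda>\<omega>. \<Prod>y\<in>B. X y \<omega>) / exp (l * b)"
    by (rule integral_Markov_inequality_measure[where A="{}", OF iP]) (auto simp: X_def intro!: prod_nonneg)
  also have "expectation (\<lambda>\<omega>. \<Prod>y\<in>B. X y \<omega>) = (\<Prod>y\<in>B. expectation (X y))"
    by (rule indep_vars_lebesgue_integral[OF B ind iX])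
  also have "\<dots> \<le> (\<Prod>y\<in>B. exp (l * exp \<rho> * mean * w y))"
    using EX by (intro prod_mono) (auto simp: X_def)
  also have "\<dots> = exp (l * exp \<rho> * mean * (\<Sum>y\<in>B. w y))"
    using B by (simp add: exp_sum sum_distrib_left)
  also have "\<dots> \<le> exp (l * exp \<rho> * mean * 1)"
    using w(2) l mean_nonneg by (subst exp_le_cancel_iff, intro mult_left_mono) auto
  also have "exp (l * exp \<rho> * mean * 1) / exp (l * b) = exp (- (l * (b - exp \<rho> * mean)))"
  proof -
    have "- (l * (b - exp \<rho> * mean)) = l * exp \<rho> * mean * 1 - l * b" by (simp add: algebra_simps)
    then show ?thesis by (simp only: exp_diff)
  qed
  finally show ?thesis by (simp add: divide_right_mono)
qed

lemma prob_all_le: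
  assumes B: "finite B" "B \<noteq> {}"
  shows "prob {\<omega> \<in> space M. \<forall>y\<in>B. z y \<omega> \<le> r} \<le> exp (- (tail r * real (card B)))"
proof -
  have "prob {\<omega> \<in> space M. \<forall>y\<in>B. z y \<omega> \<le> r} = prob (\<Inter>y\<in>B. z y -` {..r} \<inter> space M)"
    using B by (intro arg_cong[where f=prob]) auto
  also have "\<dots> = (\<Prod>y\<in>B. prob (z y -` {..r} \<inter> space M))"
    using B by (intro indep_varsD[OF indep]) auto
  also have "\<dots> = (\<Prod>y\<in>B. 1 - tail r)"
  proof (intro prod.cong refl)
    fix y
    have "z y -` {..r} \<inter> space M = space M - {\<omega> \<in> space M. z y \<omega> > r}" by auto
    then show "prob (z y -` {..r} \<inter> space M) = 1 - tail r"
      using prob_compl[of "{\<omega> \<in> space M. z y \<omega> > r}"] by (simp add: prob_z_greater)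
  qed
  also have "\<dots> = (1 - tail r) ^ card B" by simp
  also have "\<dots> \<le> exp (- tail r) ^ card B"
    using exp_ge_add_one_self[of "- tail r"] by (intro power_mono) (auto simp: tail_def)
  also have "\<dots> = exp (- (tail r * real (card B)))"
    by (simp add: exp_of_nat_mult[symmetric] mult.commute)
  finally show ?thesis .
qed

lemma prob_ex_greater:
  assumes B: "finite B"
  shows "prob {\<omega> \<in> space M. \<exists>y\<in>B. z y \<omega> > r} \<le> real (card B) * tail r"
proof -
  have "{\<omega> \<in> space M. \<exists>y\<in>B. z y \<omega> > r} = (\<Union>y\<in>B. {\<omega> \<in> space M. z y \<omega> > r})" by auto
  also have "prob \<dots> \<le> (\<Sum>y\<in>B. prob {\<omega> \<in> space M. z y \<omega> > r})"
    using B by (intro finite_measure_subadditive_finite) auto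
  finally show ?thesis by (simp add: prob_z_greater)
qed

end

text \<open>Along \<open>n = 2 ^ k\<close> every negative power of \<open>n\<close> is summable,
  however small its exponent.\<close>

lemma (in prob_space) dyadic_borel_cantelli:
  fixes A :: "real \<Rightarrow> 'a set"
  assumes A: "\<And>n. A n \<in> events" and \<eta>: "0 < \<eta>"
    and le: "eventually (\<lambda>n. prob (A n) \<le> C * n powr (- \<eta>)) at_top"
  shows "AE \<omega> in M. eventually (\<lambda>k. \<omega> \<notin> A (2 ^ k)) sequentially"
proof -
  define q where "q = (2::real) powr (- \<eta>)"
  have q: "0 < q" "q < 1" using \<eta> powr_less_mono[of "- \<eta>" 0 2] by (auto simp: q_def)
  have lim: "filterlim (\<lambda>k. (2::real) ^ k) at_top sequentially" by real_asymp
  have pw: "C * (2 ^ k) powr (- \<eta>) = C * q ^ k" for k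
    by (simp add: q_def powr_realpow[symmetric] powr_powr mult.commute)
  have "summable (\<lambda>k. prob (A (2 ^ k)))"
  proof (rule summable_comparison_test_ev)
    show "eventually (\<lambda>k. norm (prob (A (2 ^ k))) \<le> C * q ^ k) sequentially"
      using eventually_compose_filterlim[OF le lim] by eventually_elim (simp add: pw)
    show "summable (\<lambda>k. C * q ^ k)" using q by (intro summable_mult summable_geometric) auto
  qed
  then have "AE \<omega> in M. eventually (\<lambda>k. \<omega> \<in> space M - A (2 ^ k)) sequentially"
    using A by (intro borel_cantelli_AE1) (auto simp: emeasure_eq_measure)
  then show ?thesis by eventually_elim (auto elim: eventually_mono)
qed

section \<open>Exponents, and almost sure estimates for the scenery at dyadic scales\<close>

locale lattice_scenery = iid_scenery M z \<alpha> 0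
  for M :: "'a measure" and z :: "int ^ 'd::finite \<Rightarrow> 'a \<Rightarrow> real" and \<alpha> :: real +
  assumes dim: "CARD('d) = 1 \<or> CARD('d) \<ge> 2 \<and> \<alpha> > real CARD('d) / 2"
begin

text \<open>Common decay exponent of the weights: the heat kernel at time \<open>T\<close> and the
  Green function divided by \<open>T\<close> are at most of order
  \<open>T powr (- \<kappa>)\<close>, up to a logarithm.\<close>

definition \<kappa> :: real where "\<kappa> = (if CARD('d) = 1 then 1 / 2 else 1)"
definition p :: real where
  "p = (if CARD('d) = 1 then (\<alpha> - 1) / (\<alpha> + 1) else (2 * \<alpha> - real CARD('d)) / (2 * \<alpha> + real CARD('d)))"
definition \<beta> :: real where "\<beta> = (1 + p) / 2"
definition \<gamma> :: real where "\<gamma> = \<kappa> * (1 - p)"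

lemma \<kappa>: "1 / 2 \<le> \<kappa>" "\<kappa> \<le> 1" by (auto simp: \<kappa>_def)

lemma p01: "0 < p" "p < 1"
proof -
  have d: "real CARD('d) > 0" by simp
  show "0 < p" "p < 1" using dim \<alpha>1 d by (auto simp: p_def)
qed

lemma \<beta>: "1 / 2 < \<beta>" "\<beta> < 1" "2 * \<beta> - 1 = p" using p01 by (auto simp: \<beta>_def field_simps)

lemma \<gamma>: "0 < \<gamma>" using p01 \<kappa>(1) by (auto simp: \<gamma>_def)

text \<open>This equation determines \<open>p\<close>: the largest value in a cube of radius
  \<open>n powr \<beta>\<close> has exponent \<open>\<beta> * d / \<alpha>\<close>, and it must
  balance the decay exponent \<open>\<gamma>\<close> of the weights at time
  \<open>n powr (1 - p)\<close>.\<close>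

lemma \<beta>\<gamma>: "\<beta> * real CARD('d) = \<gamma> * \<alpha>"
proof (cases "CARD('d) = 1")
  case True
  then show ?thesis using \<alpha>1 by (simp add: \<beta>_def \<gamma>_def \<kappa>_def p_def field_simps)
next
  case False
  have "2 * \<alpha> + real CARD('d) > 0" using \<alpha>1 by (simp add: add_pos_pos)
  then show ?thesis using False by (simp add: \<beta>_def \<gamma>_def \<kappa>_def p_def field_simps)
qed

lemma heat_upper: "heat m (x :: int ^ 'd) \<le> 3 * real CARD('d) * (real m + 1) powr (- \<kappa>)"
proof (cases "CARD('d) = 1")
  case True
  have "heat m x \<le> 1 / sqrt (real m + 1)" by (rule heat_upper_1[OF True])
  also have "\<dots> = (real m + 1) powr (- (1 / 2))" by (simp add: powr_minus_divide powr_half_sqrt)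
  also have "\<dots> \<le> 3 * (real m + 1) powr (- (1 / 2))" by simp
  finally show ?thesis using True by (simp add: \<kappa>_def)
next
  case False
  then have "CARD('d) \<ge> 2" using dim by auto
  from heat_upper_2[OF this, of m x] show ?thesis using False by (simp add: \<kappa>_def powr_minus_divide)
qed

text \<open>Split \<open>(m + 1) powr (- \<kappa>)\<close> into
  \<open>(m + 1) powr (1 - \<kappa>)\<close> and \<open>1 / (m + 1)\<close> and bound the first
  factor by its value at \<open>T\<close>. The harmonic sum that remains costs a logarithm but
  treats both values of \<open>\<kappa>\<close> at once.\<close>

lemma green_upper:
  assumes T: "1 \<le> T"
  shows "green T (x :: int ^ 'd) \<le> 3 * real CARD('d) * real T powr (1 - \<kappa>) * (1 + ln (real T))"
proof -
  have "green T x \<le> (\<Sum>m<T. 3 * real CARD('d) * real T powr (1 - \<kappa>) * (1 / real (Suc m)))"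
    unfolding green_def
  proof (rule sum_mono)
    fix m assume m: "m \<in> {..<T}"
    have "heat m x \<le> 3 * real CARD('d) * (real m + 1) powr (- \<kappa>)" by (rule heat_upper)
    also have "(real m + 1) powr (- \<kappa>) = (real m + 1) powr (1 - \<kappa>) * (1 / real (Suc m))"
      by (simp add: powr_diff powr_minus_divide add.commute)
    also have "3 * real CARD('d) * ((real m + 1) powr (1 - \<kappa>) * (1 / real (Suc m))) \<le>
        3 * real CARD('d) * (real T powr (1 - \<kappa>) * (1 / real (Suc m)))"
      using m \<kappa> by (intro mult_left_mono mult_right_mono powr_mono2) auto
    finally show "heat m x \<le> 3 * real CARD('d) * real T powr (1 - \<kappa>) * (1 / real (Suc m))"
      by (simp only: mult.assoc)
  qed
  also have "\<dots> = 3 * real CARD('d) * real T powr (1 - \<kappa>) * harm T"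
    by (simp only: sum_distrib_left harm_altdef inverse_eq_divide)
  also have "\<dots> \<le> 3 * real CARD('d) * real T powr (1 - \<kappa>) * (1 + ln (real T))"
  proof (rule mult_left_mono)
    have "harm (Suc (T - 1)) - ln (real (Suc (T - 1))) \<le> harm (Suc 0) - ln (real (Suc 0))"
      using decseqD[OF decseq_harm_diff_ln, of 0 "T - 1"] by simp
    then show "harm T \<le> 1 + ln (real T)" using T by (simp add: harm_expand)
  qed simp
  finally show ?thesis .
qed

definition R :: "real \<Rightarrow> nat" where "R n = nat \<lfloor>n powr \<beta>\<rfloor>"
text \<open>As \<open>\<kappa> \<ge> 1 / 2\<close>, the margin \<open>4 * \<delta>\<close> brings
  the weights down to \<open>n powr (- (\<gamma> + 2 * \<delta>))\<close> up to a logarithm. This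
  beats the truncation level \<open>n powr (\<gamma> + \<delta>)\<close> times a Chernoff parameter
  of order \<open>n powr (\<delta> / 2)\<close>.\<close>

definition T :: "real \<Rightarrow> real \<Rightarrow> nat" where "T \<delta> n = nat \<lceil>n powr (1 - p + 4 * \<delta>)\<rceil>"

lemma R_bounds: "1 \<le> n \<Longrightarrow> real (R n) \<le> n powr \<beta> \<and> n powr \<beta> \<le> 2 * real (R n) \<and> n powr \<beta> \<le> n \<and> 1 \<le> n powr \<beta>"
proof -
  assume n: "1 \<le> n"
  have 1: "1 \<le> n powr \<beta>" using n \<beta> by (intro ge_one_powr_ge_zero) auto
  have 2: "n powr \<beta> \<le> n" using powr_mono[of \<beta> 1 n] n \<beta> by simp
  have "real (R n) \<le> n powr \<beta>" "n powr \<beta> < real (R n) + 1" using 1 unfolding R_def by linarith+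
  moreover have "1 \<le> real (R n)" using 1 unfolding R_def by (simp add: le_floor_iff le_nat_iff)
  ultimately show ?thesis using 1 2 by linarith
qed

lemma T_bounds:
  assumes "1 \<le> n" "0 < \<delta>" "4 * \<delta> < p"
  shows "n powr (1 - p + 4 * \<delta>) \<le> real (T \<delta> n) \<and> real (T \<delta> n) \<le> 2 * n powr (1 - p + 4 * \<delta>) \<and> real (T \<delta> n) \<le> 2 * n \<and> 1 \<le> T \<delta> n"
proof -
  have 1: "1 \<le> n powr (1 - p + 4 * \<delta>)" using assms p01 by (intro ge_one_powr_ge_zero) auto
  have 2: "n powr (1 - p + 4 * \<delta>) \<le> n powr 1" using assms by (intro powr_mono) auto
  have 3: "n powr (1 - p + 4 * \<delta>) \<le> real (T \<delta> n)" "real (T \<delta> n) < n powr (1 - p + 4 * \<delta>) + 1"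
    using 1 unfolding T_def by linarith+
  have "1 \<le> real (T \<delta> n)" using 1 3 by linarith
  then show ?thesis using 1 2 3 assms by auto
qed

lemma scenery_max_lower:
  assumes \<delta>: "0 < \<delta>" "\<delta> < \<gamma>"
  shows "AE \<omega> in M. eventually (\<lambda>k. \<exists>x\<in>cube (R (2 ^ k)). (2 ^ k) powr (\<gamma> - \<delta>) < z x \<omega>) sequentially"
proof -
  let ?A = "\<lambda>n. {\<omega> \<in> space M. \<forall>x\<in>cube (R n). z x \<omega> \<le> n powr (\<gamma> - \<delta>)}"
  \<comment> \<open>Lowering the level by \<open>\<delta>\<close> gains
    \<open>\<delta> * \<alpha>\<close> in the exponent of the expected number of high sites; half of
    it is spent on the error in the tail.\<close>
  define \<epsilon> where "\<epsilon> = \<delta> * \<alpha> / (2 * \<gamma>)"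
  have \<epsilon>: "0 < \<epsilon>" "\<epsilon> < \<alpha>" using \<delta> \<gamma> \<alpha>1 by (auto simp: \<epsilon>_def field_simps intro: mult_strict_mono)
  have lim: "filterlim (\<lambda>n::real. n powr (\<gamma> - \<delta>)) at_top at_top" using \<delta> by real_asymp
  have e: "\<delta> * \<alpha> / 2 \<le> \<beta> * real CARD('d) - (\<gamma> - \<delta>) * (\<alpha> + \<epsilon>)"
  proof -
    have "(\<gamma> - \<delta>) * \<epsilon> \<le> \<gamma> * \<epsilon>" using \<delta> \<epsilon> by (intro mult_right_mono) auto
    also have "\<gamma> * \<epsilon> = \<delta> * \<alpha> / 2" using \<gamma> by (simp add: \<epsilon>_def)
    finally show ?thesis unfolding \<beta>\<gamma> by (simp add: algebra_simps)
  qed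
  have "eventually (\<lambda>n. prob (?A n) \<le> 1 * n powr (- 1)) at_top"
  proof -
    have "0 < \<delta> * \<alpha> / 2" using \<delta> \<alpha>1 by simp
    then have "eventually (\<lambda>n::real. exp (- (n powr (\<delta> * \<alpha> / 2))) \<le> 1 * n powr (- 1)) at_top"
      by real_asymp
    then show ?thesis
      using eventually_compose_filterlim[OF tail_bounds[OF \<epsilon>] lim] eventually_ge_at_top[of 1]
    proof eventually_elim
      case (elim n)
      have Rn: "n powr \<beta> \<le> 2 * real (R n) + 1" using R_bounds[of n] elim by auto
      have "n powr (\<delta> * \<alpha> / 2) \<le> n powr (\<beta> * real CARD('d) - (\<gamma> - \<delta>) * (\<alpha> + \<epsilon>))"
        using e elim by (intro powr_mono) auto
      also have "\<dots> = (n powr (\<gamma> - \<delta>)) powr (- (\<alpha> + \<epsilon>)) * (n powr \<beta>) ^ CARD('d)"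
        using elim by (simp add: powr_powr powr_realpow[symmetric] powr_add[symmetric] algebra_simps)
      also have "\<dots> \<le> tail (n powr (\<gamma> - \<delta>)) * (2 * real (R n) + 1) ^ CARD('d)"
        using elim Rn by (intro mult_mono power_mono) (auto simp: tail_def)
      also have "\<dots> = tail (n powr (\<gamma> - \<delta>)) * real (card (cube (R n) :: (int ^ 'd) set))"
        by (simp add: card_cube add.commute)
      finally have "exp (- (tail (n powr (\<gamma> - \<delta>)) * real (card (cube (R n) :: (int ^ 'd) set)))) \<le> exp (- (n powr (\<delta> * \<alpha> / 2)))"
        by simp
      moreover have "prob (?A n) \<le> exp (- (tail (n powr (\<gamma> - \<delta>)) * real (card (cube (R n) :: (int ^ 'd) set))))"
      proof (rule prob_all_le[OF finite_cube])
        have "0 \<in> (cube (R n) :: (int ^ 'd) set)" by (simp add: cube_def)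
        then show "(cube (R n) :: (int ^ 'd) set) \<noteq> {}" by blast
      qed
      ultimately show ?case using elim by linarith
    qed
  qed
  moreover have "?A n \<in> events" for n
    using finite_cube by measurable
  ultimately have "AE \<omega> in M. eventually (\<lambda>k. \<omega> \<notin> ?A (2 ^ k)) sequentially"
    by (intro dyadic_borel_cantelli[where \<eta>=1]) auto
  then show ?thesis using AE_space by eventually_elim (auto elim!: eventually_mono simp: not_le)
qed

text \<open>The bad events are a site above the truncation level and, for some starting point, one
  of the two clipped averages above \<open>b\<close>. From outside the cube of radius
  \<open>R + T\<close> the kernels see none of the scenery, so polynomially many averages remain,
  each failing with a probability smaller than any power of \<open>n\<close>.\<close>

lemma scenery_averages_upper:
  assumes \<delta>: "0 < \<delta>" "4 * \<delta> < p" and b: "mean < b"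
  shows "AE \<omega> in M. eventually (\<lambda>k. \<forall>x.
      (\<Sum>y\<in>cube (R (2 ^ k)). heat (T \<delta> (2 ^ k)) (x - y) * z y \<omega>) \<le> b \<and>
      (\<Sum>y\<in>cube (R (2 ^ k)). green (T \<delta> (2 ^ k)) (x - y) * z y \<omega>) \<le> b * real (T \<delta> (2 ^ k))) sequentially"
proof -
  have "((\<lambda>\<rho>. exp \<rho> * mean) \<longlongrightarrow> exp 0 * mean) (at_right 0)" by (intro tendsto_intros)
  then have "eventually (\<lambda>\<rho>. exp \<rho> * mean < b) (at_right 0)" by (rule order_tendstoD(2)) (use b in simp)
  then obtain r where "r > 0" "\<And>\<rho>. 0 < \<rho> \<Longrightarrow> \<rho> < r \<Longrightarrow> exp \<rho> * mean < b"
    unfolding eventually_at_right_field by auto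
  then have "0 < r / 2" "exp (r / 2) * mean < b" by auto
  then obtain \<rho> where \<rho>: "0 < \<rho>" "exp \<rho> * mean < b" by blast
  have b0: "0 < b" using b mean_nonneg by linarith
  define Z where "Z n = n powr (\<gamma> + \<delta>)" for n :: real
  \<comment> \<open>It tends to infinity, which makes every failure probability stretched
    exponential, yet slowly enough for weight times level times \<open>l\<close> to stay below
    \<open>\<rho>\<close>.\<close>
  define l where "l n = \<rho> * n powr (\<delta> / 2)" for n :: real
  let ?w1 = "\<lambda>n (x :: int ^ 'd) y. heat (T \<delta> n) (x - y)"
    and ?w2 = "\<lambda>n (x :: int ^ 'd) y. green (T \<delta> n) (x - y) / real (T \<delta> n)"
  let ?A1 = "\<lambda>n. {\<omega> \<in> space M. \<exists>y\<in>cube (R n). z y \<omega> > Z n}"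
  let ?E = "\<lambda>w n x. {\<omega> \<in> space M. b < (\<Sum>y\<in>cube (R n). w n x y * clip (Z n) (z y \<omega>))}"
  let ?A = "\<lambda>n. ?A1 n \<union> (\<Union>x\<in>cube (R n + T \<delta> n). ?E ?w1 n x \<union> ?E ?w2 n x)"
  have A1m: "?A1 n \<in> events" for n using finite_cube by measurable
  have Em: "?E w n x \<in> events" for w n x unfolding clip_def by measurable
  have E1m: "?E ?w1 n x \<in> events" and E2m: "?E ?w2 n x \<in> events" for n x by (rule Em)+
  have Am: "?A n \<in> events" for n by (intro sets.Un sets.finite_UN A1m E1m E2m finite_cube)
  \<comment> \<open>Spends half of the exponent \<open>\<delta> * \<alpha>\<close> gained by raising
    the truncation level.\<close>
  define \<epsilon> where "\<epsilon> = \<delta> * \<alpha> / (2 * (\<gamma> + \<delta>))"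
  have \<epsilon>: "0 < \<epsilon>" "\<epsilon> < \<alpha>" using \<delta> \<gamma> \<alpha>1 by (auto simp: \<epsilon>_def field_simps add_strict_increasing2)
  have limZ: "filterlim Z at_top at_top" unfolding Z_def using \<delta> \<gamma> by real_asymp
  let ?D = "real CARD('d)"
  have small: "eventually (\<lambda>n::real. n powr (\<delta> / 2) * (3 * ?D * n powr (- (\<kappa> * (1 - p + 4 * \<delta>))) * (1 + ln (2 * n))) * Z n \<le> 1) at_top"
  proof -
    have "eventually (\<lambda>n::real. 3 * ?D * (1 + ln (2 * n)) * n powr (- (\<delta> / 2)) \<le> 1) at_top"
      using \<delta> by real_asymp
    then show ?thesis using eventually_ge_at_top[of 1]
    proof eventually_elim
      case (elim n)
      have "n powr (\<delta> / 2) * (3 * ?D * n powr (- (\<kappa> * (1 - p + 4 * \<delta>))) * (1 + ln (2 * n))) * Z n =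
        3 * ?D * (1 + ln (2 * n)) * n powr (\<delta> / 2 - \<kappa> * (1 - p + 4 * \<delta>) + (\<gamma> + \<delta>))"
      proof -
        have e: "\<delta> / 2 - \<kappa> * (1 - p + 4 * \<delta>) + (\<gamma> + \<delta>) = \<delta> / 2 + - (\<kappa> * (1 - p + 4 * \<delta>)) + (\<gamma> + \<delta>)"
          by simp
        show ?thesis unfolding e Z_def powr_add by (simp only: mult_ac)
      qed
      also have "n powr (\<delta> / 2 - \<kappa> * (1 - p + 4 * \<delta>) + (\<gamma> + \<delta>)) \<le> n powr (- (\<delta> / 2))"
      proof (rule powr_mono)
        \<comment> \<open>The terms in \<open>\<gamma>\<close> cancel, and what is left is at most
          \<open>\<delta> / 2 - 2 * \<delta> + \<delta> = - \<delta> / 2\<close>.\<close>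
        have "(1 / 2) * \<delta> \<le> \<kappa> * \<delta>" using \<kappa> \<delta> by (intro mult_right_mono) auto
        then show "\<delta> / 2 - \<kappa> * (1 - p + 4 * \<delta>) + (\<gamma> + \<delta>) \<le> - (\<delta> / 2)"
          by (simp add: \<gamma>_def algebra_simps)
      qed (use elim in auto)
      then have "3 * ?D * (1 + ln (2 * n)) * n powr (\<delta> / 2 - \<kappa> * (1 - p + 4 * \<delta>) + (\<gamma> + \<delta>)) \<le>
          3 * ?D * (1 + ln (2 * n)) * n powr (- (\<delta> / 2))"
        using elim by (intro mult_left_mono) auto
      finally show ?case using elim by linarith
    qed
  qed
  define g where "g = \<rho> * (b - exp \<rho> * mean)"
  have g: "0 < g" using \<rho> by (simp add: g_def)
  have decay2: "eventually (\<lambda>n::real. (7 * n) powr ?D * (2 * exp (- (g * n powr (\<delta> / 2)))) \<le> n powr (- 1)) at_top"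
    using g \<delta> by real_asymp
  have "eventually (\<lambda>n. prob (?A n) \<le> (3 ^ CARD('d) + 1) * n powr (- min (\<delta> * \<alpha> / 2) 1)) at_top"
    using small decay2 eventually_compose_filterlim[OF tail_bounds[OF \<epsilon>] limZ] eventually_ge_at_top[of 1]
  proof eventually_elim
    case (elim n)
    have n: "1 \<le> n" by fact
    note Rn = R_bounds[OF n] and Tn = T_bounds[OF n \<delta>]
    have "prob (?A1 n) \<le> real (card (cube (R n) :: (int ^ 'd) set)) * tail (Z n)"
      by (rule prob_ex_greater[OF finite_cube])
    also have "\<dots> \<le> (3 * n powr \<beta>) ^ CARD('d) * Z n powr (- (\<alpha> - \<epsilon>))"
    proof (rule mult_mono)
      have "real (card (cube (R n) :: (int ^ 'd) set)) = (2 * real (R n) + 1) ^ CARD('d)"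
        by (simp add: card_cube add.commute)
      also have "\<dots> \<le> (3 * n powr \<beta>) ^ CARD('d)" using Rn by (intro power_mono) auto
      finally show "real (card (cube (R n) :: (int ^ 'd) set)) \<le> (3 * n powr \<beta>) ^ CARD('d)" .
    qed (use elim tail_nonneg in auto)
    also have "\<dots> = 3 ^ CARD('d) * n powr (\<beta> * ?D - (\<gamma> + \<delta>) * (\<alpha> - \<epsilon>))"
      using n by (simp add: Z_def power_mult_distrib powr_powr powr_realpow[symmetric] powr_add[symmetric] algebra_simps)
    also have "\<beta> * ?D - (\<gamma> + \<delta>) * (\<alpha> - \<epsilon>) = - (\<delta> * \<alpha> / 2)"
    proof -
      have "s * (\<delta> * \<alpha> / (2 * s)) = \<delta> * \<alpha> / 2" if "0 < s" for s using that by (simp add: field_simps)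
      from this[of "\<gamma> + \<delta>"] have "(\<gamma> + \<delta>) * \<epsilon> = \<delta> * \<alpha> / 2" using \<gamma> \<delta> by (simp only: \<epsilon>_def)
      then show ?thesis unfolding \<beta>\<gamma> by (simp add: algebra_simps)
    qed
    finally have P1: "prob (?A1 n) \<le> 3 ^ CARD('d) * n powr (- (\<delta> * \<alpha> / 2))" .
    have wmax: "3 * ?D * real (T \<delta> n) powr (- \<kappa>) * (1 + ln (real (T \<delta> n))) \<le>
        3 * ?D * n powr (- (\<kappa> * (1 - p + 4 * \<delta>))) * (1 + ln (2 * n))"
    proof -
      have "real (T \<delta> n) powr (- \<kappa>) \<le> (n powr (1 - p + 4 * \<delta>)) powr (- \<kappa>)"
        using Tn n \<kappa> by (intro powr_mono2') auto
      also have "\<dots> = n powr (- (\<kappa> * (1 - p + 4 * \<delta>)))" by (simp add: powr_powr algebra_simps)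
      finally show ?thesis using Tn by (intro mult_mono) auto
    qed
    have lw: "l n * w * Z n \<le> \<rho>"
      if "w \<le> 3 * ?D * real (T \<delta> n) powr (- \<kappa>) * (1 + ln (real (T \<delta> n)))" for w
    proof -
      have "l n * w * Z n \<le> l n * (3 * ?D * n powr (- (\<kappa> * (1 - p + 4 * \<delta>))) * (1 + ln (2 * n))) * Z n"
        using order_trans[OF that wmax] \<rho> by (intro mult_right_mono mult_left_mono) (simp_all add: l_def Z_def)
      also have "\<dots> = \<rho> * (n powr (\<delta> / 2) * (3 * ?D * n powr (- (\<kappa> * (1 - p + 4 * \<delta>))) * (1 + ln (2 * n))) * Z n)"
        by (simp add: l_def)
      also have "\<dots> \<le> \<rho> * 1" using elim \<rho> by (intro mult_left_mono) auto
      finally show ?thesis by simp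
    qed
    have T1: "1 \<le> real (T \<delta> n)" using Tn by simp
    have w1: "?w1 n x y \<le> 3 * ?D * real (T \<delta> n) powr (- \<kappa>) * (1 + ln (real (T \<delta> n)))" for x y
    proof -
      have "?w1 n x y \<le> 3 * ?D * (real (T \<delta> n) + 1) powr (- \<kappa>)" by (rule heat_upper)
      also have "\<dots> \<le> 3 * ?D * real (T \<delta> n) powr (- \<kappa>)"
        using T1 \<kappa> by (intro mult_left_mono powr_mono2') auto
      also have "\<dots> \<le> 3 * ?D * real (T \<delta> n) powr (- \<kappa>) * (1 + ln (real (T \<delta> n)))"
        using T1 mult_left_mono[of 1 "1 + ln (real (T \<delta> n))" "3 * ?D * real (T \<delta> n) powr (- \<kappa>)"] by simp
      finally show ?thesis .
    qed
    have w2: "?w2 n x y \<le> 3 * ?D * real (T \<delta> n) powr (- \<kappa>) * (1 + ln (real (T \<delta> n)))" for x y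
    proof -
      have "?w2 n x y \<le> 3 * ?D * real (T \<delta> n) powr (1 - \<kappa>) * (1 + ln (real (T \<delta> n))) / real (T \<delta> n)"
        using Tn by (intro divide_right_mono green_upper) auto
      also have "real (T \<delta> n) powr (1 - \<kappa>) = real (T \<delta> n) * real (T \<delta> n) powr (- \<kappa>)"
        using T1 by (simp add: powr_diff powr_minus_divide)
      finally show ?thesis using T1 by simp
    qed
    have bound: "prob (?E ?w1 n x \<union> ?E ?w2 n x) \<le> 2 * exp (- (g * n powr (\<delta> / 2)))" for x
    proof -
      have eq: "l n * (b - exp \<rho> * mean) = g * n powr (\<delta> / 2)" by (simp add: l_def g_def)
      have "prob (?E ?w1 n x) \<le> exp (- (l n * (b - exp \<rho> * mean)))"
        using \<rho> lw[OF w1] by (intro weighted_sum_chernoff finite_cube heat_nonneg heat_sum_le) (auto simp: Z_def l_def)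
      moreover have "prob (?E ?w2 n x) \<le> exp (- (l n * (b - exp \<rho> * mean)))"
      proof (rule weighted_sum_chernoff)
        show "(\<Sum>y\<in>cube (R n). ?w2 n x y) \<le> 1"
          using green_sum_le[OF finite_cube, of "T \<delta> n" x "R n"] T1 by (simp add: sum_divide_distrib[symmetric])
        show "l n * ?w2 n x y * Z n \<le> \<rho>" for y by (rule lw[OF w2])
      qed (use \<rho> finite_cube in \<open>auto simp: Z_def l_def green_nonneg intro!: divide_nonneg_nonneg\<close>)
      ultimately show ?thesis
        unfolding eq using measure_Un_le[OF Em[of ?w1 n x] Em[of ?w2 n x]] by linarith
    qed
    have "prob (\<Union>x\<in>cube (R n + T \<delta> n). ?E ?w1 n x \<union> ?E ?w2 n x) \<le>
        (\<Sum>x\<in>(cube (R n + T \<delta> n) :: (int ^ 'd) set). prob (?E ?w1 n x \<union> ?E ?w2 n x))"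
      by (intro finite_measure_subadditive_finite finite_cube image_subsetI sets.Un E1m E2m)
    also have "\<dots> \<le> real (card (cube (R n + T \<delta> n) :: (int ^ 'd) set)) * (2 * exp (- (g * n powr (\<delta> / 2))))"
      by (intro sum_bounded_above bound)
    also have "\<dots> \<le> (7 * n) powr ?D * (2 * exp (- (g * n powr (\<delta> / 2))))"
    proof (rule mult_right_mono)
      have "real (card (cube (R n + T \<delta> n) :: (int ^ 'd) set)) = (2 * (real (R n) + real (T \<delta> n)) + 1) ^ CARD('d)"
        by (simp add: card_cube add.commute)
      also have "\<dots> \<le> (7 * n) ^ CARD('d)" using Rn Tn n by (intro power_mono) auto
      also have "\<dots> = (7 * n) powr ?D" using n by (simp add: powr_realpow)
      finally show "real (card (cube (R n + T \<delta> n) :: (int ^ 'd) set)) \<le> (7 * n) powr ?D" .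
    qed auto
    also have "\<dots> \<le> n powr (- 1)" by fact
    finally have P2: "prob (\<Union>x\<in>cube (R n + T \<delta> n). ?E ?w1 n x \<union> ?E ?w2 n x) \<le> n powr (- 1)" .
    have "prob (?A n) \<le> prob (?A1 n) + prob (\<Union>x\<in>cube (R n + T \<delta> n). ?E ?w1 n x \<union> ?E ?w2 n x)"
      by (intro measure_Un_le sets.finite_UN sets.Un A1m E1m E2m finite_cube)
    also have "\<dots> \<le> 3 ^ CARD('d) * n powr (- (\<delta> * \<alpha> / 2)) + 1 * n powr (- 1)" using P1 P2 by simp
    also have "\<dots> \<le> 3 ^ CARD('d) * n powr (- min (\<delta> * \<alpha> / 2) 1) + 1 * n powr (- min (\<delta> * \<alpha> / 2) 1)"
      using n by (intro add_mono mult_left_mono powr_mono) auto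
    finally show ?case by (simp add: algebra_simps)
  qed
  then have "AE \<omega> in M. eventually (\<lambda>k. \<omega> \<notin> ?A (2 ^ k)) sequentially"
    using \<delta> \<alpha>1 by (intro dyadic_borel_cantelli[OF Am]) auto
  moreover have "AE \<omega> in M. \<forall>y. 0 \<le> z y \<omega>" using nonneg by (simp add: AE_all_countable)
  ultimately show ?thesis using AE_space
  proof eventually_elim
    case (elim \<omega>)
    have \<omega>: "\<omega> \<in> space M" and z0: "\<And>y. 0 \<le> z y \<omega>" using elim by auto
    from elim(1) show ?case
    proof eventually_elim
      case (elim k)
      define n where "n = (2::real) ^ k"
      have n: "1 \<le> n" by (simp add: n_def)
      have nA: "\<omega> \<notin> ?A n" using elim by (simp add: n_def)
      have T1: "1 \<le> real (T \<delta> n)" using T_bounds[OF n \<delta>] by simp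
      have cl: "clip (Z n) (z y \<omega>) = z y \<omega>" if "y \<in> cube (R n)" for y
        using nA \<omega> that z0[of y] by (auto simp: clip_def not_less)
      have "(\<Sum>y\<in>cube (R n). heat (T \<delta> n) (x - y) * z y \<omega>) \<le> b \<and>
        (\<Sum>y\<in>cube (R n). green (T \<delta> n) (x - y) * z y \<omega>) \<le> b * real (T \<delta> n)" for x
      proof (cases "x \<in> cube (R n + T \<delta> n)")
        case True
        then have "\<omega> \<notin> ?E ?w1 n x" "\<omega> \<notin> ?E ?w2 n x" using nA by auto
        then have "(\<Sum>y\<in>cube (R n). ?w1 n x y * clip (Z n) (z y \<omega>)) \<le> b" "(\<Sum>y\<in>cube (R n). ?w2 n x y * clip (Z n) (z y \<omega>)) \<le> b"
          using \<omega> by auto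
        then have "(\<Sum>y\<in>cube (R n). ?w1 n x y * z y \<omega>) \<le> b" "(\<Sum>y\<in>cube (R n). ?w2 n x y * z y \<omega>) \<le> b"
          by (simp_all add: cl)
        moreover have "(\<Sum>y\<in>cube (R n). ?w2 n x y * z y \<omega>) = (\<Sum>y\<in>cube (R n). green (T \<delta> n) (x - y) * z y \<omega>) / real (T \<delta> n)"
          by (simp add: sum_divide_distrib)
        ultimately show ?thesis using T1 by (simp add: divide_le_eq)
      next
        case False
        \<comment> \<open>From such an \<open>x\<close> every site of \<open>cube (R n)\<close> is
          out of range of both kernels, and both sums vanish.\<close>
        have far: "\<exists>i. int (T \<delta> n) < \<bar>(x - y) $ i\<bar>" if y: "y \<in> cube (R n)" for y
        proof -
          obtain i where i: "int (R n + T \<delta> n) < \<bar>x $ i\<bar>" using False by (auto simp: cube_def not_le)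
          moreover have "\<bar>y $ i\<bar> \<le> int (R n)" using y by (simp add: cube_def)
          ultimately show ?thesis by (intro exI[of _ i]) auto
        qed
        have "heat (T \<delta> n) (x - y) = 0" "green (T \<delta> n) (x - y) = 0" if "y \<in> cube (R n)" for y
          using far[OF that] heat_support[of "T \<delta> n" "x - y"] green_support[of "T \<delta> n" "x - y"] by (meson not_le)+
        then show ?thesis using b0 by simp
      qed
      then show ?case by (simp add: n_def)
    qed
  qed
qed

end

section \<open>Asymptotics\<close>

text \<open>The scenery is controlled only at \<open>n = 2 ^ k\<close>, while \<open>t\<close> is
  continuous. The blocks from \<open>n / 2\<close> to \<open>n\<close> cover all large
  \<open>t\<close>, and within a block powers of \<open>t\<close> change by constant
  factors.\<close>

lemma eventually_at_top_dyadic: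
  assumes "eventually (\<lambda>k. \<forall>t. 2 ^ k / 2 < t \<longrightarrow> t \<le> 2 ^ k \<longrightarrow> P t) sequentially"
  shows "eventually P (at_top :: real filter)"
proof -
  obtain k\<^sub>0 where k: "\<And>k t. k \<ge> k\<^sub>0 \<Longrightarrow> 2 ^ k / 2 < t \<Longrightarrow> t \<le> 2 ^ k \<Longrightarrow> P t"
    using assms by (auto simp: eventually_sequentially)
  have "P t" if t: "2 ^ k\<^sub>0 < t" for t
  proof -
    obtain m where m: "t \<le> 2 ^ m" using real_arch_pow[of 2 t] by (auto intro: less_imp_le)
    define k where "k = (LEAST m. t \<le> 2 ^ m)"
    have k1: "t \<le> 2 ^ k" unfolding k_def by (rule LeastI[of "\<lambda>m. t \<le> 2 ^ m", OF m])
    have "\<not> k \<le> k\<^sub>0"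
    proof
      assume "k \<le> k\<^sub>0"
      then have "(2::real) ^ k \<le> 2 ^ k\<^sub>0" by (intro power_increasing) auto
      then show False using k1 t by linarith
    qed
    then obtain j where j: "k = Suc j" "k \<ge> k\<^sub>0" by (cases k) auto
    have "\<not> t \<le> 2 ^ j" using not_less_Least[of j "\<lambda>m. t \<le> 2 ^ m"] j by (simp add: k_def)
    then have "2 ^ k / 2 < t" using j by simp
    then show ?thesis using k[OF j(2)] k1 by blast
  qed
  then show ?thesis by (rule eventually_mono[OF eventually_gt_at_top])
qed

lemma eventually_dyadic:
  assumes "eventually P (at_top :: real filter)"
  shows "eventually (\<lambda>k. P (2 ^ k)) sequentially"
proof -
  have "filterlim (\<lambda>k. (2::real) ^ k) at_top sequentially" by real_asymp
  from eventually_compose_filterlim[OF assms this] show ?thesis .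
qed

section \<open>Tail probabilities for all large times\<close>

context walk
begin

lemma upper_asymptotic:
  assumes p: "0 < p" "p < 1" and \<delta>: "0 < \<delta>" "7 * \<delta> < p" and b: "0 \<le> b" "b < c" and \<zeta>: "\<And>y. 0 \<le> \<zeta> y"
    and R: "\<And>n. 1 \<le> n \<Longrightarrow> n powr ((1 + p) / 2) \<le> 2 * real (R n)"
    and T: "\<And>n. 1 \<le> n \<Longrightarrow> real (T n) \<le> 2 * n powr (1 - p + 4 * \<delta>)"
    and env: "eventually (\<lambda>k. \<forall>x. (\<Sum>y\<in>cube (R (2 ^ k)). heat (T (2 ^ k)) (x - y) * \<zeta> y) \<le> b \<and>
      (\<Sum>y\<in>cube (R (2 ^ k)). green (T (2 ^ k)) (x - y) * \<zeta> y) \<le> b * real (T (2 ^ k))) sequentially"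
  shows "eventually (\<lambda>t. prob {\<eta> \<in> space N. scenery_integral \<zeta> (\<lambda>u. S u \<eta>) t \<ge> c * t}
      \<le> exp (- (t powr (p - 7 * \<delta>)))) at_top"
proof (rule eventually_at_top_dyadic)
  \<comment> \<open>Makes \<open>(1 + a) * b\<close> at most the midpoint of \<open>b\<close> and
    \<open>c\<close>; the \<open>+ 1\<close> covers \<open>b = 0\<close>.\<close>
  define a where "a = (c - b) / (2 * (b + 1))"
  have a: "0 < a" using b by (simp add: a_def)
  define h where "h = c - (1 + a) * b"
  have h: "0 < h"
  proof -
    have "a * b \<le> a * (b + 1)" using a by (intro mult_left_mono) auto
    also have "\<dots> = (c - b) / 2" using b by (simp add: a_def field_simps)
    finally show ?thesis using b by (simp add: h_def algebra_simps)
  qed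
  \<comment> \<open>The Chebyshev term has exponent \<open>q'\<close>; the further
    \<open>\<delta>\<close> in \<open>q\<close> absorbs all constants.\<close>
  define q where "q = p - 7 * \<delta>"
  define q' where "q' = p - 6 * \<delta>"
  have q: "0 < q" "q < q'" "q < p" using \<delta> by (auto simp: q_def q'_def)
  define C where "C = 2 * real CARD('d) + 1"
  have C: "0 < C" by (simp add: C_def)
  have e1: "eventually (\<lambda>n::real. (1 + a) * (b * 2) * n powr (- (2 * \<delta>)) \<le> a) at_top"
  proof -
    have "((\<lambda>n::real. (1 + a) * (b * 2) * n powr (- (2 * \<delta>))) \<longlongrightarrow> (1 + a) * (b * 2) * 0) at_top"
      by (intro tendsto_intros) (use \<delta> in real_asymp)
    from order_tendstoD(2)[OF this, of a] show ?thesis using a by (auto elim: eventually_mono)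
  qed
  have e2: "eventually (\<lambda>n::real. C * exp (- (n powr p / 16)) \<le> exp (- (n powr q)) / 2) at_top"
    using q C p by real_asymp
  have e3: "eventually (\<lambda>n::real. (1 + a) * exp (- (h / 2 * n powr q')) \<le> exp (- (n powr q)) / 2) at_top"
    using q h a by real_asymp
  show "eventually (\<lambda>k. \<forall>t. 2 ^ k / 2 < t \<longrightarrow> t \<le> 2 ^ k \<longrightarrow>
      prob {\<eta> \<in> space N. scenery_integral \<zeta> (\<lambda>u. S u \<eta>) t \<ge> c * t} \<le> exp (- (t powr (p - 7 * \<delta>)))) sequentially"
    using env eventually_dyadic[OF e1] eventually_dyadic[OF e2] eventually_dyadic[OF e3]
  proof eventually_elim
    case (elim k)
    define n where "n = (2::real) ^ k"
    have n: "1 \<le> n" by (simp add: n_def)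
    note elim = elim[folded n_def]
    \<comment> \<open>\<open>\<theta> * T\<close> is at most of order
      \<open>n powr (- 2 * \<delta>)\<close>, as the corrector demands, while
      \<open>\<theta> * t\<close> is still of order
      \<open>n powr (p - 6 * \<delta>)\<close>.\<close>
    define \<theta> where "\<theta> = n powr (- (1 - p + 6 * \<delta>))"
    \<comment> \<open>Of order \<open>R / n\<close>, where \<open>s^2 * t - s * R\<close> is
      smallest up to constants. With the factor 1/4 the first term is at most
      \<open>n powr p / 16\<close> and the second at least \<open>n powr p / 8\<close>.\<close>
    define s where "s = n powr ((p - 1) / 2) / 4"
    have s: "0 < s" "s \<le> 1"
    proof -
      have "n powr ((p - 1) / 2) \<le> n powr 0" using n p by (intro powr_mono) auto
      then show "s \<le> 1" using n by (simp add: s_def)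
    qed (use n in \<open>simp add: s_def\<close>)
    have \<theta>: "0 < \<theta>" using n by (simp add: \<theta>_def)
    have G: "(1 + a) * \<theta> * (\<Sum>y\<in>cube (R n). green (T n) (x - y) * \<zeta> y) \<le> a" for x
    proof -
      have "(\<Sum>y\<in>cube (R n). green (T n) (x - y) * \<zeta> y) \<le> b * real (T n)" using elim by blast
      also have "\<dots> \<le> b * (2 * n powr (1 - p + 4 * \<delta>))" using T[OF n] b by (intro mult_left_mono) auto
      finally have "(1 + a) * \<theta> * (\<Sum>y\<in>cube (R n). green (T n) (x - y) * \<zeta> y) \<le>
          (1 + a) * \<theta> * (b * (2 * n powr (1 - p + 4 * \<delta>)))"
        using a \<theta> by (intro mult_left_mono) auto
      also have "\<dots> = (1 + a) * (b * 2) * (n powr (- (1 - p + 6 * \<delta>)) * n powr (1 - p + 4 * \<delta>))"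
        by (simp add: \<theta>_def)
      also have "n powr (- (1 - p + 6 * \<delta>)) * n powr (1 - p + 4 * \<delta>) = n powr (- (2 * \<delta>))"
        by (simp add: powr_add[symmetric])
      finally show ?thesis using elim by linarith
    qed
    show ?case
    proof (intro allI impI)
      fix t :: real assume "2 ^ k / 2 < t" "t \<le> 2 ^ k"
      then have t: "n / 2 < t" "t \<le> n" by (simp_all add: n_def)
      then have t0: "0 < t" using n by linarith
      have "prob {\<eta> \<in> space N. scenery_integral \<zeta> (\<lambda>u. S u \<eta>) t \<ge> c * t} \<le>
         (2 * real CARD('d) + 1) * exp (s\<^sup>2 * t - s * real (R n)) + (1 + a) * exp (- (\<theta> * t * (c - (1 + a) * b)))"
        by (rule upper_tail[OF t0 \<zeta> s \<theta> a b(1) G]) (use elim in blast)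
      also have "\<dots> \<le> C * exp (- (n powr p / 16)) + (1 + a) * exp (- (h / 2 * n powr q'))"
        unfolding C_def
      proof (intro add_mono mult_left_mono)
        have "s\<^sup>2 * t \<le> s\<^sup>2 * n" using t by (intro mult_left_mono) auto
        also have "s\<^sup>2 * n = n powr p / 16"
        proof -
          have "n powr ((p - 1) / 2) * n powr ((p - 1) / 2) * n powr 1 = n powr p"
            by (simp only: powr_add[symmetric]) simp
          then show ?thesis using n by (simp add: s_def power2_eq_square)
        qed
        moreover have "n powr p / 8 \<le> s * real (R n)"
        proof -
          have "n powr ((p - 1) / 2) * n powr ((1 + p) / 2) = n powr p"
            by (simp only: powr_add[symmetric]) (simp add: add_divide_distrib diff_divide_distrib)
          then have "n powr p / 8 = s * (n powr ((1 + p) / 2) / 2)" by (simp add: s_def)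
          also have "\<dots> \<le> s * real (R n)" using R[OF n] s by (intro mult_left_mono) auto
          finally show ?thesis .
        qed
        ultimately have "s\<^sup>2 * t - s * real (R n) \<le> - (n powr p / 16)" by linarith
        then show "exp (s\<^sup>2 * t - s * real (R n)) \<le> exp (- (n powr p / 16))" by simp
        have "h / 2 * n powr q' = \<theta> * (n / 2) * h"
        proof -
          have "\<theta> * n powr 1 = n powr q'"
            unfolding \<theta>_def by (simp only: powr_add[symmetric]) (simp add: q'_def)
          then show ?thesis using n by (simp add: mult_ac)
        qed
        also have "\<dots> \<le> \<theta> * t * h" using t \<theta> h by (intro mult_right_mono mult_left_mono) auto
        finally show "exp (- (\<theta> * t * (c - (1 + a) * b))) \<le> exp (- (h / 2 * n powr q'))"
          by (simp add: h_def)
      qed (use a in auto)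
      also have "\<dots> \<le> exp (- (n powr q))" using elim by linarith
      also have "\<dots> \<le> exp (- (t powr q))"
        using t t0 q by (simp add: powr_mono2)
      finally show "prob {\<eta> \<in> space N. scenery_integral \<zeta> (\<lambda>u. S u \<eta>) t \<ge> c * t} \<le> exp (- (t powr (p - 7 * \<delta>)))"
        by (simp add: q_def)
    qed
  qed
qed

text \<open>The Gaussian cost, distance squared over time, is of order \<open>n powr p\<close> here:
  the journey to any site of the cube has the same exponent as leaving the cube.\<close>

lemma heat_kernel_lower_diffusive:
  assumes n: "1 \<le> n" and a: "n / 4 \<le> a" "a \<le> n" and p: "0 < p" "p < 1"
    and x: "\<And>i. \<bar>real_of_int (x $ i)\<bar> \<le> n powr ((1 + p) / 2)"
  shows "exp (- (2 * real CARD('d) * (32 * real CARD('d) * n powr p + 1 + ln (3 * n)))) \<le> pmf (K a 0) x"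
proof -
  let ?D = "real CARD('d)"
  have D: "1 \<le> ?D" by (simp add: Suc_le_eq)
  define r where "r = n powr ((1 + p) / 2)"
  have r1: "1 \<le> r" using n p unfolding r_def by (intro ge_one_powr_ge_zero) auto
  have rn: "r \<le> n" using powr_mono[of "(1 + p) / 2" 1 n] n p by (simp add: r_def)
  have a0: "0 < a" using n a by linarith
  define v where "v = a / (2 * ?D)"
  have v0: "0 < v" using a0 by (simp add: v_def)
  have v1: "n / (8 * ?D) \<le> v" using a D by (simp add: v_def field_simps)
  have v2: "v \<le> n"
  proof -
    have "a * 1 \<le> a * (2 * ?D)" using D a0 by (intro mult_left_mono) linarith+
    then have "v \<le> a" using D by (simp add: v_def divide_le_eq)
    then show ?thesis using a by simp
  qed
  have "(r + 1)\<^sup>2 \<le> (2 * r)\<^sup>2" using r1 by (intro power_mono) auto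
  also have "(2 * r)\<^sup>2 = 4 * (n powr p * n)"
  proof -
    have "n powr ((1 + p) / 2) * n powr ((1 + p) / 2) = n powr p * n powr 1"
      by (simp only: powr_add[symmetric]) (simp add: add.commute)
    then show ?thesis using n by (simp add: r_def power2_eq_square)
  qed
  finally have "(r + 1)\<^sup>2 / v \<le> 4 * (n powr p * n) / (n / (8 * ?D))"
    using v1 v0 n D by (intro frac_le) auto
  also have "\<dots> = 32 * ?D * n powr p" using n D by simp
  finally have e: "(r + 1)\<^sup>2 / v \<le> 32 * ?D * n powr p" .
  have "exp (- (32 * ?D * n powr p + 1 + ln (3 * n))) = exp (- (32 * ?D * n powr p) - 1) / (3 * n)"
    using n by (simp add: exp_diff exp_minus exp_add field_simps)
  also have "\<dots> \<le> exp (- ((r + 1)\<^sup>2 / v) - 1) / (v + r + 1)"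
    using e v0 v2 rn r1 n by (intro frac_le) auto
  finally have "exp (- (32 * ?D * n powr p + 1 + ln (3 * n))) ^ (2 * CARD('d)) \<le>
      (exp (- ((r + 1)\<^sup>2 / v) - 1) / (v + r + 1)) ^ (2 * CARD('d))"
    by (intro power_mono) auto
  also have "\<dots> \<le> pmf (K a 0) x"
    unfolding v_def by (rule heat_kernel_lower[OF a0]) (use x in \<open>simp add: r_def\<close>)
  also have "exp (- (32 * ?D * n powr p + 1 + ln (3 * n))) ^ (2 * CARD('d)) =
      exp (- (2 * ?D * (32 * ?D * n powr p + 1 + ln (3 * n))))"
    by (simp only: exp_of_nat_mult[symmetric]) (simp add: algebra_simps)
  finally show ?thesis .
qed

lemma lower_asymptotic_general:
  assumes p: "0 < p" and \<delta>: "0 < \<delta>" "p + 2 * \<delta> < 1" and c: "0 < c" and \<zeta>: "\<And>y. 0 \<le> \<zeta> y"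
    and R: "\<And>n. 1 \<le> n \<Longrightarrow> real (R n) \<le> n powr ((1 + p) / 2)"
    and env: "eventually (\<lambda>k. \<exists>x\<in>cube (R (2 ^ k)). (2 ^ k) powr (1 - p - \<delta>) < \<zeta> x) sequentially"
  shows "eventually (\<lambda>t. exp (- (t powr (p + 2 * \<delta>))) \<le>
      prob {\<eta> \<in> space N. scenery_integral \<zeta> (\<lambda>u. S u \<eta>) t \<ge> c * t}) at_top"
proof (rule eventually_at_top_dyadic)
  let ?D = "real CARD('d)"
  define D where "D = ?D"
  have D: "0 < D" by (simp add: D_def)
  define q where "q = p + 2 * \<delta>"
  define q' where "q' = p + \<delta>"
  have q: "0 < p" "p < q'" "q' < q" "q < 1" "0 < q'" "0 < q" using p \<delta> by (auto simp: q_def q'_def)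
  have e1: "eventually (\<lambda>n::real. 2 * c * n powr q' + 1 \<le> n / 4) at_top"
    using q c by real_asymp
  have e2: "eventually (\<lambda>n::real. 2 * D * (32 * D * n powr p + 1 + ln (3 * n)) + 2 * (2 * c * n powr q' + 1) + ln 4 \<le> (n / 2) powr q) at_top"
    using q c D by real_asymp
  show "eventually (\<lambda>k. \<forall>t. 2 ^ k / 2 < t \<longrightarrow> t \<le> 2 ^ k \<longrightarrow> exp (- (t powr (p + 2 * \<delta>))) \<le>
      prob {\<eta> \<in> space N. scenery_integral \<zeta> (\<lambda>u. S u \<eta>) t \<ge> c * t}) sequentially"
    using env eventually_dyadic[OF e1] eventually_dyadic[OF e2]
  proof eventually_elim
    case (elim k)
    define n where "n = (2::real) ^ k"
    have n: "1 \<le> n" by (simp add: n_def)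
    note elim = elim[folded n_def]
    obtain x where x: "x \<in> cube (R n)" "n powr (1 - p - \<delta>) < \<zeta> x" using elim(1) by blast
    \<comment> \<open>At a site above \<open>n powr (1 - p - \<delta>)\<close>, local time
      \<open>c * n powr q'\<close> collects \<open>c * n\<close>. The factor 2 undoes the fraction
      in \<open>(T - ln 2) / 2\<close>, and the 1 covers \<open>ln 2\<close>.\<close>
    define T where "T = 2 * c * n powr q' + 1"
    have T0: "0 < T" using c by (simp add: T_def add_nonneg_pos)
    show ?case
    proof (intro allI impI)
      fix t :: real assume "2 ^ k / 2 < t" "t \<le> 2 ^ k"
      then have t: "n / 2 < t" "t \<le> n" by (simp_all add: n_def)
      have Tn: "T \<le> n / 4" using elim by (simp add: T_def)
      define a where "a = t - T"
      have a: "n / 4 \<le> a" "a \<le> n" "a + T = t" "0 \<le> a" using t Tn T0 n by (auto simp: a_def)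
      have xr: "\<bar>real_of_int (x $ i)\<bar> \<le> n powr ((1 + p) / 2)" for i
      proof -
        have "\<bar>x $ i\<bar> \<le> int (R n)" using x by (simp add: cube_def)
        then have "\<bar>real_of_int (x $ i)\<bar> \<le> real (R n)" by linarith
        then show ?thesis using R[OF n] by linarith
      qed
      have "c * t \<le> c * (n powr (1 - p - \<delta>) * n powr q')"
      proof -
        have "n powr (1 - p - \<delta>) * n powr q' = n" using n by (simp add: powr_add[symmetric] q'_def)
        then show ?thesis using t c by simp
      qed
      also have "\<dots> = n powr (1 - p - \<delta>) * (c * n powr q')" by simp
      also have "\<dots> \<le> \<zeta> x * ((T - ln 2) / 2)"
      proof (rule mult_mono)
        have "ln 2 \<le> (1::real)" using ln_le_minus_one[of 2] by simp
        then show "c * n powr q' \<le> (T - ln 2) / 2" by (simp add: T_def)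
      qed (use x \<zeta> c in auto)
      finally have "c * (a + T) \<le> \<zeta> x * ((T - ln 2) / 2)" by (simp only: a(3))
      then have "pmf (K a 0) x * exp (- 2 * T) / 4 \<le>
         prob {\<eta> \<in> space N. scenery_integral \<zeta> (\<lambda>u. S u \<eta>) (a + T) \<ge> c * (a + T)}"
        by (rule lower_tail_general[where \<zeta>=\<zeta> and x=x, rotated -1]) (use a T0 \<zeta> in simp_all)
      then have "pmf (K a 0) x * exp (- 2 * T) / 4 \<le>
         prob {\<eta> \<in> space N. scenery_integral \<zeta> (\<lambda>u. S u \<eta>) t \<ge> c * t}"
        by (simp only: a(3))
      moreover have "exp (- (t powr q)) \<le> pmf (K a 0) x * exp (- 2 * T) / 4"
      proof -
        have "(n / 2) powr q \<le> t powr q" using t n q by (intro powr_mono2) auto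
        then have "2 * D * (32 * D * n powr p + 1 + ln (3 * n)) + 2 * T + ln 4 \<le> t powr q"
          using elim by (simp add: T_def)
        then have "exp (- (t powr q)) \<le> exp (- (2 * D * (32 * D * n powr p + 1 + ln (3 * n))) - 2 * T - ln 4)"
          by simp
        also have "\<dots> = exp (- (2 * D * (32 * D * n powr p + 1 + ln (3 * n)))) * exp (- 2 * T) / 4"
        proof -
          have "exp (- X - 2 * T - ln 4) = exp (- X) * exp (- 2 * T) / 4" for X :: real
          proof -
            have "exp (- X - 2 * T - ln 4) = exp (- X + - 2 * T) / exp (ln 4)"
              by (simp only: exp_diff[symmetric]) simp
            then show ?thesis by (simp only: exp_add) simp
          qed
          then show ?thesis .
        qed
        also have "\<dots> \<le> pmf (K a 0) x * exp (- 2 * T) / 4"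
          using heat_kernel_lower_diffusive[OF n a(1,2) p _ xr] \<delta> p
          by (intro divide_right_mono mult_right_mono) (auto simp: D_def)
        finally show ?thesis .
      qed
      ultimately show "exp (- (t powr (p + 2 * \<delta>))) \<le>
          prob {\<eta> \<in> space N. scenery_integral \<zeta> (\<lambda>u. S u \<eta>) t \<ge> c * t}" by (simp add: q_def)
    qed
  qed
qed

lemma lower_asymptotic_one_dim:
  assumes d: "CARD('d) = 1" and p: "0 < p" and \<delta>: "0 < \<delta>" "p + 3 * \<delta> < 1" and c: "0 < c" and \<zeta>: "\<And>y. 0 \<le> \<zeta> y"
    and R: "\<And>n. 1 \<le> n \<Longrightarrow> real (R n) \<le> n powr ((1 + p) / 2)"
    and env: "eventually (\<lambda>k. \<exists>x\<in>cube (R (2 ^ k)). (2 ^ k) powr ((1 - p) / 2 - \<delta>) < \<zeta> x) sequentially"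
  shows "eventually (\<lambda>t. exp (- (t powr (p + 3 * \<delta>))) \<le>
      prob {\<eta> \<in> space N. scenery_integral \<zeta> (\<lambda>u. S u \<eta>) t \<ge> c * t}) at_top"
proof (rule eventually_at_top_dyadic)
  \<comment> \<open>With \<open>u = A * n powr (- g)\<close> and a stay of at least
    \<open>n / 4\<close> the main term collects \<open>A * n / 16 = 2 * c * n\<close>, twice the
    required amount; the spare half absorbs the \<open>ln 2\<close> term.\<close>
  define A where "A = 32 * c"
  have A: "0 < A" using c by (simp add: A_def)
  define g where "g = (1 - p) / 2 - \<delta>"
  have g: "0 < g" "2 * g < 1" using p \<delta> by (auto simp: g_def field_simps)
  define q where "q = p + 3 * \<delta>"
  define q' where "q' = p + 2 * \<delta>"
  have q: "0 < p" "p < q'" "q' < q" "q < 1" "0 < q'" "0 < q" using p \<delta> by (auto simp: q_def q'_def)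
  define g2 where "g2 = 2 * g"
  have g2: "0 < g2" "g2 < 1" using g by (auto simp: g2_def)
  have e1: "eventually (\<lambda>n::real. n powr g2 / (2 * A) \<le> c * n) at_top"
    using g2 c A by real_asymp
  have e2: "eventually (\<lambda>n::real. 4 * A * n powr (- g) \<le> 1) at_top"
  proof -
    have "((\<lambda>n::real. 4 * A * n powr (- g)) \<longlongrightarrow> 4 * A * 0) at_top"
      by (intro tendsto_intros) (use g in real_asymp)
    from order_tendstoD(2)[OF this, of 1] show ?thesis by (auto elim: eventually_mono)
  qed
  have e3: "eventually (\<lambda>n::real. 2 * (32 * n powr p + 1 + ln (3 * n)) + 64 * A\<^sup>2 * n powr q' + ln 8 \<le> (n / 2) powr q) at_top"
    using q A by real_asymp
  show "eventually (\<lambda>k. \<forall>t. 2 ^ k / 2 < t \<longrightarrow> t \<le> 2 ^ k \<longrightarrow> exp (- (t powr (p + 3 * \<delta>))) \<le>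
      prob {\<eta> \<in> space N. scenery_integral \<zeta> (\<lambda>u. S u \<eta>) t \<ge> c * t}) sequentially"
    using env eventually_dyadic[OF e1] eventually_dyadic[OF e2] eventually_dyadic[OF e3]
  proof eventually_elim
    case (elim k)
    define n where "n = (2::real) ^ k"
    have n: "1 \<le> n" by (simp add: n_def)
    note elim = elim[folded n_def]
    obtain x where x: "x \<in> cube (R n)" "n powr g < \<zeta> x" using elim(1) by (auto simp: g_def)
    define u where "u = A * n powr (- g)"
    have u: "0 < u" "4 * u \<le> 1" using A n elim by (auto simp: u_def mult.assoc)
    \<comment> \<open>The largest integer radius with \<open>4 * u * r \<le> 1\<close>; rounding
      down loses at most a factor 2.\<close>
    define r where "r = nat \<lfloor>1 / (4 * u)\<rfloor>"
    have "1 \<le> 1 / (4 * u)" using u by simp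
    then have "1 \<le> \<lfloor>1 / (4 * u)\<rfloor>" by simp
    then have r: "real r \<le> 1 / (4 * u)" "1 / (4 * u) < real r + 1" "1 \<le> real r"
      unfolding r_def by linarith+
    have r4: "4 * u * real r \<le> 1" using r(1) u by (simp add: field_simps)
    have r8: "1 / (8 * u) \<le> real r" using r by simp
    show ?case
    proof (intro allI impI)
      fix t :: real assume "2 ^ k / 2 < t" "t \<le> 2 ^ k"
      then have t: "n / 2 < t" "t \<le> n" by (simp_all add: n_def)
      define a where "a = t / 2"
      have a: "n / 4 \<le> a" "a \<le> n" "a + a = t" "0 \<le> a" "0 < a" using t n by (auto simp: a_def)
      have xr: "\<bar>real_of_int (x $ i)\<bar> \<le> n powr ((1 + p) / 2)" for i
      proof -
        have "\<bar>x $ i\<bar> \<le> int (R n)" using x by (simp add: cube_def)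
        then have "\<bar>real_of_int (x $ i)\<bar> \<le> real (R n)" by linarith
        then show ?thesis using R[OF n] by linarith
      qed
      have lt: "c * (a + a) \<le> \<zeta> x * ((u\<^sup>2 / 2 * a - ln 2) / (2 * u))"
      proof -
        have eq: "(u\<^sup>2 / 2 * a - ln 2) / (2 * u) = u * a / 4 - ln 2 / (2 * u)"
          using u by (simp add: power2_eq_square field_simps)
        have "c * (a + a) \<le> c * n" using a t c by (intro mult_left_mono) auto
        also have "c * n \<le> 2 * c * n - n powr g2 / (2 * A)" using elim by linarith
        also have "\<dots> = n powr g * (u * (n / 4) / 4 - 1 / (2 * u))"
        proof -
          have 1: "n powr g * n powr (- g) = 1" using n by (simp add: powr_add[symmetric])
          have 2: "n powr g2 = n powr g * n powr g" by (simp add: g2_def powr_add[symmetric])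
          have 3: "1 / (2 * u) = n powr g / (2 * A)" using n by (simp add: u_def powr_minus_divide)
          have "n powr g * (u * (n / 4) / 4 - 1 / (2 * u)) = (n powr g * n powr (- g)) * (A * n / 16) - n powr g * n powr g / (2 * A)"
            unfolding 3 by (simp add: u_def algebra_simps)
          then show ?thesis unfolding 1 2[symmetric] by (simp add: A_def)
        qed
        also have "\<dots> \<le> n powr g * (u * a / 4 - ln 2 / (2 * u))"
        proof (rule mult_left_mono)
          have "u * (n / 4) \<le> u * a" using a u by (intro mult_left_mono) auto
          moreover have "ln 2 / (2 * u) \<le> 1 / (2 * u)"
            using u ln_le_minus_one[of 2] by (intro divide_right_mono) auto
          ultimately show "u * (n / 4) / 4 - 1 / (2 * u) \<le> u * a / 4 - ln 2 / (2 * u)" by linarith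
        qed simp
        finally have m: "c * (a + a) \<le> n powr g * (u * a / 4 - ln 2 / (2 * u))" .
        \<comment> \<open>The sign allows \<open>n powr g\<close> to be replaced by the larger
          \<open>\<zeta> x\<close>; it holds because the product is at least a positive
          number.\<close>
        have "0 \<le> u * a / 4 - ln 2 / (2 * u)"
        proof (rule ccontr)
          assume "\<not> 0 \<le> u * a / 4 - ln 2 / (2 * u)"
          then have "n powr g * (u * a / 4 - ln 2 / (2 * u)) \<le> 0"
            by (intro mult_nonneg_nonpos) auto
          moreover have "0 < c * (a + a)" using a c by simp
          ultimately show False using m by linarith
        qed
        then have "n powr g * (u * a / 4 - ln 2 / (2 * u)) \<le> \<zeta> x * (u * a / 4 - ln 2 / (2 * u))"
          using x by (intro mult_right_mono) auto
        then show ?thesis using m unfolding eq by linarith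
      qed
      have "pmf (K a 0) x * exp (- (a / (real r)\<^sup>2)) / 8 \<le>
         prob {\<eta> \<in> space N. scenery_integral \<zeta> (\<lambda>u. S u \<eta>) (a + a) \<ge> c * (a + a)}"
        by (rule lower_tail_one_dim[where u=u]) (use d a \<zeta> u r4 r lt in simp_all)
      then have "pmf (K a 0) x * exp (- (a / (real r)\<^sup>2)) / 8 \<le>
         prob {\<eta> \<in> space N. scenery_integral \<zeta> (\<lambda>u. S u \<eta>) t \<ge> c * t}"
        by (simp only: a(3))
      moreover have "exp (- (t powr q)) \<le> pmf (K a 0) x * exp (- (a / (real r)\<^sup>2)) / 8"
      proof -
        have "a / (real r)\<^sup>2 \<le> n / (1 / (8 * u))\<^sup>2"
          using a r8 u n by (intro frac_le power_mono zero_less_power) auto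
        also have "\<dots> = 64 * A\<^sup>2 * (n powr 1 * n powr (- g) * n powr (- g))"
          using n u by (simp add: u_def power2_eq_square)
        also have "n powr 1 * n powr (- g) * n powr (- g) = n powr q'"
        proof -
          have "1 + - g + - g = q'" by (simp add: g_def q'_def field_simps)
          then show ?thesis by (simp only: powr_add[symmetric])
        qed
        finally have ar: "a / (real r)\<^sup>2 \<le> 64 * A\<^sup>2 * n powr q'" .
        have "(n / 2) powr q \<le> t powr q" using t n q by (intro powr_mono2) auto
        then have "2 * (32 * n powr p + 1 + ln (3 * n)) + a / (real r)\<^sup>2 + ln 8 \<le> t powr q"
          using elim ar by linarith
        then have "exp (- (t powr q)) \<le> exp (- (2 * (32 * n powr p + 1 + ln (3 * n))) - a / (real r)\<^sup>2 - ln 8)"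
          by simp
        also have "\<dots> = exp (- (2 * (32 * n powr p + 1 + ln (3 * n)))) * exp (- (a / (real r)\<^sup>2)) / 8"
          by (simp only: exp_diff exp_minus) (simp add: field_simps)
        also have "\<dots> \<le> pmf (K a 0) x * exp (- (a / (real r)\<^sup>2)) / 8"
          using heat_kernel_lower_diffusive[OF n a(1,2) p _ xr] \<delta> p d
          by (intro divide_right_mono mult_right_mono) auto
        finally show ?thesis .
      qed
      ultimately show "exp (- (t powr (p + 3 * \<delta>))) \<le>
          prob {\<eta> \<in> space N. scenery_integral \<zeta> (\<lambda>u. S u \<eta>) t \<ge> c * t}" by (simp add: q_def)
    qed
  qed
qed

end

lemma stretched_exp_decayI:
  assumes "\<And>\<epsilon>. 0 < \<epsilon> \<Longrightarrow> eventually (\<lambda>t. exp (- (t powr (p + \<epsilon>))) \<le> F t \<and> F t \<le> exp (- (t powr (p - \<epsilon>)))) at_top"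
  shows "stretched_exp_decay F p"
  unfolding stretched_exp_decay_def
proof (rule tendstoI)
  fix e :: real assume e: "0 < e"
  have "eventually (\<lambda>t. exp (- (t powr (p + e / 2))) \<le> F t \<and> F t \<le> exp (- (t powr (p - e / 2)))) at_top"
    using assms[of "e / 2"] e by simp
  then show "eventually (\<lambda>t. dist (ln (- ln (F t)) / ln t) p < e) at_top"
    using eventually_gt_at_top[of 1]
  proof eventually_elim
    case (elim t)
    have F: "0 < F t" using elim by (meson exp_gt_zero less_le_trans)
    have "ln (exp (- (t powr (p + e / 2)))) \<le> ln (F t)" using elim F by (subst ln_le_cancel_iff) auto
    then have 1: "- ln (F t) \<le> t powr (p + e / 2)" by simp
    have "ln (F t) \<le> ln (exp (- (t powr (p - e / 2))))" using elim F by (subst ln_le_cancel_iff) auto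
    then have 2: "t powr (p - e / 2) \<le> - ln (F t)" by simp
    have t: "0 < t powr (p - e / 2)" "0 < ln t" using elim by auto
    have l: "0 < - ln (F t)" using 2 t(1) by linarith
    then have "ln (- ln (F t)) \<le> ln (t powr (p + e / 2))" using 1 by (intro ln_mono)
    then have 3: "ln (- ln (F t)) \<le> (p + e / 2) * ln t" using elim by (simp add: ln_powr)
    have "ln (t powr (p - e / 2)) \<le> ln (- ln (F t))" using 2 t(1) by (intro ln_mono)
    then have 4: "(p - e / 2) * ln t \<le> ln (- ln (F t))" using elim by (simp add: ln_powr)
    have "ln (- ln (F t)) / ln t \<le> p + e / 2" "p - e / 2 \<le> ln (- ln (F t)) / ln t"
      using 3 4 t by (simp_all add: pos_divide_le_eq pos_le_divide_eq)
    then show ?case using e by (simp add: dist_real_def abs_le_iff abs_less_iff)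
  qed
qed

theorem theorem2:
  fixes M :: "'a measure" and z :: "int ^ 'd::finite \<Rightarrow> 'a \<Rightarrow> real"
    and N :: "'b measure" and S :: "real \<Rightarrow> 'b \<Rightarrow> int ^ 'd"
    and \<alpha> c :: real
  assumes "prob_space M"
    and "iid_family M z"
    and "\<And>x. AE \<omega> in M. 0 \<le> z x \<omega>"
    and "0 < \<alpha>"
    and "polynomial_decay (\<lambda>r. measure M {\<omega> \<in> space M. z 0 \<omega> > r}) \<alpha>"
    and "ct_simple_random_walk N S"
    and "(CARD('d) = 1 \<and> \<alpha> > 1) \<or> (CARD('d) \<ge> 2 \<and> \<alpha> > real CARD('d) / 2)"
    and "c > prob_space.expectation M (z 0)"
  shows "AE \<omega> in M. stretched_exp_decay
           (\<lambda>t. measure N {\<eta> \<in> space N. scenery_integral (\<lambda>x. z x \<omega>) (\<lambda>u. S u \<eta>) t \<ge> c * t})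
           (if CARD('d) = 1 then (\<alpha> - 1) / (\<alpha> + 1)
            else (2 * \<alpha> - real CARD('d)) / (2 * \<alpha> + real CARD('d)))"
proof -
  have \<alpha>1: "1 < \<alpha>"
  proof (cases "CARD('d) = 1")
    case False
    then have "real CARD('d) \<ge> 2" "\<alpha> > real CARD('d) / 2" using assms(7) by auto
    then show ?thesis by linarith
  qed (use assms(7) in auto)
  interpret sc: lattice_scenery M z \<alpha>
    using assms \<alpha>1
    by (auto simp: lattice_scenery_def lattice_scenery_axioms_def iid_scenery_def iid_scenery_axioms_def)
  obtain K where K: "markov_semigroup K"
    "has_generator K (\<lambda>f x. discrete_laplacian f x / (2 * real CARD('d)))" "markov_jump_process N S K 0"
    using assms(6) by (auto simp: ct_simple_random_walk_def)
  interpret W: walk N S K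
    by (unfold walk_def jump_process_def) (use K in auto)
  define b where "b = (sc.mean + c) / 2"
  have c: "sc.mean < b" "b < c" "0 \<le> b" "0 < c"
    using assms(8) sc.mean_nonneg by (auto simp: b_def sc.mean_def)
  define \<delta>\<^sub>0 where "\<delta>\<^sub>0 = min (sc.p / 8) (min (sc.\<gamma> / 2) ((1 - sc.p) / 8))"
  have \<delta>\<^sub>0: "0 < \<delta>\<^sub>0" "\<delta>\<^sub>0 \<le> sc.p / 8" "\<delta>\<^sub>0 \<le> sc.\<gamma> / 2" "\<delta>\<^sub>0 \<le> (1 - sc.p) / 8"
    unfolding \<delta>\<^sub>0_def using sc.p01 sc.\<gamma> by (simp, linarith+)
  \<comment> \<open>A sequence of margins tending to 0: being countable, it lets one null set of
    sceneries serve for every \<open>\<epsilon>\<close>.\<close>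
  define \<delta> where "\<delta> m = \<delta>\<^sub>0 / real (Suc m)" for m
  have \<delta>: "0 < \<delta> m" "\<delta> m \<le> \<delta>\<^sub>0" for m
    using \<delta>\<^sub>0(1) by (auto simp: \<delta>_def divide_le_eq)
  have \<delta>b: "7 * \<delta> m < sc.p" "\<delta> m < sc.\<gamma>" "sc.p + 3 * \<delta> m < 1" for m
  proof -
    have "8 * \<delta>\<^sub>0 \<le> sc.p" "2 * \<delta>\<^sub>0 \<le> sc.\<gamma>" "8 * \<delta>\<^sub>0 \<le> 1 - sc.p" using \<delta>\<^sub>0 by simp_all
    then show "7 * \<delta> m < sc.p" "\<delta> m < sc.\<gamma>" "sc.p + 3 * \<delta> m < 1"
      using \<delta>[of m] by linarith+
  qed
  have "AE \<omega> in M. \<forall>m. eventually (\<lambda>k. \<exists>x\<in>cube (sc.R (2 ^ k)). (2 ^ k) powr (sc.\<gamma> - \<delta> m) < z x \<omega>) sequentially"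
    using sc.scenery_max_lower[OF \<delta>(1) \<delta>b(2)] by (simp add: AE_all_countable)
  moreover have "AE \<omega> in M. \<forall>m. eventually (\<lambda>k. \<forall>x.
      (\<Sum>y\<in>cube (sc.R (2 ^ k)). heat (sc.T (\<delta> m) (2 ^ k)) (x - y) * z y \<omega>) \<le> b \<and>
      (\<Sum>y\<in>cube (sc.R (2 ^ k)). green (sc.T (\<delta> m) (2 ^ k)) (x - y) * z y \<omega>) \<le> b * real (sc.T (\<delta> m) (2 ^ k))) sequentially"
  proof (subst AE_all_countable, intro allI)
    fix m
    have "4 * \<delta> m < sc.p" using \<delta>b(1)[of m] \<delta>(1)[of m] by linarith
    from sc.scenery_averages_upper[OF \<delta>(1) this c(1)]
    show "AE \<omega> in M. eventually (\<lambda>k. \<forall>x.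
      (\<Sum>y\<in>cube (sc.R (2 ^ k)). heat (sc.T (\<delta> m) (2 ^ k)) (x - y) * z y \<omega>) \<le> b \<and>
      (\<Sum>y\<in>cube (sc.R (2 ^ k)). green (sc.T (\<delta> m) (2 ^ k)) (x - y) * z y \<omega>) \<le> b * real (sc.T (\<delta> m) (2 ^ k))) sequentially" .
  qed
  moreover have "AE \<omega> in M. \<forall>y. 0 \<le> z y \<omega>" using assms(3) by (simp add: AE_all_countable)
  ultimately show ?thesis
  proof eventually_elim
    case (elim \<omega>)
    let ?F = "\<lambda>t. measure N {\<eta> \<in> space N. scenery_integral (\<lambda>x. z x \<omega>) (\<lambda>u. S u \<eta>) t \<ge> c * t}"
    have z0: "\<And>y. 0 \<le> z y \<omega>" using elim by simp
    have R1: "real (sc.R n) \<le> n powr ((1 + sc.p) / 2)" and R2: "n powr ((1 + sc.p) / 2) \<le> 2 * real (sc.R n)"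
      if "1 \<le> n" for n
      using sc.R_bounds[OF that] by (simp_all add: sc.\<beta>_def)
    have up: "eventually (\<lambda>t. ?F t \<le> exp (- (t powr (sc.p - 7 * \<delta> m)))) at_top" for m
    proof (rule W.upper_asymptotic[OF sc.p01 \<delta>(1) \<delta>b(1) c(3,2) z0])
      show "n powr ((1 + sc.p) / 2) \<le> 2 * real (sc.R n)" if "1 \<le> n" for n by (rule R2[OF that])
      show "real (sc.T (\<delta> m) n) \<le> 2 * n powr (1 - sc.p + 4 * \<delta> m)" if "1 \<le> n" for n
        using sc.T_bounds[OF that \<delta>(1)[of m]] \<delta>b(1)[of m] \<delta>(1)[of m] by auto
    qed (use elim in blast)+
    have lo: "eventually (\<lambda>t. exp (- (t powr (sc.p + 3 * \<delta> m))) \<le> ?F t) at_top" for m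
    proof (cases "CARD('d) = 1")
      case True
      have gam: "sc.\<gamma> = (1 - sc.p) / 2" using True by (simp add: sc.\<gamma>_def sc.\<kappa>_def)
      have env: "eventually (\<lambda>k. \<exists>x\<in>cube (sc.R (2 ^ k)). (2 ^ k) powr ((1 - sc.p) / 2 - \<delta> m) < z x \<omega>) sequentially"
        using elim(1)[rule_format, of m] unfolding gam .
      show ?thesis
        by (rule W.lower_asymptotic_one_dim[OF True sc.p01(1) \<delta>(1) \<delta>b(3) c(4) z0 _ env]) (rule R1)
    next
      case False
      have gam: "sc.\<gamma> = 1 - sc.p" using False by (simp add: sc.\<gamma>_def sc.\<kappa>_def)
      have env: "eventually (\<lambda>k. \<exists>x\<in>cube (sc.R (2 ^ k)). (2 ^ k) powr (1 - sc.p - \<delta> m) < z x \<omega>) sequentially"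
        using elim(1)[rule_format, of m] unfolding gam .
      have p2: "sc.p + 2 * \<delta> m < 1" using \<delta>b(3)[of m] \<delta>(1)[of m] by linarith
      have "eventually (\<lambda>t. exp (- (t powr (sc.p + 2 * \<delta> m))) \<le> ?F t) at_top"
        by (rule W.lower_asymptotic_general[OF sc.p01(1) \<delta>(1) p2 c(4) z0 _ env]) (rule R1)
      then show ?thesis using eventually_ge_at_top[of 1]
      proof eventually_elim
        case (elim t)
        have "t powr (sc.p + 2 * \<delta> m) \<le> t powr (sc.p + 3 * \<delta> m)"
          using elim \<delta>(1)[of m] by (intro powr_mono) auto
        then have "exp (- (t powr (sc.p + 3 * \<delta> m))) \<le> exp (- (t powr (sc.p + 2 * \<delta> m)))" by simp
        then show ?case using elim by linarith
      qed
    qed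
    have "stretched_exp_decay ?F sc.p"
    proof (rule stretched_exp_decayI)
      fix \<epsilon> :: real assume \<epsilon>: "0 < \<epsilon>"
      obtain m where m: "7 * \<delta>\<^sub>0 / \<epsilon> < real m" using reals_Archimedean2 by blast
      have "7 * \<delta>\<^sub>0 < \<epsilon> * real (Suc m)" using m \<epsilon> by (simp add: divide_less_eq algebra_simps)
      then have 7: "7 * \<delta> m \<le> \<epsilon>" by (simp add: \<delta>_def divide_le_eq)
      show "eventually (\<lambda>t. exp (- (t powr (sc.p + \<epsilon>))) \<le> ?F t \<and> ?F t \<le> exp (- (t powr (sc.p - \<epsilon>)))) at_top"
        using up[of m] lo[of m] eventually_ge_at_top[of 1]
      proof eventually_elim
        case (elim t)
        have "t powr (sc.p + 3 * \<delta> m) \<le> t powr (sc.p + \<epsilon>)" "t powr (sc.p - \<epsilon>) \<le> t powr (sc.p - 7 * \<delta> m)"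
          using elim 7 \<delta>(1)[of m] by (auto intro!: powr_mono)
        then have "exp (- (t powr (sc.p + \<epsilon>))) \<le> exp (- (t powr (sc.p + 3 * \<delta> m)))"
          "exp (- (t powr (sc.p - 7 * \<delta> m))) \<le> exp (- (t powr (sc.p - \<epsilon>)))" by simp_all
        then show ?case using elim by linarith
      qed
    qed
    then show ?case by (simp only: sc.p_def)
  qed
qed

end
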